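(* Let $(V,\Omega)$ be a finite-dimensional real symplectic vector space, $\tilde\jmath$ a compatible complex structure on $(V,\Omega)$ (not necessarily positive), and $j\in j_+(V,\Omega)$ a positive compatible complex structure commuting with $\tilde\jmath$. Then the pseudo-unitary group $U(V,\Omega,\tilde\jmath)=\{g\in Sp(V,\Omega)\mid g\tilde\jmath=\tilde\jmath g\}$ embeds in $Mp^c(V,\Omega,j)$: the map $$F_{\tilde\jmath,j}:U(V,\Omega,\tilde\jmath)\to Mp^c(V,\Omega,j),\qquad g\mapsto(U_{g,\lambda},g)\quad\text{with }\lambda=\left(\mathrm{Det}_jC_g^-\right)^{-1},$$ where $C_g^-$ is the restriction of $C_g=\frac12(g-jgj)$ to the invariant subspace $V_-=\{v\in V\mid\tilde\jmath v=-jv\}$, is an injective homomorphism lifting the inclusion of $U(V,\Omega,\tilde\jmath)$ in $Sp(V,\Omega)$ (i.e. $\sigma\circ F_{\tilde\jmath,j}$ is the inclusion).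
   Context: Fix $h>0$, $\hbar=h/2\pi$; $\dim_{\mathbb R} V=2n$. A compatible complex structure on $(V,\Omega)$ is $\tilde\jmath\in Sp(V,\Omega)$ with $\tilde\jmath^2=-\mathrm{Id}$; it is positive if $\Omega(v,\tilde\jmath v)>0$ for all $v\neq0$; $j_+(V,\Omega)$ is the set of positive ones. For $j\in j_+(V,\Omega)$ put $\langle v,w\rangle_j=\Omega(v,jw)-i\Omega(v,w)$ (complex linear in the first argument). $\mathcal H(V,\Omega,j)$ is the Hilbert space of $j$-holomorphic functions $f$ on $V$ with $\|f\|^2=h^{-n}\int_V|f(z)|^2e^{-\langle z,z\rangle_j/2\hbar}dz<\infty$ ($dz$ the normalised Lebesgue measure). The Heisenberg group $V\times\mathbb R$, with product $(v_1,t_1)(v_2,t_2)=(v_1+v_2,t_1+t_2-\frac12\Omega(v_1,v_2))$, acts on it unitarily and irreducibly by $(U_j(v,t)f)(z)=e^{-it/\hbar+\langle z,v\rangle_j/2\hbar-\langle v,v\rangle_j/4\hbar}f(z-v)$. $Mp^c(V,\Omega,j)$ is the group of pairs $(U,g)$, $U$ unitary on $\mathcal H(V,\Omega,j)$, $g\in Sp(V,\Omega)$, with $U_j(gv,t)=U\,U_j(v,t)\,U^{-1}$ for all $(v,t)$, with diagonal multiplication; $\sigma(U,g)=g$. For $g\in Sp(V,\Omega)$: $C_g=\frac12(g-jgj)$ ($j$-linear, invertible) and $Z_g=C_g^{-1}\cdot\frac12(g+jgj)$ ($j$-antilinear). $\mathrm{Det}_j$ is the complex determinant of $j$-linear maps.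 On the contractible open set of $j$-linear maps $x$ of $V$ with $x+x^*$ positive definite, $a$ is the unique smooth function with $\mathrm{Det}_jx=e^{a(x)}$, $a(I)=0$. Known facts: let $e_v(z)=e^{\langle z,v\rangle_j/2\hbar}$. Every $(U,g)\in Mp^c(V,\Omega,j)$ satisfies $(Ue_v)(z)=\lambda\exp\frac1{4\hbar}\{2\langle C_g^{-1}z,v\rangle_j-\langle z,Z_{g^{-1}}z\rangle_j-\langle Z_gv,v\rangle_j\}$ with $\lambda=(Ue_0)(0)$ and $|\lambda^2\mathrm{Det}_jC_g|=1$; conversely for each $g\in Sp(V,\Omega)$ and $\lambda\in\mathbb C$ with $|\lambda^2\mathrm{Det}_jC_g|=1$ this formula defines a unitary $U_{g,\lambda}$ with $(U_{g,\lambda},g)\in Mp^c(V,\Omega,j)$; $(g,\lambda)$ are the parameters of this element. The product of elements with parameters $(g_1,\lambda_1),(g_2,\lambda_2)$ has parameters $\left(g_1g_2,\ \lambda_1\lambda_2e^{-\frac12a(1-Z_{g_1}Z_{g_2^{-1}})}\right)$. *)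

theory Defs
  imports
    "HOL-Analysis.Analysis"
    "HOL-Algebra.Group"
    "Jordan_Normal_Form.Determinant"
begin

text \<open>
  The vector space \<open>V\<close> is the universe of a type of class \<open>real_normed_vector\<close> that is assumed to
  have finite dimension. The norm is auxiliary: it only provides the canonical topology of a
  finite-dimensional real vector space, to speak about derivatives and Borel sets. The zero
  space is allowed.
\<close>

definition symplectic_form :: "('v::real_normed_vector \<Rightarrow> 'v \<Rightarrow> real) \<Rightarrow> bool" where
  "symplectic_form \<Omega> \<longleftrightarrow>
     (\<exists>B::'v set. finite B \<and> span B = UNIV) \<and>
     bilinear \<Omega> \<and> (\<forall>v. \<Omega> v v = 0) \<and> (\<forall>v. (\<forall>w. \<Omega> v w = 0) \<longrightarrow> v = 0)"

definition Sp :: "('v::real_normed_vector \<Rightarrow> 'v \<Rightarrow> real) \<Rightarrow> ('v \<Rightarrow> 'v) set" where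
  "Sp \<Omega> = {g. linear g \<and> bij g \<and> (\<forall>v w. \<Omega> (g v) (g w) = \<Omega> v w)}"

definition compatible_cs ::
  "('v::real_normed_vector \<Rightarrow> 'v \<Rightarrow> real) \<Rightarrow> ('v \<Rightarrow> 'v) \<Rightarrow> bool" where
  "compatible_cs \<Omega> j \<longleftrightarrow> j \<in> Sp \<Omega> \<and> (\<forall>v. j (j v) = - v)"

definition j_plus :: "('v::real_normed_vector \<Rightarrow> 'v \<Rightarrow> real) \<Rightarrow> ('v \<Rightarrow> 'v) set" where
  "j_plus \<Omega> = {j. compatible_cs \<Omega> j \<and> (\<forall>v. v \<noteq> 0 \<longrightarrow> \<Omega> v (j v) > 0)}"

definition pseudo_unitary_group ::
  "('v::real_normed_vector \<Rightarrow> 'v \<Rightarrow> real) \<Rightarrow> ('v \<Rightarrow> 'v) \<Rightarrow> ('v \<Rightarrow> 'v) monoid" where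
  "pseudo_unitary_group \<Omega> jt =
     \<lparr>carrier = {g \<in> Sp \<Omega>. g \<circ> jt = jt \<circ> g}, mult = (\<circ>), one = id\<rparr>"

definition herm ::
  "('v::real_normed_vector \<Rightarrow> 'v \<Rightarrow> real) \<Rightarrow> ('v \<Rightarrow> 'v) \<Rightarrow> 'v \<Rightarrow> 'v \<Rightarrow> complex" where
  "herm \<Omega> j v w = complex_of_real (\<Omega> v (j w)) - \<i> * complex_of_real (\<Omega> v w)"

definition C_part :: "('v::real_normed_vector \<Rightarrow> 'v) \<Rightarrow> ('v \<Rightarrow> 'v) \<Rightarrow> 'v \<Rightarrow> 'v" where
  "C_part j g v = (1/2) *\<^sub>R (g v - j (g (j v)))"

definition Z_part :: "('v::real_normed_vector \<Rightarrow> 'v) \<Rightarrow> ('v \<Rightarrow> 'v) \<Rightarrow> 'v \<Rightarrow> 'v" where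
  "Z_part j g v = inv_into UNIV (C_part j g) ((1/2) *\<^sub>R (g v + j (g (j v))))"

definition V_minus :: "('v::real_normed_vector \<Rightarrow> 'v) \<Rightarrow> ('v \<Rightarrow> 'v) \<Rightarrow> 'v set" where
  "V_minus jt j = {v. jt v = - j v}"

definition C_minus ::
  "('v::real_normed_vector \<Rightarrow> 'v) \<Rightarrow> ('v \<Rightarrow> 'v) \<Rightarrow> ('v \<Rightarrow> 'v) \<Rightarrow> 'v \<Rightarrow> 'v" where
  "C_minus jt j g = restrict (C_part j g) (V_minus jt j)"

definition jscale :: "('v::real_normed_vector \<Rightarrow> 'v) \<Rightarrow> complex \<Rightarrow> 'v \<Rightarrow> 'v" where
  "jscale j c v = Re c *\<^sub>R v + Im c *\<^sub>R j v"

lemma vector_space_jscale: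
  assumes "linear j" "\<And>v. j (j v) = - v"
  shows "vector_space (jscale j)"
proof -
  interpret linear j by fact
  show ?thesis
    by standard (simp_all add: jscale_def add scale assms(2) algebra_simps)
qed

definition is_jbasis :: "('v::real_normed_vector \<Rightarrow> 'v) \<Rightarrow> 'v set \<Rightarrow> 'v list \<Rightarrow> bool" where
  "is_jbasis j W bs \<longleftrightarrow>
     distinct bs \<and> \<not> Modules.module.dependent (jscale j) (set bs) \<and>
     Modules.module.span (jscale j) (set bs) = W"

text \<open>
  Determinant of a \<open>j\<close>-linear endomorphism \<open>A\<close> of a \<open>j\<close>-invariant subspace \<open>W\<close>; the value does not
  depend on the chosen basis, and it is \<open>1\<close> if \<open>W = {0}\<close>.
\<close>

definition Det_on ::
  "('v::real_normed_vector \<Rightarrow> 'v) \<Rightarrow> 'v set \<Rightarrow> ('v \<Rightarrow> 'v) \<Rightarrow> complex" where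
  "Det_on j W A =
     (let bs = (SOME bs. is_jbasis j W bs); m = length bs
      in Determinant.det (Matrix.mat m m (\<lambda>(r, c).
           Modules.module.representation (jscale j) (set bs) (A (bs ! c)) (bs ! r))))"

definition hbar :: "real \<Rightarrow> real" where
  "hbar h = h / (2 * pi)"

definition is_unitary_basis ::
  "('v::real_normed_vector \<Rightarrow> 'v \<Rightarrow> real) \<Rightarrow> ('v \<Rightarrow> 'v) \<Rightarrow> 'v list \<Rightarrow> bool" where
  "is_unitary_basis \<Omega> j bs \<longleftrightarrow>
     is_jbasis j UNIV bs \<and>
     (\<forall>k < length bs. \<forall>l < length bs. herm \<Omega> j (bs ! k) (bs ! l) = (if k = l then 1 else 0))"

text \<open>
  Normalised Lebesgue measure: the image of the Lebesgue measure of \<open>\<complex>\<^sup>n\<close> under the isomorphism with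
  \<open>V\<close> given by a unitary basis (any choice gives the same measure). Equivalently, the unit cube on
  a real orthonormal basis for \<open>Re \<langle>v,w\<rangle>\<^sub>j\<close> has volume \<open>1\<close>; with this normalisation the constant
  function \<open>1\<close> has norm \<open>1\<close> in the Fock space.
\<close>

definition lebesgue_V ::
  "('v::real_normed_vector \<Rightarrow> 'v \<Rightarrow> real) \<Rightarrow> ('v \<Rightarrow> 'v) \<Rightarrow> 'v measure" where
  "lebesgue_V \<Omega> j =
     (let bs = (SOME bs. is_unitary_basis \<Omega> j bs); n = length bs
      in distr (Pi\<^sub>M {..<n} (\<lambda>_. (lborel :: complex measure))) borel
           (\<lambda>x. \<Sum>k<n. jscale j (x k) (bs ! k)))"

definition j_holomorphic :: "('v::real_normed_vector \<Rightarrow> 'v) \<Rightarrow> ('v \<Rightarrow> complex) \<Rightarrow> bool" where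
  "j_holomorphic j f \<longleftrightarrow>
     (\<forall>z. \<exists>D. (f has_derivative D) (at z) \<and> (\<forall>v. D (j v) = \<i> * D v))"

definition gauss_weight ::
  "real \<Rightarrow> ('v::real_normed_vector \<Rightarrow> 'v \<Rightarrow> real) \<Rightarrow> ('v \<Rightarrow> 'v) \<Rightarrow> 'v \<Rightarrow> real" where
  "gauss_weight h \<Omega> j z = exp (- Re (herm \<Omega> j z z) / (2 * hbar h))"

definition Fock ::
  "real \<Rightarrow> ('v::real_normed_vector \<Rightarrow> 'v \<Rightarrow> real) \<Rightarrow> ('v \<Rightarrow> 'v) \<Rightarrow> ('v \<Rightarrow> complex) set" where
  "Fock h \<Omega> j =
     {f. j_holomorphic j f \<and>
         integrable (lebesgue_V \<Omega> j) (\<lambda>z. (cmod (f z))\<^sup>2 * gauss_weight h \<Omega> j z)}"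

definition Fock_inner ::
  "real \<Rightarrow> ('v::real_normed_vector \<Rightarrow> 'v \<Rightarrow> real) \<Rightarrow> ('v \<Rightarrow> 'v) \<Rightarrow>
     ('v \<Rightarrow> complex) \<Rightarrow> ('v \<Rightarrow> complex) \<Rightarrow> complex" where
  "Fock_inner h \<Omega> j f1 f2 =
     (LINT z|lebesgue_V \<Omega> j. f1 z * cnj (f2 z) * complex_of_real (gauss_weight h \<Omega> j z))
       / complex_of_real (h ^ (dim (UNIV :: 'v set) div 2))"

text \<open>
  Operators on the Fock space are represented by functions that are \<open>undefined\<close> outside it, so that
  equality of operators is equality of functions.
\<close>

definition Fock_unitary ::
  "real \<Rightarrow> ('v::real_normed_vector \<Rightarrow> 'v \<Rightarrow> real) \<Rightarrow> ('v \<Rightarrow> 'v) \<Rightarrow>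
     (('v \<Rightarrow> complex) \<Rightarrow> ('v \<Rightarrow> complex)) set" where
  "Fock_unitary h \<Omega> j =
     {U. U \<in> extensional (Fock h \<Omega> j) \<and>
         bij_betw U (Fock h \<Omega> j) (Fock h \<Omega> j) \<and>
         (\<forall>f1 \<in> Fock h \<Omega> j. \<forall>f2 \<in> Fock h \<Omega> j. U (\<lambda>z. f1 z + f2 z) = (\<lambda>z. U f1 z + U f2 z)) \<and>
         (\<forall>c. \<forall>f \<in> Fock h \<Omega> j. U (\<lambda>z. c * f z) = (\<lambda>z. c * U f z)) \<and>
         (\<forall>f1 \<in> Fock h \<Omega> j. \<forall>f2 \<in> Fock h \<Omega> j.
            Fock_inner h \<Omega> j (U f1) (U f2) = Fock_inner h \<Omega> j f1 f2)}"

definition heisenberg_op ::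
  "real \<Rightarrow> ('v::real_normed_vector \<Rightarrow> 'v \<Rightarrow> real) \<Rightarrow> ('v \<Rightarrow> 'v) \<Rightarrow> 'v \<Rightarrow> real \<Rightarrow>
     ('v \<Rightarrow> complex) \<Rightarrow> ('v \<Rightarrow> complex)" where
  "heisenberg_op h \<Omega> j v t =
     (\<lambda>f \<in> Fock h \<Omega> j. \<lambda>z.
        exp (- \<i> * complex_of_real t / complex_of_real (hbar h)
             + herm \<Omega> j z v / complex_of_real (2 * hbar h)
             - herm \<Omega> j v v / complex_of_real (4 * hbar h)) * f (z - v))"

definition Mpc ::
  "real \<Rightarrow> ('v::real_normed_vector \<Rightarrow> 'v \<Rightarrow> real) \<Rightarrow> ('v \<Rightarrow> 'v) \<Rightarrow>
     ((('v \<Rightarrow> complex) \<Rightarrow> ('v \<Rightarrow> complex)) \<times> ('v \<Rightarrow> 'v)) monoid" where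
  "Mpc h \<Omega> j =
     \<lparr>carrier = {(U, g). U \<in> Fock_unitary h \<Omega> j \<and> g \<in> Sp \<Omega> \<and>
         (\<forall>v t. \<forall>f \<in> Fock h \<Omega> j.
            heisenberg_op h \<Omega> j (g v) t f
              = U (heisenberg_op h \<Omega> j v t (inv_into (Fock h \<Omega> j) U f)))},
      mult = (\<lambda>(U1, g1) (U2, g2). (compose (Fock h \<Omega> j) U1 U2, g1 \<circ> g2)),
      one = ((\<lambda>f \<in> Fock h \<Omega> j. f), id)\<rparr>"

definition Mpc_sigma ::
  "(('v::real_normed_vector \<Rightarrow> complex) \<Rightarrow> ('v \<Rightarrow> complex)) \<times> ('v \<Rightarrow> 'v) \<Rightarrow> ('v \<Rightarrow> 'v)" where
  "Mpc_sigma X = snd X"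

definition coherent ::
  "real \<Rightarrow> ('v::real_normed_vector \<Rightarrow> 'v \<Rightarrow> real) \<Rightarrow> ('v \<Rightarrow> 'v) \<Rightarrow> 'v \<Rightarrow> 'v \<Rightarrow> complex" where
  "coherent h \<Omega> j v z = exp (herm \<Omega> j z v / complex_of_real (2 * hbar h))"

definition has_parameters ::
  "real \<Rightarrow> ('v::real_normed_vector \<Rightarrow> 'v \<Rightarrow> real) \<Rightarrow> ('v \<Rightarrow> 'v) \<Rightarrow>
     (('v \<Rightarrow> complex) \<Rightarrow> ('v \<Rightarrow> complex)) \<Rightarrow> ('v \<Rightarrow> 'v) \<Rightarrow> complex \<Rightarrow> bool" where
  "has_parameters h \<Omega> j U g lam \<longleftrightarrow>
     (\<forall>v z. U (coherent h \<Omega> j v) z =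
        lam * exp ((2 * herm \<Omega> j (inv_into UNIV (C_part j g) z) v
                   - herm \<Omega> j z (Z_part j (inv_into UNIV g) z)
                   - herm \<Omega> j (Z_part j g v) v) / complex_of_real (4 * hbar h)))"

text \<open>
  Uniqueness in the next definition comes from the totality of the coherent states in the Fock
  space; existence requires the modulus of \<open>lam\<close> to be the right one.
\<close>

definition U_op ::
  "real \<Rightarrow> ('v::real_normed_vector \<Rightarrow> 'v \<Rightarrow> real) \<Rightarrow> ('v \<Rightarrow> 'v) \<Rightarrow> ('v \<Rightarrow> 'v) \<Rightarrow> complex \<Rightarrow>
     ('v \<Rightarrow> complex) \<Rightarrow> ('v \<Rightarrow> complex)" where
  "U_op h \<Omega> j g lam = (THE U. U \<in> Fock_unitary h \<Omega> j \<and> has_parameters h \<Omega> j U g lam)"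

definition F_lambda ::
  "('v::real_normed_vector \<Rightarrow> 'v) \<Rightarrow> ('v \<Rightarrow> 'v) \<Rightarrow> ('v \<Rightarrow> 'v) \<Rightarrow> complex" where
  "F_lambda jt j g = inverse (Det_on j (V_minus jt j) (C_minus jt j g))"

definition F_map ::
  "real \<Rightarrow> ('v::real_normed_vector \<Rightarrow> 'v \<Rightarrow> real) \<Rightarrow> ('v \<Rightarrow> 'v) \<Rightarrow> ('v \<Rightarrow> 'v) \<Rightarrow> ('v \<Rightarrow> 'v) \<Rightarrow>
     (('v \<Rightarrow> complex) \<Rightarrow> ('v \<Rightarrow> complex)) \<times> ('v \<Rightarrow> 'v)" where
  "F_map h \<Omega> jt j g = (U_op h \<Omega> j g (F_lambda jt j g), g)"

end

theory Submission
  imports Defs "HOL-Real_Asymp.Real_Asymp" "HOL-Complex_Analysis.Cauchy_Integral_Formula"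
begin

text \<open>
  Averaging over rotations gives the reproducing property \<open>\<langle>f, e\<^sub>v\<rangle> = f(v)\<close>; so a unitary operator is
  determined by its values on the coherent states. The operator with parameters \<open>(g, \<lambda>)\<close> is the
  integral operator whose kernel \<open>K\<^sub>g(v)(z)\<close> is the prescribed image of \<open>e\<^sub>v\<close>. The kernels are covariant
  under Weyl operators, so the quotient of \<open>\<langle>K\<^sub>g(v), K\<^sub>k(z)\<rangle>\<close> by \<open>K\<^bsub>k'g\<^esub>(v)(z)\<close>, with \<open>k'\<close> the inverse of \<open>k\<close>,
  depends on \<open>z - k'gv\<close> only. It is holomorphic in \<open>z\<close> and antiholomorphic in \<open>v\<close>, hence a constant
  \<open>J\<close>. This composition rule gives unitarity, first on the dilated functions \<open>f(rz)\<close> with \<open>r < 1\<close> by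
  Fubini, then on all of the Fock space by Fatou's lemma.

  For pseudo-unitary maps the antilinear parts \<open>Z\<close> interchange \<open>V\<^sub>+\<close> and \<open>V\<^sub>-\<close>. After conjugating the
  coordinates on \<open>V\<^sub>+\<close> the Gaussian integral \<open>J\<close> becomes sesquilinear, and it evaluates to the inverse
  of the determinant of \<open>1 - Z\<^sub>1Z\<^sub>2'\<close> on \<open>V\<^sub>-\<close>, without a square root. Since \<open>C\<^sub>1\<^sub>2 = C\<^sub>1(1 - Z\<^sub>1Z\<^sub>2')C\<^sub>2\<close>, this is the
  factor by which the determinants of the \<open>C\<close> on \<open>V\<^sub>-\<close> fail to be multiplicative.
\<close>

text \<open>The obstacle is the square root. For general symplectic maps the constant J of the
  composition rule is an inverse square root of a determinant, whose branch has to be followed; a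
  phase fixed pointwise would not multiply.

  Bijectivity is obtained without a completeness or density argument: conjugating a kernel and
  exchanging its arguments gives the kernel of the inverse map, so the operator with parameters
  (g^-1, conjugate of lambda) is an explicit two-sided inverse. The condition on the modulus of
  lambda takes the form |lambda|^2 J(g^-1, g) = |lambda|^2 J(g, g^-1) = 1.

  Dilations enter because a Fock function may grow like exp(nm(z)/(4 hbar)), which is borderline for
  Fubini; f(rz) grows strictly slower.

  Conjugating some coordinates is not complex linear, so it has to be justified for the measure.
  Uniqueness of Haar measure does this: the Gaussian measure has the same form in every
  real-additive isometric parametrisation of V.\<close>

locale fock_space =
  fixes h :: real and \<Omega> :: "'v::real_normed_vector \<Rightarrow> 'v \<Rightarrow> real" and j :: "'v \<Rightarrow> 'v"
  assumes h_pos: "h > 0" and sympl: "symplectic_form \<Omega>" and j_plus: "j \<in> j_plus \<Omega>"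
begin

section \<open>The Hermitian form and its norm\<close>

abbreviation "H \<equiv> herm \<Omega> j"
abbreviation "sc \<equiv> jscale j"

text \<open>The squared Hermitian norm, as a real number.\<close>

definition nm :: "'v \<Rightarrow> real" where "nm v = \<Omega> v (j v)"

lemma bilin: "bilinear \<Omega>" using sympl by (simp add: symplectic_form_def)

lemma linear_j: "linear j" and j_j [simp]: "j (j v) = - v" and \<Omega>_j_j [simp]: "\<Omega> (j v) (j w) = \<Omega> v w"
  using j_plus by (auto simp: j_plus_def compatible_cs_def Sp_def)

lemma \<Omega>_left: "linear (\<lambda>v. \<Omega> v w)" and \<Omega>_right: "linear (\<Omega> v)"
  using bilin by (auto simp: bilinear_def)

lemmas \<Omega>_simps = linear_add[OF \<Omega>_left] linear_add[OF \<Omega>_right]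
  linear_diff[OF \<Omega>_left] linear_diff[OF \<Omega>_right]
  linear_neg[OF \<Omega>_left] linear_neg[OF \<Omega>_right]
  linear_scale[OF \<Omega>_left] linear_scale[OF \<Omega>_right]
  linear_0[OF \<Omega>_left] linear_0[OF \<Omega>_right]

lemmas j_simps [simp] = linear_add[OF linear_j] linear_diff[OF linear_j] linear_neg[OF linear_j]
  linear_scale[OF linear_j] linear_0[OF linear_j]

lemma \<Omega>_self [simp]: "\<Omega> v v = 0"
  using sympl by (simp add: symplectic_form_def)

lemma \<Omega>_skew: "\<Omega> v w = - \<Omega> w v"
proof -
  have "\<Omega> (v + w) (v + w) = 0" by (rule \<Omega>_self)
  thus ?thesis by (simp add: \<Omega>_simps del: \<Omega>_self) (simp add: add_eq_0_iff)
qed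

lemma \<Omega>_j_left: "\<Omega> (j v) w = - \<Omega> v (j w)"
proof -
  have "\<Omega> (j (j v)) (j w) = \<Omega> (j v) w" by (rule \<Omega>_j_j)
  thus ?thesis by (simp add: \<Omega>_simps)
qed

lemma nm_pos: "v \<noteq> 0 \<Longrightarrow> nm v > 0"
  using j_plus by (auto simp: nm_def j_plus_def)

lemma nm_nonneg [simp]: "nm v \<ge> 0"
  using nm_pos[of v] by (cases "v = 0") (auto simp: nm_def \<Omega>_simps)

lemma nm_eq_0_iff [simp]: "nm v = 0 \<longleftrightarrow> v = 0"
  using nm_pos[of v] by (cases "v = 0") (auto simp: nm_def \<Omega>_simps)

lemma H_self: "H v v = complex_of_real (nm v)"
  by (simp add: herm_def nm_def)

lemma H_cnj: "cnj (H v w) = H w v"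
  using \<Omega>_skew[of w v] \<Omega>_skew[of w "j v"] by (simp add: herm_def \<Omega>_j_left)

lemma H_add_left: "H (u + v) w = H u w + H v w"
  and H_add_right: "H w (u + v) = H w u + H w v"
  and H_diff_left: "H (u - v) w = H u w - H v w"
  and H_diff_right: "H w (u - v) = H w u - H w v"
  and H_minus_left: "H (- v) w = - H v w"
  and H_minus_right: "H w (- v) = - H w v"
  and H_0_left [simp]: "H 0 w = 0"
  and H_0_right [simp]: "H w 0 = 0"
  by (simp_all add: herm_def \<Omega>_simps algebra_simps)

lemma H_scaleR_left: "H (r *\<^sub>R v) w = of_real r * H v w"
  and H_scaleR_right: "H w (r *\<^sub>R v) = of_real r * H w v"
  by (simp_all add: herm_def \<Omega>_simps algebra_simps)

lemma H_j_left: "H (j v) w = \<i> * H v w"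
  by (simp add: herm_def \<Omega>_j_left complex_eq_iff \<Omega>_simps)

lemma H_j_right: "H w (j v) = - \<i> * H w v"
  by (metis H_cnj H_j_left complex_cnj_i complex_cnj_mult)

lemmas H_simps = H_add_left H_add_right H_diff_left H_diff_right H_minus_left H_minus_right
  H_scaleR_left H_scaleR_right H_j_left H_j_right

lemma H_sc_left: "H (sc c v) w = c * H v w"
  by (simp add: jscale_def H_simps complex_eq_iff)

lemma H_sc_right: "H w (sc c v) = cnj c * H w v"
  by (simp add: jscale_def H_simps complex_eq_iff)

lemma H_sum_left: "H (\<Sum>i\<in>A. f i) w = (\<Sum>i\<in>A. H (f i) w)"
  by (induction A rule: infinite_finite_induct) (auto simp: H_add_left)

lemma H_sum_right: "H w (\<Sum>i\<in>A. f i) = (\<Sum>i\<in>A. H w (f i))"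
  by (induction A rule: infinite_finite_induct) (auto simp: H_add_right)

lemma nm_Re: "nm v = Re (H v v)"
  by (simp add: H_self)

lemma nm_minus [simp]: "nm (- v) = nm v"
  by (simp add: nm_def \<Omega>_simps)

lemma nm_0 [simp]: "nm 0 = 0" by simp

lemma nm_j [simp]: "nm (j v) = nm v"
  by (simp add: nm_def \<Omega>_j_left \<Omega>_simps)

lemma nm_scaleR: "nm (r *\<^sub>R v) = r\<^sup>2 * nm v"
  by (simp add: nm_def \<Omega>_simps power2_eq_square)

lemma nm_sc: "nm (sc c v) = (cmod c)\<^sup>2 * nm v"
proof -
  have "complex_of_real (nm (sc c v)) = c * cnj c * of_real (nm v)"
    by (simp only: H_self[symmetric] H_sc_left H_sc_right mult_ac)
  also have "\<dots> = of_real ((cmod c)\<^sup>2 * nm v)"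
    by (simp only: complex_norm_square of_real_mult mult_ac)
  finally show ?thesis by (simp only: of_real_eq_iff)
qed

lemma nm_add: "nm (u + v) = nm u + 2 * Re (H u v) + nm v"
proof -
  have "Re (H v u) = Re (H u v)" by (metis H_cnj cnj.simps(1))
  thus ?thesis by (simp add: nm_Re H_simps)
qed

lemma nm_diff: "nm (u - v) = nm u - 2 * Re (H u v) + nm v"
  using nm_add[of u "- v"] by (simp add: H_simps)

text \<open>Cauchy-Schwarz: subtracting from v its projection \<open>sc c w\<close> on the complex
  line of w leaves a vector of nonnegative squared norm.\<close>

lemma cmod_H_le: "(cmod (H v w))\<^sup>2 \<le> nm v * nm w"
proof (cases "w = 0")
  case False
  define c where "c = H v w / of_real (nm w)"
  have w: "nm w > 0" using False nm_pos by auto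
  have "0 \<le> nm (v - sc c w)" by simp
  also have "\<dots> = nm v - 2 * Re (cnj c * H v w) + (cmod c)\<^sup>2 * nm w"
    by (simp add: nm_diff nm_sc H_sc_right)
  also have "cnj c * H v w = of_real ((cmod (H v w))\<^sup>2 / nm w)"
    by (simp add: c_def complex_norm_square del: of_real_power)
  also have "(cmod c)\<^sup>2 * nm w = (cmod (H v w))\<^sup>2 / nm w"
    using w by (simp add: c_def norm_divide power_divide power2_eq_square field_simps)
  finally have "0 \<le> nm v - (cmod (H v w))\<^sup>2 / nm w" by simp
  thus ?thesis using w by (simp add: field_simps)
qed auto

lemma J_vs: "vector_space sc"
  by (rule vector_space_jscale[OF linear_j j_j])

lemma sc_0 [simp]: "sc c 0 = 0" "sc 0 v = 0" and sc_1 [simp]: "sc 1 v = v"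
  and sc_add_left: "sc (a + b) v = sc a v + sc b v"
  by (simp_all add: jscale_def algebra_simps)

lemma sc_sc: "sc a (sc b v) = sc (a * b) v"
  by (simp add: jscale_def algebra_simps)

lemma sc_of_real: "sc (of_real r) v = r *\<^sub>R v" by (simp add: jscale_def)

subsection \<open>Orthonormal bases\<close>

definition orthonormal :: "'v set \<Rightarrow> 'v list \<Rightarrow> bool" where
  "orthonormal W bs \<longleftrightarrow> set bs \<subseteq> W \<and>
     (\<forall>k < length bs. \<forall>l < length bs. H (bs ! k) (bs ! l) = (if k = l then 1 else 0))"

definition orthonormal_basis :: "'v set \<Rightarrow> 'v list \<Rightarrow> bool" where
  "orthonormal_basis W bs \<longleftrightarrow> orthonormal W bs \<and> (\<forall>w\<in>W. w = (\<Sum>k<length bs. sc (H w (bs ! k)) (bs ! k)))"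

lemma orthonormal_nth: "orthonormal W bs \<Longrightarrow> k < length bs \<Longrightarrow> l < length bs \<Longrightarrow> H (bs ! k) (bs ! l) = (if k = l then 1 else 0)"
  by (simp add: orthonormal_def)

lemma orthonormal_distinct: assumes "orthonormal W bs" shows "distinct bs"
  unfolding distinct_conv_nth
proof (intro allI impI)
  fix k l assume "k < length bs" "l < length bs" "k \<noteq> l"
  thus "bs ! k \<noteq> bs ! l" using orthonormal_nth[OF assms, of k l] orthonormal_nth[OF assms, of k k] by auto
qed

lemma H_orthonormal_sum:
  assumes "orthonormal W bs" "l < length bs"
  shows "H (\<Sum>k<length bs. sc (c k) (bs ! k)) (bs ! l) = c l"
proof -
  have "H (\<Sum>k<length bs. sc (c k) (bs ! k)) (bs ! l) = (\<Sum>k<length bs. c k * H (bs ! k) (bs ! l))"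
    by (simp add: H_sum_left H_sc_left)
  also have "\<dots> = (\<Sum>k<length bs. if k = l then c k else 0)"
    by (rule sum.cong) (use assms orthonormal_nth in auto)
  finally show ?thesis using assms(2) by simp
qed

lemma nm_orthonormal_sum:
  assumes "orthonormal W bs"
  shows "nm (\<Sum>k<length bs. sc (c k) (bs ! k)) = (\<Sum>k<length bs. (cmod (c k))\<^sup>2)"
proof -
  let ?v = "\<Sum>k<length bs. sc (c k) (bs ! k)"
  have "H ?v ?v = (\<Sum>k<length bs. cnj (c k) * H ?v (bs ! k))"
    by (subst H_sum_right) (simp add: H_sc_right)
  also have "\<dots> = (\<Sum>k<length bs. of_real ((cmod (c k))\<^sup>2))"
    by (rule sum.cong) (use H_orthonormal_sum[OF assms] in \<open>auto simp: complex_norm_square mult.commute simp del: of_real_power\<close>)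
  finally show ?thesis by (simp add: nm_Re)
qed

lemma sum_nth_distinct: "distinct bs \<Longrightarrow> (\<Sum>x\<in>set bs. f x) = (\<Sum>k<length bs. f (bs ! k))"
  by (subst sum.reindex_bij_betw[OF bij_betw_nth, symmetric, of bs "{..<length bs}"]) auto

lemma orthonormal_independent:
  assumes "orthonormal W bs" shows "\<not> Modules.module.dependent sc (set bs)"
proof -
  interpret J: vector_space sc by (rule J_vs)
  show ?thesis
  proof
    assume "J.dependent (set bs)"
    then obtain u x where x: "x \<in> set bs" "u x \<noteq> 0" and 0: "(\<Sum>v\<in>set bs. sc (u v) v) = 0"
      by (auto simp: J.dependent_finite)
    from x obtain l where l: "l < length bs" "x = bs ! l" by (auto simp: in_set_conv_nth)
    have "(\<Sum>k<length bs. sc (u (bs ! k)) (bs ! k)) = 0"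
      using 0 by (simp add: sum_nth_distinct[OF orthonormal_distinct[OF assms]])
    with H_orthonormal_sum[OF assms l(1), of "\<lambda>k. u (bs ! k)"] l x show False by simp
  qed
qed

text \<open>Orthonormal vectors are also independent over the reals, so a finite real spanning set
  bounds their number. The bound makes a longest orthonormal list exist.\<close>

lemma orthonormal_length_bound: "\<exists>N. \<forall>W bs. orthonormal W bs \<longrightarrow> length bs \<le> N"
proof -
  obtain B where B: "finite B" "span B = (UNIV :: 'v set)"
    using sympl by (auto simp: symplectic_form_def)
  have "length bs \<le> card B" if o: "orthonormal W bs" for W bs
  proof -
    have "independent (set bs)"
    proof
      assume "dependent (set bs)"
      then obtain u x where x: "x \<in> set bs" "u x \<noteq> 0" and 0: "(\<Sum>v\<in>set bs. u v *\<^sub>R v) = 0"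
        by (auto simp: real_vector.dependent_finite)
      from x obtain l where l: "l < length bs" "x = bs ! l" by (auto simp: in_set_conv_nth)
      have "(\<Sum>k<length bs. sc (of_real (u (bs ! k))) (bs ! k)) = 0"
        using 0 by (simp add: sum_nth_distinct[OF orthonormal_distinct[OF o]] sc_of_real)
      with H_orthonormal_sum[OF o l(1), of "\<lambda>k. of_real (u (bs ! k))"] l x show False by simp
    qed
    from independent_span_bound[OF B(1) this] B show ?thesis
      by (simp add: distinct_card[OF orthonormal_distinct[OF o]])
  qed
  thus ?thesis by blast
qed

text \<open>A longest orthonormal list is a basis: a nonzero remainder after projection could be
  normalised and appended.\<close>

lemma orthonormal_basis_exists:
  assumes W: "subspace W" and jW: "\<And>w. w \<in> W \<Longrightarrow> j w \<in> W"
  shows "\<exists>bs. orthonormal_basis W bs"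
proof -
  obtain N where N: "\<And>bs. orthonormal W bs \<Longrightarrow> length bs \<le> N" using orthonormal_length_bound by blast
  have "orthonormal W []" by (simp add: orthonormal_def)
  hence "\<exists>x. orthonormal W x \<and> (\<forall>y. orthonormal W y \<longrightarrow> length y \<le> length x)"
    by (rule ex_has_greatest_nat[where b = "Suc N"]) (use N in \<open>auto simp: less_Suc_eq_le\<close>)
  then obtain bs where bs: "orthonormal W bs" and mx: "\<And>cs. orthonormal W cs \<Longrightarrow> length cs \<le> length bs"
    by blast
  have "w = (\<Sum>k<length bs. sc (H w (bs ! k)) (bs ! k))" if w: "w \<in> W" for w
  proof (rule ccontr)
    assume neq: "w \<noteq> (\<Sum>k<length bs. sc (H w (bs ! k)) (bs ! k))"
    define r where "r = w - (\<Sum>k<length bs. sc (H w (bs ! k)) (bs ! k))"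
    have scW: "sc c x \<in> W" if "x \<in> W" for c x
      using that W jW unfolding jscale_def by (intro subspace_add subspace_scale) auto
    have "r \<in> W" unfolding r_def
      by (intro subspace_diff[OF W] subspace_sum[OF W] w scW) (use bs in \<open>auto simp: orthonormal_def\<close>)
    have r0: "r \<noteq> 0" using neq by (simp add: r_def)
    define b where "b = (1 / sqrt (nm r)) *\<^sub>R r"
    have bW: "b \<in> W" unfolding b_def using \<open>r \<in> W\<close> W by (intro subspace_scale)
    have "nm b = 1" using nm_pos[OF r0] r0 by (simp add: b_def nm_scaleR power_divide)
    hence bb: "H b b = 1" by (simp add: H_self)
    have rb: "H r (bs ! l) = 0" if "l < length bs" for l
      using H_orthonormal_sum[OF bs that, of "\<lambda>k. H w (bs ! k)"] by (simp add: r_def H_diff_left)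
    have b1: "H b (bs ! l) = 0" if "l < length bs" for l using rb[OF that] by (simp add: b_def H_simps)
    have b2: "H (bs ! l) b = 0" if "l < length bs" for l using b1[OF that] by (metis H_cnj complex_cnj_zero)
    have "orthonormal W (bs @ [b])"
      using bs bW by (auto simp: orthonormal_def nth_append less_Suc_eq bb b1 b2)
    from mx[OF this] show False by simp
  qed
  thus ?thesis using bs by (auto simp: orthonormal_basis_def)
qed

lemma orthonormal_basis_UNIV_exists: "\<exists>bs. orthonormal_basis UNIV bs"
  by (rule orthonormal_basis_exists) auto

lemma orthonormal_basis_expand: "orthonormal_basis W bs \<Longrightarrow> w \<in> W \<Longrightarrow> (\<Sum>k<length bs. sc (H w (bs ! k)) (bs ! k)) = w"
  by (simp add: orthonormal_basis_def)

lemma orthonormal_basis_is_jbasis: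
  assumes bs: "orthonormal_basis W bs" and W: "subspace W" and jW: "\<And>w. w \<in> W \<Longrightarrow> j w \<in> W"
  shows "is_jbasis j W bs"
proof -
  interpret J: vector_space sc by (rule J_vs)
  have o: "orthonormal W bs" using bs by (simp add: orthonormal_basis_def)
  have scW: "sc c x \<in> W" if "x \<in> W" for c x
      using that W jW unfolding jscale_def by (intro subspace_add subspace_scale) auto
  have "J.subspace W"
    unfolding J.subspace_def using W scW by (auto simp: subspace_def)
  hence "J.span (set bs) \<subseteq> W" using o by (intro J.span_minimal) (auto simp: orthonormal_def)
  moreover have "w \<in> J.span (set bs)" if "w \<in> W" for w
  proof -
    have "(\<Sum>k<length bs. sc (H w (bs ! k)) (bs ! k)) \<in> J.span (set bs)"
      by (intro J.span_sum J.span_scale J.span_base) auto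
    thus ?thesis using orthonormal_basis_expand[OF bs that] by simp
  qed
  ultimately show ?thesis
    using orthonormal_distinct[OF o] orthonormal_independent[OF o] by (auto simp: is_jbasis_def)
qed

lemma is_unitary_basis_orthonormal_basis: "is_unitary_basis \<Omega> j bs \<longleftrightarrow> orthonormal_basis UNIV bs"
proof
  assume "orthonormal_basis UNIV bs"
  thus "is_unitary_basis \<Omega> j bs"
    using orthonormal_basis_is_jbasis[of UNIV bs] by (auto simp: is_unitary_basis_def orthonormal_basis_def orthonormal_def)
next
  assume u: "is_unitary_basis \<Omega> j bs"
  interpret J: vector_space sc by (rule J_vs)
  have o: "orthonormal UNIV bs" using u by (auto simp: is_unitary_basis_def orthonormal_def)
  have "w = (\<Sum>k<length bs. sc (H w (bs ! k)) (bs ! k))" for w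
  proof -
    have "w \<in> J.span (set bs)" using u by (auto simp: is_unitary_basis_def is_jbasis_def)
    then obtain c where "w = (\<Sum>v\<in>set bs. sc (c v) v)"
      using J.span_finite[of "set bs"] by auto
    hence w: "w = (\<Sum>k<length bs. sc (c (bs ! k)) (bs ! k))"
      by (simp add: sum_nth_distinct[OF orthonormal_distinct[OF o]])
    show ?thesis
      by (subst w, rule sum.cong) (auto simp: H_orthonormal_sum[OF o] w)
  qed
  thus "orthonormal_basis UNIV bs" using o by (auto simp: orthonormal_basis_def)
qed

subsection \<open>Finite-dimensional topology\<close>

text \<open>Coordinates are functions on all of \<open>nat\<close>, of which the first
  \<open>length bs\<close> values count, so that they carry the product topology.\<close>

definition cmb :: "'v list \<Rightarrow> (nat \<Rightarrow> complex) \<Rightarrow> 'v" where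
  "cmb bs x = (\<Sum>k<length bs. sc (x k) (bs ! k))"

lemma continuous_sc [continuous_intros]:
  "continuous_on A f \<Longrightarrow> continuous_on A (\<lambda>x. sc (f x) v)"
  unfolding jscale_def by (intro continuous_intros)

lemma continuous_cmb: "continuous_on UNIV (cmb bs)"
  unfolding cmb_def
  by (intro continuous_intros continuous_on_sum continuous_on_product_coordinates)

text \<open>The half of the equivalence of \<open>sqrt (nm v)\<close> with the given norm that uses
  compactness: on the unit sphere of \<open>nm\<close> the given norm is continuous and has no zero,
  hence is bounded below. This makes linear maps on V continuous.\<close>

lemma nm_le_norm: "\<exists>c>0. \<forall>v. sqrt (nm v) \<le> c * norm v"
proof -
  obtain bs where bs: "orthonormal_basis UNIV bs" using orthonormal_basis_UNIV_exists by blast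
  define n where "n = length bs"
  have o: "orthonormal UNIV bs" using bs by (simp add: orthonormal_basis_def)
  \<comment> \<open>All factors beyond the n-th are a single point, so Tychonoff's theorem gives
    compactness in the infinite product and no finite-dimensional coordinate type is
    required.\<close>
  define K where "K = PiE UNIV (\<lambda>i. if i < n then cball 0 1 else {0::complex})"
  define S where "S = {x\<in>K. (\<Sum>i<n. (cmod (x i))\<^sup>2) = 1}"
  have "compactin (product_topology (\<lambda>i. euclidean) (UNIV::nat set)) K"
    unfolding K_def by (subst compactin_PiE) auto
  hence cK: "compact K" by (simp add: euclidean_product_topology)
  have "closed {x::nat\<Rightarrow>complex. (\<Sum>i<n. (cmod (x i))\<^sup>2) = 1}"
    by (intro closed_Collect_eq continuous_intros continuous_on_product_coordinates)
  hence cS: "compact S" unfolding S_def using compact_Int_closed[OF cK] by (simp add: Collect_conj_eq)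
  have nS: "nm (cmb bs x) = 1" if "x \<in> S" for x
    using that nm_orthonormal_sum[OF o, of x] by (simp add: S_def cmb_def n_def)
  have "\<exists>m>0. \<forall>x\<in>S. m \<le> norm (cmb bs x)"
  proof (cases "S = {}")
    case False
    have "continuous_on S (\<lambda>x. norm (cmb bs x))"
      by (intro continuous_intros continuous_on_subset[OF continuous_cmb]) auto
    from continuous_attains_inf[OF cS False this] obtain x0 where x0: "x0 \<in> S"
      "\<forall>y\<in>S. norm (cmb bs x0) \<le> norm (cmb bs y)" by blast
    have "cmb bs x0 \<noteq> 0" using nS[OF x0(1)] by auto
    thus ?thesis using x0 by (intro exI[of _ "norm (cmb bs x0)"]) auto
  qed (auto intro: exI[of _ 1])
  then obtain m where m: "m > 0" "\<And>x. x \<in> S \<Longrightarrow> m \<le> norm (cmb bs x)" by blast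
  have "sqrt (nm v) \<le> (1 / m) * norm v" for v
  proof (cases "v = 0")
    case False
    define s where "s = sqrt (nm v)"
    have s: "s > 0" using nm_pos[OF False] by (simp add: s_def)
    define u where "u = (1 / s) *\<^sub>R v"
    have nu: "nm u = 1" using s nm_pos[OF False] False by (simp add: u_def nm_scaleR s_def power_divide)
    define x where "x = (\<lambda>k. if k < n then H u (bs ! k) else 0)"
    have ux: "cmb bs x = u" unfolding cmb_def using orthonormal_basis_expand[OF bs, of u] by (simp add: x_def n_def)
    have sum1: "(\<Sum>i<n. (cmod (x i))\<^sup>2) = 1"
      using nm_orthonormal_sum[OF o, of x] ux nu by (simp add: cmb_def n_def)
    have "cmod (x i) \<le> 1" if "i < n" for i
    proof -
      have "(cmod (x i))\<^sup>2 \<le> (\<Sum>i<n. (cmod (x i))\<^sup>2)" using that by (intro member_le_sum) auto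
      hence "(cmod (x i))\<^sup>2 \<le> 1" by (simp only: sum1)
      thus ?thesis using power2_le_imp_le[of "cmod (x i)" 1] by simp
    qed
    hence "x \<in> S" using sum1 by (auto simp: S_def K_def x_def)
    from m(2)[OF this] have "m \<le> norm v / s" using s by (simp add: ux u_def)
    thus ?thesis using s m(1) by (simp add: s_def field_simps)
  qed auto
  thus ?thesis using m(1) by (intro exI[of _ "1/m"]) auto
qed

lemma cmod_H_basis_le: "nm b = 1 \<Longrightarrow> cmod (H v b) \<le> sqrt (nm v)"
  using cmod_H_le[of v b] by (simp add: real_le_rsqrt)

lemma linear_bound_nm:
  fixes f :: "'v \<Rightarrow> 'b::real_normed_vector"
  assumes "linear f" shows "\<exists>B>0. \<forall>v. norm (f v) \<le> B * sqrt (nm v)"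
proof -
  interpret linear f by fact
  obtain bs where bs: "orthonormal_basis UNIV bs" using orthonormal_basis_UNIV_exists by blast
  have n1: "nm (bs ! k) = 1" if "k < length bs" for k
    using that bs by (auto simp: orthonormal_basis_def orthonormal_def nm_Re)
  define B where "B = (\<Sum>k<length bs. norm (f (bs ! k)) + norm (f (j (bs ! k))))"
  have "norm (f v) \<le> (B + 1) * sqrt (nm v)" for v
  proof -
    have "f v = f (\<Sum>k<length bs. sc (H v (bs ! k)) (bs ! k))" using orthonormal_basis_expand[OF bs, of v] by simp
    hence fv: "f v = (\<Sum>k<length bs. Re (H v (bs ! k)) *\<^sub>R f (bs ! k) + Im (H v (bs ! k)) *\<^sub>R f (j (bs ! k)))"
      by (simp add: sum jscale_def add scale)
    have "norm (f v) \<le> (\<Sum>k<length bs. sqrt (nm v) * (norm (f (bs ! k)) + norm (f (j (bs ! k)))))"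
      unfolding fv
    proof (rule sum_norm_le)
      fix k assume "k \<in> {..<length bs}"
      hence c: "cmod (H v (bs ! k)) \<le> sqrt (nm v)" using cmod_H_basis_le n1 by auto
      have "\<bar>Re (H v (bs ! k))\<bar> \<le> sqrt (nm v)" "\<bar>Im (H v (bs ! k))\<bar> \<le> sqrt (nm v)"
        using order_trans[OF abs_Re_le_cmod c] order_trans[OF abs_Im_le_cmod c] by auto
      thus "norm (Re (H v (bs ! k)) *\<^sub>R f (bs ! k) + Im (H v (bs ! k)) *\<^sub>R f (j (bs ! k)))
         \<le> sqrt (nm v) * (norm (f (bs ! k)) + norm (f (j (bs ! k))))"
        by (intro order_trans[OF norm_triangle_ineq]) (unfold distrib_left norm_scaleR, intro add_mono mult_right_mono norm_ge_zero)
    qed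
    also have "\<dots> = B * sqrt (nm v)"
      unfolding B_def by (subst mult.commute, subst sum_distrib_left[symmetric], rule refl)
    also have "\<dots> \<le> (B + 1) * sqrt (nm v)" by (intro mult_right_mono) auto
    finally show ?thesis .
  qed
  moreover have "B + 1 > 0" unfolding B_def by (intro add_nonneg_pos sum_nonneg) auto
  ultimately show ?thesis by blast
qed

lemma linear_bounded_linear:
  fixes f :: "'v \<Rightarrow> 'b::real_normed_vector"
  assumes "linear f" shows "bounded_linear f"
proof -
  obtain B where B: "B > 0" "\<And>v. norm (f v) \<le> B * sqrt (nm v)" using linear_bound_nm[OF assms] by blast
  obtain c where c: "c > 0" "\<And>v. sqrt (nm v) \<le> c * norm v" using nm_le_norm by blast
  show ?thesis
    unfolding bounded_linear_def bounded_linear_axioms_def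
  proof (intro conjI assms exI[of _ "B * c"] allI)
    fix v show "norm (f v) \<le> norm v * (B * c)"
      using order_trans[OF B(2)[of v] mult_left_mono[OF c(2)[of v], of B]] B(1) by (simp add: mult_ac)
  qed
qed

end

subsection \<open>Exponential integrals with a parameter\<close>

lemma norm_exp_minus_1_minus_le: "norm (exp x - 1 - x) \<le> (norm x)\<^sup>2 * exp (norm x)" for x :: complex
proof -
  have "norm (exp x - (\<Sum>i\<le>1. x ^ i / fact i)) \<le> exp (norm x) * (norm x ^ Suc 1) / fact 1"
    by (rule Taylor_exp_field)
  thus ?thesis by (simp add: algebra_simps power2_eq_square)
qed

lemma square_le_two_exp: "(b::real) \<ge> 0 \<Longrightarrow> b\<^sup>2 \<le> 2 * exp b"
  using exp_lower_Taylor_quadratic[of b] by simp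

lemma norm_integral_le:
  fixes f :: "'a \<Rightarrow> 'b::{banach, second_countable_topology}"
  assumes "integrable M f" "integrable M g" "\<And>x. norm (f x) \<le> g x"
  shows "norm (integral\<^sup>L M f) \<le> integral\<^sup>L M g"
  using assms by (intro order_trans[OF integral_norm_bound] integral_mono) auto

text \<open>Differentiation under the integral by a direct remainder estimate. Exponential moments
  of b of every order bound the second-order remainder of exp uniformly, so the error is quadratic
  in the increment.\<close>

lemma has_derivative_exp_integral:
  fixes \<nu> :: "'a measure" and \<phi> :: "'a \<Rightarrow> complex" and l :: "'a \<Rightarrow> 'w::real_normed_vector \<Rightarrow> complex"
    and b :: "'a \<Rightarrow> real"
  assumes lin: "\<And>z. linear (l z)" and bd: "\<And>z w. norm (l z w) \<le> b z * norm w" and b0: "\<And>z. b z \<ge> 0"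
    and [measurable]: "\<phi> \<in> borel_measurable \<nu>" "b \<in> borel_measurable \<nu>"
      "\<And>w. (\<lambda>z. l z w) \<in> borel_measurable \<nu>"
    and int: "\<And>R. integrable \<nu> (\<lambda>z. norm (\<phi> z) * exp (R * b z))"
  shows "((\<lambda>w. \<integral>z. \<phi> z * exp (l z w) \<partial>\<nu>) has_derivative
         (\<lambda>d. \<integral>z. \<phi> z * l z d * exp (l z w) \<partial>\<nu>)) (at w)"
proof -
  have e: "norm (exp (l z w)) \<le> exp (norm w * b z)" for z w
    using norm_exp[of "l z w"] bd[of z w] by (simp add: mult.commute)
  have I0: "integrable \<nu> (\<lambda>z. \<phi> z * exp (l z w))" for w
    by (rule Bochner_Integration.integrable_bound[OF int[of "norm w"]])
       (auto simp: norm_mult simp del: norm_exp_eq_Re intro!: mult_left_mono e)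
  have l1: "norm (\<phi> z * l z d * exp (l z w)) \<le> norm d * (norm (\<phi> z) * exp ((norm w + 1) * b z))" for z d w
  proof -
    have "norm (l z d) * norm (exp (l z w)) \<le> (b z * norm d) * exp (norm w * b z)"
      by (intro mult_mono bd e mult_nonneg_nonneg b0) auto
    also have "\<dots> \<le> (exp (b z) * norm d) * exp (norm w * b z)"
    proof (intro mult_right_mono)
      show "b z \<le> exp (b z)" using exp_ge_add_one_self[of "b z"] by linarith
    qed auto
    also have "\<dots> = norm d * exp ((norm w + 1) * b z)"
      by (simp add: exp_add[symmetric] algebra_simps)
    finally have "norm (\<phi> z) * (norm (l z d) * norm (exp (l z w))) \<le> norm (\<phi> z) * (norm d * exp ((norm w + 1) * b z))"
      by (intro mult_left_mono) auto
    thus ?thesis by (simp add: norm_mult mult_ac)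
  qed
  have I1: "integrable \<nu> (\<lambda>z. \<phi> z * l z d * exp (l z w))" for d w
    by (rule Bochner_Integration.integrable_bound[OF integrable_mult_right[OF int[of "norm w + 1"], of "norm d"]])
       (auto intro!: l1 order_trans[OF l1])
  \<comment> \<open>The 2 and one factor exp(b) come from b^2 <= 2 exp(b); the other factor exp(b)
    bounds the exponential in the Taylor remainder for increments of norm below 1.\<close>
  define C where "C = 2 * (\<integral>z. norm (\<phi> z) * exp ((norm w + 2) * b z) \<partial>\<nu>)"
  show "((\<lambda>w. \<integral>z. \<phi> z * exp (l z w) \<partial>\<nu>) has_derivative
         (\<lambda>d. \<integral>z. \<phi> z * l z d * exp (l z w) \<partial>\<nu>)) (at w)"
  proof (rule has_derivativeI_sandwich[where e = 1 and H = "\<lambda>y. C * norm (y - w)"])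
    show "bounded_linear (\<lambda>d. \<integral>z. \<phi> z * l z d * exp (l z w) \<partial>\<nu>)"
    proof (rule bounded_linear_intro)
      fix x y show "(\<integral>z. \<phi> z * l z (x + y) * exp (l z w) \<partial>\<nu>) =
          (\<integral>z. \<phi> z * l z x * exp (l z w) \<partial>\<nu>) + (\<integral>z. \<phi> z * l z y * exp (l z w) \<partial>\<nu>)"
        by (subst Bochner_Integration.integral_add[OF I1 I1, symmetric]) (simp add: linear_add[OF lin] algebra_simps)
    next
      fix r x show "(\<integral>z. \<phi> z * l z (r *\<^sub>R x) * exp (l z w) \<partial>\<nu>) = r *\<^sub>R (\<integral>z. \<phi> z * l z x * exp (l z w) \<partial>\<nu>)"
        by (subst integral_scaleR_right[symmetric]) (auto intro!: Bochner_Integration.integral_cong simp: linear_scale[OF lin])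
    next
      fix d
      have "norm (\<integral>z. \<phi> z * l z d * exp (l z w) \<partial>\<nu>) \<le> (\<integral>z. norm d * (norm (\<phi> z) * exp ((norm w + 1) * b z)) \<partial>\<nu>)"
        by (rule norm_integral_le) (auto intro!: I1 l1 int)
      thus "norm (\<integral>z. \<phi> z * l z d * exp (l z w) \<partial>\<nu>) \<le> norm d * (\<integral>z. norm (\<phi> z) * exp ((norm w + 1) * b z) \<partial>\<nu>)"
        by simp
    qed
    fix y assume "y \<noteq> w" "dist y w < 1"
    define d where "d = y - w"
    have y: "y = w + d" and d: "norm d < 1" "d \<noteq> 0" using \<open>dist y w < 1\<close> \<open>y \<noteq> w\<close> by (auto simp: d_def dist_norm)
    have bnd: "norm (\<phi> z * exp (l z (w + d)) - \<phi> z * exp (l z w) - \<phi> z * l z d * exp (l z w))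
        \<le> 2 * (norm d)\<^sup>2 * (norm (\<phi> z) * exp ((norm w + 2) * b z))" for z
    proof -
      have "norm (exp (l z d) - 1 - l z d) \<le> (norm (l z d))\<^sup>2 * exp (norm (l z d))"
        by (rule norm_exp_minus_1_minus_le)
      also have "\<dots> \<le> (b z * norm d)\<^sup>2 * exp (b z)"
      proof (intro mult_mono power_mono bd)
        have "norm (l z d) \<le> b z * norm d" by (rule bd)
        also have "\<dots> \<le> b z * 1" using d b0 by (intro mult_left_mono) auto
        finally show "exp (norm (l z d)) \<le> exp (b z)" by simp
      qed (use b0 in auto)
      also have "\<dots> = (norm d)\<^sup>2 * ((b z)\<^sup>2 * exp (b z))" by (simp add: power_mult_distrib)
      also have "\<dots> \<le> (norm d)\<^sup>2 * ((2 * exp (b z)) * exp (b z))"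
        by (intro mult_left_mono mult_right_mono square_le_two_exp b0) auto
      also have "\<dots> = 2 * (norm d)\<^sup>2 * exp (b z + b z)" by (simp only: exp_add mult_ac)
      finally have 1: "norm (exp (l z d) - 1 - l z d) \<le> 2 * (norm d)\<^sup>2 * exp (2 * b z)" by (simp only: mult_2)
      have "\<phi> z * exp (l z (w + d)) - \<phi> z * exp (l z w) - \<phi> z * l z d * exp (l z w)
         = \<phi> z * exp (l z w) * (exp (l z d) - 1 - l z d)"
        by (simp add: linear_add[OF lin] exp_add algebra_simps)
      also have "norm \<dots> = norm (\<phi> z) * norm (exp (l z w)) * norm (exp (l z d) - 1 - l z d)"
        by (simp only: norm_mult)
      also have "\<dots> \<le> norm (\<phi> z) * exp (norm w * b z) * (2 * (norm d)\<^sup>2 * exp (2 * b z))"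
        by (intro mult_mono e 1) auto
      also have "\<dots> = 2 * (norm d)\<^sup>2 * (norm (\<phi> z) * exp ((norm w + 2) * b z))"
        by (simp add: exp_add algebra_simps)
      finally show ?thesis .
    qed
    have "norm ((\<integral>z. \<phi> z * exp (l z y) \<partial>\<nu>) - (\<integral>z. \<phi> z * exp (l z w) \<partial>\<nu>) - (\<integral>z. \<phi> z * l z d * exp (l z w) \<partial>\<nu>))
       = norm (\<integral>z. \<phi> z * exp (l z (w + d)) - \<phi> z * exp (l z w) - \<phi> z * l z d * exp (l z w) \<partial>\<nu>)"
      using I0 I1 by (simp add: y)
    also have "\<dots> \<le> (\<integral>z. 2 * (norm d)\<^sup>2 * (norm (\<phi> z) * exp ((norm w + 2) * b z)) \<partial>\<nu>)"
      by (rule norm_integral_le) (auto intro!: I0 I1 bnd int Bochner_Integration.integrable_diff)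
    also have "\<dots> = C * norm d * norm d" by (simp add: C_def power2_eq_square)
    finally show "norm ((\<integral>z. \<phi> z * exp (l z y) \<partial>\<nu>) - (\<integral>z. \<phi> z * exp (l z w) \<partial>\<nu>)
        - (\<integral>z. \<phi> z * l z (y - w) * exp (l z w) \<partial>\<nu>)) / norm (y - w) \<le> C * norm (y - w)"
      using d by (simp add: d_def[symmetric] divide_simps)
  next
    have "((\<lambda>y. C * norm (y - w)) \<longlongrightarrow> C * norm (w - w)) (at w)" by (intro tendsto_intros)
    thus "((\<lambda>y. C * norm (y - w)) \<longlongrightarrow> 0) (at w)" by simp
  qed auto
qed

subsection \<open>Gaussian integrals over the complex plane\<close>

text \<open>The disc where the squared modulus is at most a has area pi a, which is linear in a;
  hence the density is constant. This plays the part of polar coordinates.\<close>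

lemma distr_norm_square_complex:
  "distr lborel borel (\<lambda>u::complex. (cmod u)\<^sup>2) = density lborel (\<lambda>t. ennreal (pi * indicator {0..} t))"
    (is "?M = ?N")
proof (rule measure_eqI_generator_eq[where E = "range (\<lambda>a::real. {..a})" and \<Omega> = UNIV and A = "\<lambda>i. {..real i}"])
  show "Int_stable (range (\<lambda>a::real. {..a}))" by (auto simp: Int_stable_def)
  show "sets ?M = sigma_sets UNIV (range (\<lambda>a::real. {..a}))"
    by (simp add: borel_eq_atMost) 
  show "sets ?N = sigma_sets UNIV (range (\<lambda>a::real. {..a}))"
    by (simp add: borel_eq_atMost)
  have M: "emeasure ?M {..a} = ennreal (pi * max 0 a)" for a
  proof (cases "a \<ge> 0")
    case True
    have "emeasure ?M {..a} = emeasure lborel {u::complex. (cmod u)\<^sup>2 \<le> a}"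
      by (subst emeasure_distr) (auto simp: vimage_def)
    also have "{u::complex. (cmod u)\<^sup>2 \<le> a} = cball 0 (sqrt a)"
    proof -
      have "(cmod u)\<^sup>2 \<le> a \<longleftrightarrow> cmod u \<le> sqrt a" for u
        unfolding real_sqrt_le_iff[of "(cmod u)\<^sup>2" a, symmetric] real_sqrt_abs abs_norm_cancel by (rule refl)
      hence "{u::complex. (cmod u)\<^sup>2 \<le> a} = {u. cmod u \<le> sqrt a}" by blast
      thus ?thesis by (simp add: cball_def dist_norm)
    qed
    also have "emeasure lborel \<dots> = ennreal (pi * a)"
      using True by (subst emeasure_cball) (auto simp: unit_ball_vol_2)
    finally show ?thesis using True by simp
  next
    case False
    have "(\<lambda>u::complex. (cmod u)\<^sup>2) -` {..a} = {}" using False by (auto simp: not_le) (smt (verit) zero_le_power2)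
    thus ?thesis using False by (subst emeasure_distr) auto
  qed
  have N: "emeasure ?N {..a} = ennreal (pi * max 0 a)" for a
  proof -
    have "emeasure ?N {..a} = (\<integral>\<^sup>+t. ennreal pi * indicator {0..a} t \<partial>lborel)"
      by (subst emeasure_density) (auto intro!: nn_integral_cong split: split_indicator)
    also have "\<dots> = ennreal (pi * max 0 a)"
      by (subst nn_integral_cmult_indicator) (auto simp: ennreal_mult'[symmetric] max_def)
    finally show ?thesis .
  qed
  show "X \<in> range (\<lambda>a::real. {..a}) \<Longrightarrow> emeasure ?M X = emeasure ?N X" for X
    using M N by auto
  show "emeasure ?M {..real i} \<noteq> \<infinity>" for i by (subst M) simp
  show "(\<Union>i. {..real i}) = UNIV" using real_arch_simple by (auto simp: set_eq_iff)
qed auto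

lemma integrable_exp_Ici:
  assumes "e > 0" shows "integrable lborel (\<lambda>t::real. indicator {0..} t * exp (- e * t))"
proof -
  have "(\<integral>\<^sup>+t. ennreal (exp (- e * t)) * indicator {0..} t \<partial>lborel) = 0 - (- exp (- e * 0) / e)"
  proof (rule nn_integral_FTC_atLeast)
    show "((\<lambda>t. - exp (- e * t) / e) \<longlongrightarrow> 0) at_top" using assms by real_asymp
  qed (use assms in \<open>auto intro!: derivative_eq_intros\<close>)
  thus ?thesis
    by (intro integrableI_bounded)
       (auto simp: ennreal_mult' mult.commute abs_mult ennreal_indicator less_top)
qed

lemma integral_exp_Ici_complex:
  fixes p :: complex
  assumes p: "Re p > 0"
  shows "integrable lborel (\<lambda>t::real. indicator {0..} t *\<^sub>R exp (- p * complex_of_real t))"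
    and "(\<integral>t. indicator {0..} t *\<^sub>R exp (- p * complex_of_real t) \<partial>lborel) = 1 / p"
proof -
  show I: "integrable lborel (\<lambda>t::real. indicator {0..} t *\<^sub>R exp (- p * complex_of_real t))"
    by (rule Bochner_Integration.integrable_bound[OF integrable_exp_Ici[OF p]])
       (auto simp: norm_exp_eq_Re)
  have p0: "p \<noteq> 0" using p by auto
  have "(LBINT t=0..\<infinity>. exp (- p * complex_of_real t)) = 0 - (- 1 / p)"
  proof (rule interval_integral_FTC_integrable)
    show "((\<lambda>t. - exp (- p * complex_of_real t) / p) has_vector_derivative exp (- p * complex_of_real x)) (at x)" for x
      using p0 by (auto intro!: derivative_eq_intros has_vector_derivative_real_field simp: field_simps)
    show "set_integrable lborel (einterval 0 \<infinity>) (\<lambda>t. exp (- p * complex_of_real t))"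
      unfolding set_integrable_def
      by (rule Bochner_Integration.integrable_bound[OF I]) (auto split: split_indicator simp: einterval_def)
    have "((\<lambda>t. - exp (- p * complex_of_real t) / p) \<longlongrightarrow> - exp (- p * complex_of_real 0) / p) (at_right 0)"
      by (intro tendsto_intros p0)
    thus "(((\<lambda>t. - exp (- p * complex_of_real t) / p) \<circ> real_of_ereal) \<longlongrightarrow> - 1 / p) (at_right 0)"
      by (simp add: zero_ereal_def ereal_tendsto_simps)
    have "((\<lambda>t. - exp (- p * complex_of_real t) / p) \<longlongrightarrow> 0) at_top"
    proof (rule tendsto_norm_zero_cancel)
      have "((\<lambda>t. exp (- Re p * t) / norm p) \<longlongrightarrow> 0) at_top" using p p0 by real_asymp
      thus "((\<lambda>t. norm (- exp (- p * complex_of_real t) / p)) \<longlongrightarrow> 0) at_top"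
        by (simp add: norm_divide norm_exp_eq_Re)
    qed
    thus "(((\<lambda>t. - exp (- p * complex_of_real t) / p) \<circ> real_of_ereal) \<longlongrightarrow> 0) (at_left \<infinity>)"
      by (simp add: ereal_tendsto_simps)
  qed (auto intro!: continuous_intros)
  also have "(LBINT t=0..\<infinity>. exp (- p * complex_of_real t)) = (\<integral>t. indicator {0<..} t *\<^sub>R exp (- p * complex_of_real t) \<partial>lborel)"
    by (simp add: interval_lebesgue_integral_def set_lebesgue_integral_def einterval_def zero_ereal_def greaterThan_def)
  also have "\<dots> = (\<integral>t. indicator {0..} t *\<^sub>R exp (- p * complex_of_real t) \<partial>lborel)"
    by (rule integral_cong_AE) (auto intro!: AE_I[where N = "{0}"] split: split_indicator)
  finally show "(\<integral>t. indicator {0..} t *\<^sub>R exp (- p * complex_of_real t) \<partial>lborel) = 1 / p" by simp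
qed

lemma gauss_complex:
  fixes p :: complex
  assumes p: "Re p > 0"
  shows "integrable lborel (\<lambda>u::complex. exp (- p * complex_of_real ((cmod u)\<^sup>2)))"
    and "(\<integral>u. exp (- p * complex_of_real ((cmod u)\<^sup>2)) \<partial>lborel) = pi / p"
proof -
  let ?N = "density lborel (\<lambda>t. ennreal (pi * indicator {0..} t))"
  have eq: "(pi * indicator {0..} t) *\<^sub>R exp (- p * complex_of_real t) =
      complex_of_real pi * (indicator {0..} t *\<^sub>R exp (- p * complex_of_real t))" for t
    by (simp add: scaleR_conv_of_real)
  have "integrable ?N (\<lambda>t. exp (- p * complex_of_real t))"
  proof (subst integrable_density)
    show "integrable lborel (\<lambda>t. (pi * indicator {0..} t) *\<^sub>R exp (- p * complex_of_real t))"
      unfolding eq by (rule integrable_mult_right[OF integral_exp_Ici_complex(1)[OF p]])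
  qed auto
  thus "integrable lborel (\<lambda>u::complex. exp (- p * complex_of_real ((cmod u)\<^sup>2)))"
    by (subst (asm) distr_norm_square_complex[symmetric], subst (asm) integrable_distr_eq) auto
  have "(\<integral>u. exp (- p * complex_of_real ((cmod u)\<^sup>2)) \<partial>lborel) =
     (\<integral>t. exp (- p * complex_of_real t) \<partial>distr lborel borel (\<lambda>u::complex. (cmod u)\<^sup>2))"
    by (subst integral_distr) auto
  also have "\<dots> = (\<integral>t. exp (- p * complex_of_real t) \<partial>?N)" by (simp only: distr_norm_square_complex)
  also have "\<dots> = (\<integral>t. complex_of_real pi * (indicator {0..} t *\<^sub>R exp (- p * complex_of_real t)) \<partial>lborel)"
  proof (subst integral_density)
    show "(\<integral>t. (pi * indicator {0..} t) *\<^sub>R exp (- p * complex_of_real t) \<partial>lborel) =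
      (\<integral>t. complex_of_real pi * (indicator {0..} t *\<^sub>R exp (- p * complex_of_real t)) \<partial>lborel)"
      by (simp only: eq)
  qed auto
  also have "\<dots> = pi / p" by (simp only: integral_mult_right_zero integral_exp_Ici_complex(2)[OF p]) simp
  finally show "(\<integral>u. exp (- p * complex_of_real ((cmod u)\<^sup>2)) \<partial>lborel) = pi / p" .
qed

lemma gauss_complex_linear_integrable:
  assumes "e > 0"
  shows "integrable lborel (\<lambda>u::complex. exp (R * cmod u - e * (cmod u)\<^sup>2))"
proof -
  have "integrable lborel (\<lambda>u::complex. norm (exp (- complex_of_real (e/2) * complex_of_real ((cmod u)\<^sup>2))))"
    using assms by (intro integrable_norm gauss_complex) auto
  hence "integrable lborel (\<lambda>u::complex. exp (R\<^sup>2 / (2*e)) * exp (- (e/2) * (cmod u)\<^sup>2))"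
    by (intro integrable_mult_right) (simp add: norm_exp_eq_Re)
  thus ?thesis
  proof (rule Bochner_Integration.integrable_bound)
    \<comment> \<open>Half of the quadratic decay absorbs the linear term, by completing the
      square.\<close>
    have "R * r - e * r\<^sup>2 \<le> R\<^sup>2 / (2*e) + (- (e/2) * r\<^sup>2)" for r
    proof -
      have "0 \<le> (R - e * r)\<^sup>2 / (2 * e)" using assms by auto
      also have "\<dots> = R\<^sup>2 / (2*e) - R * r + e/2 * r\<^sup>2" using assms by (simp add: field_simps power2_eq_square)
      finally show ?thesis by (simp add: algebra_simps)
    qed
    thus "AE u in lborel. norm (exp (R * cmod u - e * (cmod u)\<^sup>2)) \<le> norm (exp (R\<^sup>2 / (2*e)) * exp (- (e/2) * (cmod u)\<^sup>2))"
      by (intro AE_I2) (simp add: mult_exp_exp)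
  qed auto
qed

text \<open>
  Completing the square would require translating \<open>y\<close> and its conjugate independently. Instead,
  \<open>G(a,b) exp(-ab/p)\<close>, where \<open>G(a,b)\<close> is the integral, is holomorphic in \<open>(a,b)\<close> and invariant under
  \<open>(a,b) \<mapsto> (a + pt, b + p cnj t)\<close> because of the translations \<open>y \<mapsto> y + t\<close>, hence constant.
\<close>

lemma gauss_complex_linear:
  fixes p a b :: complex
  assumes p: "Re p > 0"
  shows "(\<integral>y. exp (- (p * complex_of_real ((cmod y)\<^sup>2) + cnj y * a + b * y)) \<partial>lborel) = pi / p * exp (a * b / p)"
proof -
  have p0: "p \<noteq> 0" using p by auto
  define \<phi> where "\<phi> = (\<lambda>y::complex. exp (- p * complex_of_real ((cmod y)\<^sup>2)))"
  define l where "l = (\<lambda>(y::complex) (w::complex\<times>complex). - (cnj y * fst w + snd w * y))"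
  define G where "G = (\<lambda>w. \<integral>y. \<phi> y * exp (l y w) \<partial>lborel)"
  have lin: "linear (l z)" for z
    by (rule linearI) (auto simp: l_def algebra_simps scaleR_conv_of_real)
  have bd: "norm (l z w) \<le> (2 * cmod z) * norm w" for z w
  proof -
    have "norm (l z w) = norm (cnj z * fst w + snd w * z)" unfolding l_def by (rule norm_minus_cancel)
    also have "\<dots> \<le> norm (cnj z * fst w) + norm (snd w * z)" by (rule norm_triangle_ineq)
    also have "\<dots> = cmod z * cmod (fst w) + cmod (snd w) * cmod z" by (simp add: norm_mult)
    also have "\<dots> \<le> cmod z * norm w + norm w * cmod z"
      using norm_fst_le[of "fst w" "snd w"] norm_snd_le[of "snd w" "fst w"]
      by (intro add_mono mult_left_mono mult_right_mono) auto
    finally show ?thesis by simp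
  qed
  have D: "(G has_derivative (\<lambda>d. \<integral>z. \<phi> z * l z d * exp (l z w) \<partial>lborel)) (at w)" for w
    unfolding G_def
  proof -
    have "integrable lborel (\<lambda>z. norm (\<phi> z) * exp (R * (2 * cmod z)))" for R
      using gauss_complex_linear_integrable[OF p, of "2 * R"]
      by (simp add: \<phi>_def norm_exp_eq_Re mult_exp_exp algebra_simps)
    note * = has_derivative_exp_integral[of l "\<lambda>z. 2 * cmod z" \<phi> lborel, OF lin bd _ _ _ _ this]
    show "((\<lambda>w. \<integral>y. \<phi> y * exp (l y w) \<partial>lborel) has_derivative (\<lambda>d. \<integral>z. \<phi> z * l z d * exp (l z w) \<partial>lborel)) (at w)"
      by (rule *) (auto simp: \<phi>_def l_def intro!: borel_measurable_continuous_onI continuous_intros)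
  qed
  define R where "R = (\<lambda>w. G w * exp (- (fst w * snd w / p)))"
  define DR where "DR = (\<lambda>w d. (\<integral>z. \<phi> z * l z d * exp (l z w) \<partial>lborel) * exp (- (fst w * snd w / p)) +
      G w * (- (fst d * snd w + fst w * snd d) / p * exp (- (fst w * snd w / p))))"
  have DR: "(R has_derivative DR w) (at w)" for w
  proof -
    have 1: "((\<lambda>w. fst w * snd w * (- 1 / p)) has_derivative (\<lambda>d. (fst w * snd d + fst d * snd w) * (- 1 / p))) (at w)"
      by (intro has_derivative_mult_left has_derivative_mult has_derivative_fst has_derivative_snd has_derivative_ident)
    have "(exp has_derivative (*) (exp (fst w * snd w * (- 1 / p)))) (at (fst w * snd w * (- 1 / p)))"
      using DERIV_exp unfolding has_field_derivative_def by blast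
    from has_derivative_compose[OF 1 this]
    have "((\<lambda>w. exp (fst w * snd w * (- 1 / p))) has_derivative
       (\<lambda>d. exp (fst w * snd w * (- 1 / p)) * ((fst w * snd d + fst d * snd w) * (- 1 / p)))) (at w)" .
    from has_derivative_mult[OF D this]
    have *: "(R has_derivative (\<lambda>d. G w * (exp (fst w * snd w * (- 1 / p)) * ((fst w * snd d + fst d * snd w) * (- 1 / p))) +
      (\<integral>z. \<phi> z * l z d * exp (l z w) \<partial>lborel) * exp (fst w * snd w * (- 1 / p)))) (at w)"
      by (simp add: R_def)
    show ?thesis by (rule has_derivative_eq_rhs[OF *]) (simp add: DR_def fun_eq_iff divide_inverse algebra_simps)
  qed
  have lC: "l z (c * fst d, c * snd d) = c * l z d" for z c d by (simp add: l_def algebra_simps)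
  have DRC: "DR w (c * fst d, c * snd d) = c * DR w d" for w c d
  proof -
    have "(\<integral>z. \<phi> z * l z (c * fst d, c * snd d) * exp (l z w) \<partial>lborel) = (\<integral>z. c * (\<phi> z * l z d * exp (l z w)) \<partial>lborel)"
      by (simp only: lC mult_ac)
    also have "\<dots> = c * (\<integral>z. \<phi> z * l z d * exp (l z w) \<partial>lborel)" by (rule integral_mult_right_zero)
    finally show ?thesis using p0 by (simp add: DR_def field_simps)
  qed
  have shift: "R (w + t *\<^sub>R (p * s, p * cnj s)) = R w" for w s and t :: real
  proof -
    define u where "u = of_real t * s"
    obtain a b where w: "w = (a, b)" by (cases w)
    have ws: "w + t *\<^sub>R (p * s, p * cnj s) = (a + p * u, b + p * cnj u)"
      by (simp add: w u_def scaleR_conv_of_real)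
    have "\<phi> (u + y) * exp (l (u + y) (a, b)) =
        exp (- (p * u * cnj u + cnj u * a + b * u)) * (\<phi> y * exp (l y (a + p * u, b + p * cnj u)))" for y
      unfolding \<phi>_def l_def complex_norm_square mult_exp_exp
      by (rule arg_cong[where f = exp]) (simp add: algebra_simps)
    hence "(\<integral>y. \<phi> (u + y) * exp (l (u + y) (a, b)) \<partial>lborel) =
       exp (- (p * u * cnj u + cnj u * a + b * u)) * G (a + p * u, b + p * cnj u)"
      by (simp add: G_def)
    also have "(\<integral>y. \<phi> (u + y) * exp (l (u + y) (a, b)) \<partial>lborel) = (\<integral>y. \<phi> y * exp (l y (a, b)) \<partial>distr lborel borel ((+) u))"
      by (subst integral_distr)
         (auto simp: \<phi>_def l_def intro!: borel_measurable_continuous_onI continuous_intros)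
    also have "\<dots> = G (a, b)" by (simp add: lborel_distr_plus G_def)
    finally have G: "G (a, b) = exp (- (p * u * cnj u + cnj u * a + b * u)) * G (a + p * u, b + p * cnj u)" .
    have "R w = G (a + p * u, b + p * cnj u) * (exp (- (p * u * cnj u + cnj u * a + b * u)) * exp (- (a * b / p)))"
      by (simp add: R_def w G)
    also have "exp (- (p * u * cnj u + cnj u * a + b * u)) * exp (- (a * b / p)) =
        exp (- ((a + p * u) * (b + p * cnj u) / p))"
      unfolding mult_exp_exp by (rule arg_cong[where f = exp]) (use p0 in \<open>simp add: field_simps\<close>)
    finally show ?thesis unfolding ws by (simp only: R_def fst_conv snd_conv)
  qed
  note [simp del] = scaleR_Pair
  have DR0: "DR w (p * s, p * cnj s) = 0" for w s
  proof -
    have "((\<lambda>t. R (w + t *\<^sub>R (p * s, p * cnj s))) has_derivative (\<lambda>t. DR w (t *\<^sub>R (p * s, p * cnj s)))) (at 0)"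
      by (rule has_derivative_compose[where g = R and f = "\<lambda>t. w + t *\<^sub>R (p * s, p * cnj s)"])
         (auto intro!: derivative_eq_intros DR)
    moreover have "((\<lambda>t::real. R w) has_derivative (\<lambda>t. 0)) (at 0)" by auto
    ultimately have "(\<lambda>t. DR w (t *\<^sub>R (p * s, p * cnj s))) = (\<lambda>t. 0)"
      unfolding shift by (rule has_derivative_unique)
    from fun_cong[OF this, of 1] show ?thesis by simp
  qed
  have "DR w d = 0" for w d
  proof -
    have lin: "linear (DR w)" using DR[of w] by (rule has_derivative_linear)
    define x y where "x = fst d / p" and "y = snd d / p"
    have x: "fst d = p * x" and y: "snd d = p * y" using p0 by (simp_all add: x_def y_def)
    \<comment> \<open>The invariant directions for s = 1 and s = i span the complex plane pairs over
      the complex numbers, so complex linearity of the derivative makes it vanish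
      everywhere.\<close>
    have "d = (1/2) *\<^sub>R (((x+y) * (p * 1), (x+y) * (p * cnj 1)) + ((x-y) * -\<i> * (p * \<i>), (x-y) * - \<i> * (p * cnj \<i>)))"
      by (rule prod_eqI) (simp_all add: x y scaleR_conv_of_real algebra_simps)
    hence "DR w d = (1/2) *\<^sub>R (DR w ((x+y) * (p * 1), (x+y) * (p * cnj 1)) + DR w ((x-y) * -\<i> * (p * \<i>), (x-y) * - \<i> * (p * cnj \<i>)))"
      by (simp only: linear_scale[OF lin] linear_add[OF lin])
    also have "\<dots> = 0"
      using DRC[of w "x + y" "(p * 1, p * cnj 1)"] DRC[of w "(x - y) * - \<i>" "(p * \<i>, p * cnj \<i>)"] DR0[of w 1] DR0[of w \<i>]
      by simp
    finally show ?thesis .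
  qed
  hence "DR = (\<lambda>w d. 0)" by (simp add: fun_eq_iff)
  hence "R (a, b) = R (0, 0)"
    using has_derivative_zero_unique[of UNIV R "(a,b)" "(0,0)"] DR by auto
  also have "\<dots> = pi / p" using gauss_complex(2)[OF p] by (simp add: R_def G_def l_def \<phi>_def)
  finally have "G (a, b) * exp (- (a * b / p)) = pi / p" by (simp add: R_def)
  hence "G (a, b) * exp (- (a * b / p)) * exp (a * b / p) = pi / p * exp (a * b / p)" by simp
  hence "G (a, b) = pi / p * exp (a * b / p)" by (simp add: mult.assoc mult_exp_exp)
  thus ?thesis by (simp add: G_def \<phi>_def l_def mult_exp_exp algebra_simps)
qed

subsection \<open>Gaussian integrals in several variables\<close>

text \<open>The matrix is a unipotent upper block triangular matrix times a lower block triangular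
  one, whose diagonal blocks are the Schur complement and the pivot. This is elimination of the last
  variable.\<close>

lemma det_Schur_complement:
  fixes P :: "nat \<Rightarrow> nat \<Rightarrow> complex"
  assumes p: "P m m \<noteq> 0"
  shows "Determinant.det (Matrix.mat (Suc m) (Suc m) (\<lambda>(i, l). P i l)) =
    P m m * Determinant.det (Matrix.mat m m (\<lambda>(i, l). P i l - P i m * P m l / P m m))"
proof -
  let ?A = "Matrix.mat (Suc m) (Suc m) (\<lambda>(i, l). P i l)"
  let ?B = "Matrix.mat m m (\<lambda>(i, l). P i l - P i m * P m l / P m m)"
  let ?U = "four_block_mat (1\<^sub>m m) (Matrix.mat m 1 (\<lambda>(i, l). P i m / P m m)) (0\<^sub>m 1 m) (1\<^sub>m 1)"
  let ?L = "four_block_mat ?B (0\<^sub>m m 1) (Matrix.mat 1 m (\<lambda>(i, l). P m l)) (Matrix.mat 1 1 (\<lambda>_. P m m))"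
  have M: "?U * (four_block_mat ?B (Matrix.mat m 1 (\<lambda>_. 0)) (Matrix.mat 1 m (\<lambda>(i, l). P m l)) (Matrix.mat 1 1 (\<lambda>_. P m m))) = ?A"
    (is "?U * ?L' = _")
  proof -
    have "?U * ?L' = four_block_mat
       (1\<^sub>m m * ?B + Matrix.mat m 1 (\<lambda>(i, l). P i m / P m m) * Matrix.mat 1 m (\<lambda>(i, l). P m l))
       (1\<^sub>m m * Matrix.mat m 1 (\<lambda>_. 0) + Matrix.mat m 1 (\<lambda>(i, l). P i m / P m m) * Matrix.mat 1 1 (\<lambda>_. P m m))
       (0\<^sub>m 1 m * ?B + 1\<^sub>m 1 * Matrix.mat 1 m (\<lambda>(i, l). P m l))
       (0\<^sub>m 1 m * Matrix.mat m 1 (\<lambda>_. 0) + 1\<^sub>m 1 * Matrix.mat 1 1 (\<lambda>_. P m m))"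
      by (rule mult_four_block_mat) auto
    also have "\<dots> = ?A"
    proof (rule eq_matI)
      fix i l assume "i < dim_row ?A" "l < dim_col ?A"
      hence "i < Suc m" "l < Suc m" by auto
      thus "four_block_mat
       (1\<^sub>m m * ?B + Matrix.mat m 1 (\<lambda>(i, l). P i m / P m m) * Matrix.mat 1 m (\<lambda>(i, l). P m l))
       (1\<^sub>m m * Matrix.mat m 1 (\<lambda>_. 0) + Matrix.mat m 1 (\<lambda>(i, l). P i m / P m m) * Matrix.mat 1 1 (\<lambda>_. P m m))
       (0\<^sub>m 1 m * ?B + 1\<^sub>m 1 * Matrix.mat 1 m (\<lambda>(i, l). P m l))
       (0\<^sub>m 1 m * Matrix.mat m 1 (\<lambda>_. 0) + 1\<^sub>m 1 * Matrix.mat 1 1 (\<lambda>_. P m m)) $$ (i, l) = ?A $$ (i, l)"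
        using p by (cases "i < m"; cases "l < m")
          (auto simp: scalar_prod_def less_Suc_eq mult_ac)
    qed auto
    finally show ?thesis .
  qed
  have 0: "Matrix.mat m 1 (\<lambda>_. 0) = (0\<^sub>m m 1 :: complex mat)" by (rule eq_matI) auto
  have U: "?U \<in> carrier_mat (m + 1) (m + 1)" by (rule four_block_carrier_mat) auto
  have L: "?L \<in> carrier_mat (m + 1) (m + 1)" by (rule four_block_carrier_mat) auto
  have "Determinant.det ?A = Determinant.det ?U * Determinant.det ?L"
    using det_mult[OF U L] M unfolding 0 by simp
  also have "Determinant.det ?U = Determinant.det (1\<^sub>m m :: complex mat) * Determinant.det (1\<^sub>m 1 :: complex mat)"
    by (rule det_four_block_mat_lower_left_zero) auto
  also have "Determinant.det ?L = Determinant.det ?B * Determinant.det (Matrix.mat 1 1 (\<lambda>_. P m m))"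
    by (rule det_four_block_mat_upper_right_zero) auto
  also have "Determinant.det (Matrix.mat 1 1 (\<lambda>_. P m m)) = P m m"
    by (subst det_single) auto
  finally show ?thesis by simp
qed

interpretation lborel_PiM: product_sigma_finite "\<lambda>_::nat. (lborel :: complex measure)"
  by standard

abbreviation CPi :: "nat \<Rightarrow> (nat \<Rightarrow> complex) measure" where
  "CPi m \<equiv> Pi\<^sub>M {..<m} (\<lambda>_. lborel)"

lemma gauss_real_complex:
  assumes "c > 0"
  shows "integrable lborel (\<lambda>u::complex. exp (- c * (cmod u)\<^sup>2))"
    and "(\<integral>\<^sup>+u. ennreal (exp (- c * (cmod u)\<^sup>2)) \<partial>(lborel :: complex measure)) = ennreal (pi / c)"
proof -
  have "integrable lborel (\<lambda>u::complex. norm (exp (- complex_of_real c * complex_of_real ((cmod u)\<^sup>2))))"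
    by (intro integrable_norm gauss_complex) (use assms in auto)
  thus I: "integrable lborel (\<lambda>u::complex. exp (- c * (cmod u)\<^sup>2))" by (simp add: norm_exp_eq_Re)
  have "complex_of_real (\<integral>u. exp (- c * (cmod u)\<^sup>2) \<partial>(lborel :: complex measure)) =
     (\<integral>u. exp (- complex_of_real c * complex_of_real ((cmod u)\<^sup>2)) \<partial>lborel)"
    by (subst integral_complex_of_real[symmetric]) (simp add: exp_of_real[symmetric])
  also have "\<dots> = of_real (pi / c)" using assms by (subst gauss_complex(2)) auto
  finally have "(\<integral>u. exp (- c * (cmod u)\<^sup>2) \<partial>(lborel :: complex measure)) = pi / c" by (simp only: of_real_eq_iff)
  thus "(\<integral>\<^sup>+u. ennreal (exp (- c * (cmod u)\<^sup>2)) \<partial>(lborel :: complex measure)) = ennreal (pi / c)"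
    by (subst nn_integral_eq_integral[OF I]) auto
qed

lemma gauss_real_CPi:
  assumes "c > 0"
  shows "integrable (CPi m) (\<lambda>x. exp (- c * (\<Sum>i<m. (cmod (x i))\<^sup>2)))"
    and "(\<integral>\<^sup>+x. ennreal (exp (- c * (\<Sum>i<m. (cmod (x i))\<^sup>2))) \<partial>CPi m) = ennreal ((pi / c) ^ m)"
proof -
  have eq: "exp (- c * (\<Sum>i<m. (cmod (x i))\<^sup>2)) = (\<Prod>i<m. exp (- c * (cmod (x i))\<^sup>2))" for x :: "nat \<Rightarrow> complex"
    by (simp add: exp_sum[symmetric] sum_distrib_left sum_negf)
  show "integrable (CPi m) (\<lambda>x. exp (- c * (\<Sum>i<m. (cmod (x i))\<^sup>2)))"
    unfolding eq by (rule lborel_PiM.product_integrable_prod) (use gauss_real_complex[OF assms] in auto)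
  have "(\<integral>\<^sup>+x. ennreal (exp (- c * (\<Sum>i<m. (cmod (x i))\<^sup>2))) \<partial>CPi m) =
     (\<integral>\<^sup>+x. (\<Prod>i<m. ennreal (exp (- c * (cmod (x i))\<^sup>2))) \<partial>CPi m)"
    by (simp only: eq) (simp add: prod_ennreal)
  also have "\<dots> = (\<Prod>i<m. \<integral>\<^sup>+u. ennreal (exp (- c * (cmod u)\<^sup>2)) \<partial>(lborel :: complex measure))"
    by (rule lborel_PiM.product_nn_integral_prod) auto
  also have "\<dots> = ennreal ((pi / c) ^ m)"
    by (subst gauss_real_complex(2)[OF assms]) (use assms in \<open>simp add: ennreal_power\<close>)
  finally show "(\<integral>\<^sup>+x. ennreal (exp (- c * (\<Sum>i<m. (cmod (x i))\<^sup>2))) \<partial>CPi m) = ennreal ((pi / c) ^ m)" .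
qed

text \<open>Integrating out the last variable by \<open>gauss_complex_linear\<close> leaves the
  Gaussian of the Schur complement, and determinants multiply accordingly. The coercivity constant e
  is inherited, so the induction goes through.\<close>

lemma gauss_CPi:
  fixes P :: "nat \<Rightarrow> nat \<Rightarrow> complex"
  assumes "e > 0"
    and "\<And>y. Re (\<Sum>i<m. \<Sum>l<m. cnj (y i) * P i l * y l) \<ge> e * (\<Sum>i<m. (cmod (y i))\<^sup>2)"
  shows "integrable (CPi m) (\<lambda>y. exp (- (\<Sum>i<m. \<Sum>l<m. cnj (y i) * P i l * y l))) \<and>
    (\<integral>y. exp (- (\<Sum>i<m. \<Sum>l<m. cnj (y i) * P i l * y l)) \<partial>CPi m) =
      pi ^ m / Determinant.det (Matrix.mat m m (\<lambda>(i, l). P i l))"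
  using assms(2)
proof (induction m arbitrary: P)
  \<comment> \<open>Over the empty index set the product measure is a point mass, and the empty
    determinant is 1.\<close>
  case 0
  show ?case by (simp add: PiM_empty integrable_count_space lebesgue_integral_count_space_finite)
next
  case (Suc m P)
  define Q where "Q = (\<lambda>m (P :: nat \<Rightarrow> nat \<Rightarrow> complex) y. \<Sum>i<m. \<Sum>l<m. cnj (y i) * P i l * y l)"
  define p where "p = P m m"
  define P' where "P' = (\<lambda>i l. P i l - P i m * P m l / p)"
  define a where "a = (\<lambda>x. \<Sum>l<m. P m l * x l)"
  define b where "b = (\<lambda>x. \<Sum>i<m. cnj (x i) * P i m)"
  have pos: "Re (Q (Suc m) P y) \<ge> e * (\<Sum>i<Suc m. (cmod (y i))\<^sup>2)" for y
    using Suc.prems by (simp add: Q_def)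
  have QS: "Q (Suc m) P (x(m := y)) = Q m P x + (p * complex_of_real ((cmod y)\<^sup>2) + cnj y * a x + b x * y)" for x y
  proof -
    have "Q (Suc m) P (x(m := y)) = (\<Sum>i<m. (\<Sum>l<m. cnj (x i) * P i l * x l) + cnj (x i) * P i m * y)
       + ((\<Sum>l<m. cnj y * P m l * x l) + cnj y * p * y)"
      by (simp add: Q_def p_def)
    also have "\<dots> = Q m P x + (p * (y * cnj y) + cnj y * a x + b x * y)"
      by (simp add: Q_def a_def b_def sum.distrib sum_distrib_left sum_distrib_right algebra_simps)
    finally show ?thesis by (simp only: complex_norm_square)
  qed
  have "Re p > 0"
  proof -
    have "Q (Suc m) P ((\<lambda>_. 0)(m := 1)) = p"
      by (subst QS) (simp add: Q_def a_def b_def)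
    moreover have "(\<Sum>i<Suc m. (cmod (((\<lambda>_. 0)(m := 1)) i))\<^sup>2) = 1" by simp
    ultimately show ?thesis using pos[of "(\<lambda>_. 0)(m := 1)"] assms(1) by simp
  qed
  hence p0: "p \<noteq> 0" by auto
  have ab: "a x * b x / p = Q m P x - Q m P' x" for x
  proof -
    have "b x * a x = (\<Sum>i<m. \<Sum>l<m. cnj (x i) * (P i m * P m l) * x l)"
      unfolding a_def b_def sum_product by (simp add: mult_ac)
    moreover have "Q m P x - Q m P' x = (\<Sum>i<m. \<Sum>l<m. cnj (x i) * (P i m * P m l) * x l) / p"
      unfolding Q_def P'_def sum_subtractf[symmetric] sum_divide_distrib by (simp add: field_simps)
    ultimately show ?thesis by (simp add: mult.commute)
  qed
  have pos': "Re (Q m P' x) \<ge> e * (\<Sum>i<m. (cmod (x i))\<^sup>2)" for x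
  proof -
    \<comment> \<open>This y kills p y + a(x); at it the form in m + 1 variables takes the value of
      the Schur complement, whose positivity follows.\<close>
    define y where "y = - a x / p"
    have "p * complex_of_real ((cmod y)\<^sup>2) + cnj y * a x + b x * y = cnj y * (p * y + a x) + b x * y"
      by (simp only: complex_norm_square) (simp add: algebra_simps)
    also have "\<dots> = - (a x * b x / p)" using p0 by (simp add: y_def)
    finally have "Q (Suc m) P (x(m := y)) = Q m P' x" by (simp only: QS ab) simp
    moreover have "(\<Sum>i<Suc m. (cmod ((x(m := y)) i))\<^sup>2) = (\<Sum>i<m. (cmod (x i))\<^sup>2) + (cmod y)\<^sup>2" by simp
    ultimately have "e * ((\<Sum>i<m. (cmod (x i))\<^sup>2) + (cmod y)\<^sup>2) \<le> Re (Q m P' x)"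
      using pos[of "x(m := y)"] by simp
    thus ?thesis using assms(1) by (simp add: distrib_left) (smt (verit) mult_nonneg_nonneg zero_le_power2)
  qed
  have IH: "integrable (CPi m) (\<lambda>x. exp (- Q m P' x))"
    "(\<integral>x. exp (- Q m P' x) \<partial>CPi m) = pi ^ m / Determinant.det (Matrix.mat m m (\<lambda>(i, l). P' i l))"
    using Suc.IH[of P'] pos' by (simp_all add: Q_def)
  have [measurable]: "(\<lambda>y. exp (- Q (Suc m) P y)) \<in> borel_measurable (CPi (Suc m))"
  proof -
    have [measurable]: "(\<lambda>y. y i) \<in> borel_measurable (CPi (Suc m))" if "i < Suc m" for i
      using measurable_component_singleton[of i "{..<Suc m}" "\<lambda>_. lborel :: complex measure"] that by simp
    have [measurable]: "cnj \<in> borel_measurable borel"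
      by (intro borel_measurable_continuous_onI continuous_intros)
    have [measurable]: "Q (Suc m) P \<in> borel_measurable (CPi (Suc m))"
      unfolding Q_def by (rule borel_measurable_sum, rule borel_measurable_sum) auto
    show ?thesis by measurable
  qed
  have I: "integrable (CPi (Suc m)) (\<lambda>y. exp (- Q (Suc m) P y))"
    by (rule Bochner_Integration.integrable_bound[OF gauss_real_CPi(1)[OF assms(1), of "Suc m"]])
       (use pos in \<open>auto simp: norm_exp_eq_Re simp del: sum.lessThan_Suc\<close>)
  have "(\<integral>y. exp (- Q (Suc m) P y) \<partial>CPi (Suc m)) =
    (\<integral>x. (\<integral>y. exp (- Q (Suc m) P (x(m := y))) \<partial>lborel) \<partial>CPi m)"
    unfolding lessThan_Suc
    by (rule lborel_PiM.product_integral_insert) (use I in \<open>auto simp: lessThan_Suc\<close>)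
  also have "\<dots> = (\<integral>x. pi / p * exp (- Q m P' x) \<partial>CPi m)"
  proof (rule Bochner_Integration.integral_cong[OF refl])
    fix x
    have "(\<integral>y. exp (- Q (Suc m) P (x(m := y))) \<partial>lborel) =
      (\<integral>y. exp (- Q m P x) * exp (- (p * complex_of_real ((cmod y)\<^sup>2) + cnj y * a x + b x * y)) \<partial>lborel)"
      by (simp only: QS minus_add_distrib exp_add)
    also have "\<dots> = exp (- Q m P x) * (pi / p * exp (a x * b x / p))"
      by (simp only: integral_mult_right_zero gauss_complex_linear[OF \<open>Re p > 0\<close>])
    also have "\<dots> = pi / p * exp (- Q m P' x)"
      unfolding ab by (simp add: mult_exp_exp)
    finally show "(\<integral>y. exp (- Q (Suc m) P (x(m := y))) \<partial>lborel) = pi / p * exp (- Q m P' x)" .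
  qed
  also have "\<dots> = pi / p * (pi ^ m / Determinant.det (Matrix.mat m m (\<lambda>(i, l). P' i l)))"
    by (simp only: integral_mult_right_zero IH(2))
  also have "\<dots> = pi ^ Suc m / Determinant.det (Matrix.mat (Suc m) (Suc m) (\<lambda>(i, l). P i l))"
    using p0 by (simp add: det_Schur_complement[of P m] p_def P'_def)
  finally show ?case using I by (simp add: Q_def)
qed

text \<open>Boxes determine a product measure, and a translation moves a box factor by
  factor.\<close>

lemma CPi_translation:
  "distr (CPi m) (CPi m) (\<lambda>x. \<lambda>i\<in>{..<m}. x i + a i) = CPi m"
proof (rule lborel_PiM.PiM_eqI)
  fix A :: "nat \<Rightarrow> complex set" assume A: "\<And>i. i \<in> {..<m} \<Longrightarrow> A i \<in> sets lborel"
  have [measurable]: "(\<lambda>x. \<lambda>i\<in>{..<m}. x i + a i) \<in> measurable (CPi m) (CPi m)"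
    by measurable
  have "emeasure (distr (CPi m) (CPi m) (\<lambda>x. \<lambda>i\<in>{..<m}. x i + a i)) (Pi\<^sub>E {..<m} A) =
     emeasure (CPi m) ((\<lambda>x. \<lambda>i\<in>{..<m}. x i + a i) -` Pi\<^sub>E {..<m} A \<inter> space (CPi m))"
    using A by (subst emeasure_distr) (auto intro!: sets_PiM_I_finite)
  also have "(\<lambda>x. \<lambda>i\<in>{..<m}. x i + a i) -` Pi\<^sub>E {..<m} A \<inter> space (CPi m) =
      Pi\<^sub>E {..<m} (\<lambda>i. (\<lambda>u. a i + u) -` A i)"
    by (auto simp: space_PiM PiE_iff extensional_def add.commute)
  also have "emeasure (CPi m) \<dots> = (\<Prod>i\<in>{..<m}. emeasure lborel ((\<lambda>u. a i + u) -` A i))"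
    using A by (intro lborel_PiM.emeasure_PiM) (auto intro!: measurable_sets_borel[of "\<lambda>u. _ + u" borel])
  also have "\<dots> = (\<Prod>i\<in>{..<m}. emeasure lborel (A i))"
  proof (rule prod.cong[OF refl])
    fix i assume "i \<in> {..<m}"
    hence "emeasure (distr lborel borel (\<lambda>u. a i + u)) (A i) = emeasure lborel ((\<lambda>u. a i + u) -` A i)"
      using A by (subst emeasure_distr) auto
    thus "emeasure lborel ((\<lambda>u. a i + u) -` A i) = emeasure lborel (A i)"
      by (simp add: lborel_distr_plus)
  qed
  finally show "emeasure (distr (CPi m) (CPi m) (\<lambda>x. \<lambda>i\<in>{..<m}. x i + a i)) (Pi\<^sub>E {..<m} A) = (\<Prod>i\<in>{..<m}. emeasure lborel (A i))" .
qed auto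

context fock_space
begin

subsection \<open>Translation-invariant measures and the Gaussian measure\<close>

text \<open>This is 1/(2 hbar), the constant in the Gaussian weight.\<close>

definition kap :: real where "kap = pi / h"

lemma kap_pos: "kap > 0" using h_pos by (simp add: kap_def)

definition wt :: "'v \<Rightarrow> real" where "wt z = exp (- kap * nm z)"

lemma wt_pos: "wt z > 0" by (simp add: wt_def)

lemma gauss_weight_wt: "gauss_weight h \<Omega> j = wt"
  using h_pos by (simp add: fun_eq_iff gauss_weight_def wt_def kap_def hbar_def nm_Re)

lemma bounded_bilinear_H: "bounded_bilinear H"
proof -
  obtain c where c: "c > 0" "\<And>v. sqrt (nm v) \<le> c * norm v" using nm_le_norm by blast
  show ?thesis
  proof (rule bounded_bilinear.intro)
    show "\<exists>K. \<forall>a b. norm (H a b) \<le> norm a * norm b * K"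
    proof (intro exI[of _ "c * c"] allI)
      fix a b
      have "norm (H a b) \<le> sqrt (nm a) * sqrt (nm b)"
        using cmod_H_le[of a b] by (simp add: real_le_rsqrt flip: real_sqrt_mult)
      also have "\<dots> \<le> (c * norm a) * (c * norm b)"
        using c by (intro mult_mono) auto
      finally show "norm (H a b) \<le> norm a * norm b * (c * c)" by (simp add: mult_ac)
    qed
  qed (simp_all add: H_simps scaleR_conv_of_real)
qed

lemmas continuous_on_H [continuous_intros] = bounded_bilinear.continuous_on[OF bounded_bilinear_H]

lemma continuous_on_nm [continuous_intros]: "continuous_on A f \<Longrightarrow> continuous_on A (\<lambda>x. nm (f x))"
  unfolding nm_Re by (intro continuous_intros)

lemma continuous_on_wt [continuous_intros]: "continuous_on A f \<Longrightarrow> continuous_on A (\<lambda>x. wt (f x))"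
  unfolding wt_def by (intro continuous_intros)

lemma continuous_on_linear: "linear (f :: 'v \<Rightarrow> 'b::real_normed_vector) \<Longrightarrow> continuous_on A g \<Longrightarrow> continuous_on A (\<lambda>x. f (g x))"
  by (rule bounded_linear.continuous_on[OF linear_bounded_linear])

lemma borel_H [measurable]: "(\<lambda>v. H v w) \<in> borel_measurable borel" "(\<lambda>v. H w v) \<in> borel_measurable borel"
  by (intro borel_measurable_continuous_onI continuous_intros)+

lemma borel_nm [measurable]: "nm \<in> borel_measurable borel" and borel_wt [measurable]: "wt \<in> borel_measurable borel"
  by (intro borel_measurable_continuous_onI continuous_on_nm continuous_on_wt continuous_on_id)+

lemma borel_shift [measurable]: "(\<lambda>z::'v. z + a) \<in> borel_measurable borel" "(\<lambda>z::'v. a + z) \<in> borel_measurable borel"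
  "(\<lambda>z::'v. z - a) \<in> borel_measurable borel" "(\<lambda>z::'v. a - z) \<in> borel_measurable borel"
  "(\<lambda>z::'v. - z) \<in> borel_measurable borel" "(\<lambda>z::'v. r *\<^sub>R z) \<in> borel_measurable borel"
  by (intro borel_measurable_continuous_onI continuous_intros)+

text \<open>
  The class of \<open>'v\<close> does not include second countability, so continuous functions on \<open>V \<times> V\<close> are
  shown to be measurable for the product \<open>\<sigma>\<close>-algebra by factoring through coordinates.
\<close>

definition crd :: "'v list \<Rightarrow> 'v \<Rightarrow> nat \<Rightarrow> complex" where
  "crd bs v = (\<lambda>k. if k < length bs then H v (bs ! k) else 0)"

lemma measurable_crd [measurable]: "crd bs \<in> borel_measurable borel"
  by (rule measurable_coordinatewise_then_product) (simp add: crd_def)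

lemma cmb_crd: "orthonormal_basis UNIV bs \<Longrightarrow> cmb bs (crd bs v) = v"
  using orthonormal_basis_expand[of UNIV bs v] by (simp add: cmb_def crd_def)

lemma measurable_continuous_pair:
  fixes f :: "'v \<times> 'v \<Rightarrow> 'b::topological_space"
  assumes "continuous_on UNIV f" shows "f \<in> borel_measurable (borel \<Otimes>\<^sub>M borel)"
proof -
  obtain bs where bs: "orthonormal_basis UNIV bs" using orthonormal_basis_UNIV_exists by blast
  have "continuous_on UNIV (\<lambda>p. f (cmb bs (fst p), cmb bs (snd p)))"
    by (intro continuous_on_compose2[OF assms] continuous_on_Pair continuous_on_compose2[OF continuous_cmb]
        continuous_on_fst continuous_on_snd continuous_on_id) auto
  hence [measurable]: "(\<lambda>p. f (cmb bs (fst p), cmb bs (snd p))) \<in> borel_measurable (borel \<Otimes>\<^sub>M borel)"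
    unfolding borel_prod by (rule borel_measurable_continuous_onI)
  have "(\<lambda>q. (\<lambda>p. f (cmb bs (fst p), cmb bs (snd p))) (crd bs (fst q), crd bs (snd q))) \<in> borel_measurable (borel \<Otimes>\<^sub>M borel)"
    by measurable
  thus ?thesis by (simp add: cmb_crd[OF bs])
qed

lemma measurable_continuous_pair':
  fixes f :: "real \<times> 'v \<Rightarrow> 'b::topological_space"
  assumes "continuous_on UNIV f" shows "f \<in> borel_measurable (borel \<Otimes>\<^sub>M borel)"
proof -
  obtain bs where bs: "orthonormal_basis UNIV bs" using orthonormal_basis_UNIV_exists by blast
  have "continuous_on UNIV (\<lambda>p. f (fst p, cmb bs (snd p)))"
    by (intro continuous_on_compose2[OF assms] continuous_on_Pair continuous_on_compose2[OF continuous_cmb]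
        continuous_on_fst continuous_on_snd continuous_on_id) auto
  hence [measurable]: "(\<lambda>p. f (fst p, cmb bs (snd p))) \<in> borel_measurable (borel \<Otimes>\<^sub>M borel)"
    unfolding borel_prod by (rule borel_measurable_continuous_onI)
  have "(\<lambda>q. (\<lambda>p. f (fst p, cmb bs (snd p))) (fst q, crd bs (snd q))) \<in> borel_measurable (borel \<Otimes>\<^sub>M borel)"
    by measurable
  thus ?thesis by (simp add: cmb_crd[OF bs])
qed

definition trans_inv :: "'v measure \<Rightarrow> bool" where
  "trans_inv \<nu> \<longleftrightarrow> sets \<nu> = sets borel \<and> (\<forall>a. distr \<nu> borel (\<lambda>z. z + a) = \<nu>)"

lemma trans_inv_nn:
  assumes "trans_inv \<nu>" and [measurable]: "f \<in> borel_measurable borel"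
  shows "(\<integral>\<^sup>+z. f (z + a) \<partial>\<nu>) = (\<integral>\<^sup>+z. f z \<partial>\<nu>)"
proof -
  have [measurable_cong]: "sets \<nu> = sets borel" using assms(1) by (simp add: trans_inv_def)
  have "(\<integral>\<^sup>+z. f z \<partial>\<nu>) = (\<integral>\<^sup>+z. f z \<partial>distr \<nu> borel (\<lambda>z. z + a))"
    using assms(1) by (simp add: trans_inv_def)
  also have "\<dots> = (\<integral>\<^sup>+z. f (z + a) \<partial>\<nu>)" by (rule nn_integral_distr) measurable
  finally show ?thesis by simp
qed

text \<open>The weight is positive, so its superlevel sets exhaust V; Markov's inequality makes them
  of finite measure.\<close>

lemma sigma_finite_wt:
  assumes [measurable_cong]: "sets \<nu> = sets borel" and fin: "(\<integral>\<^sup>+z. ennreal (wt z) \<partial>\<nu>) < \<infinity>"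
  shows "sigma_finite_measure \<nu>"
proof (rule sigma_finite_measure.intro, intro exI conjI)
  let ?A = "\<lambda>m. {z. 1 \<le> ennreal (real (Suc m)) * ennreal (wt z)}"
  have sp: "space \<nu> = UNIV" using sets_eq_imp_space_eq[OF assms(1)] by simp
  show "countable (range ?A)" by simp
  have m: "?A m \<in> sets \<nu>" for m
  proof -
    have "{z\<in>space \<nu>. 1 \<le> ennreal (real (Suc m)) * ennreal (wt z)} \<in> sets \<nu>" by measurable
    thus ?thesis by (simp add: sp)
  qed
  thus "range ?A \<subseteq> sets \<nu>" by auto
  have "z \<in> \<Union> (range ?A)" for z
  proof -
    obtain m where "1 / wt z < real (Suc m)"
      using reals_Archimedean2 by (metis less_trans of_nat_less_iff lessI)
    hence "1 \<le> real (Suc m) * wt z" using wt_pos[of z] by (simp add: field_simps)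
    hence "ennreal 1 \<le> ennreal (real (Suc m) * wt z)" by (rule ennreal_leI)
    hence "1 \<le> ennreal (real (Suc m)) * ennreal (wt z)" by (subst ennreal_mult[symmetric]) (auto simp: wt_def)
    thus ?thesis by blast
  qed
  thus "\<Union> (range ?A) = space \<nu>" by (auto simp: sp)
  have "emeasure \<nu> (?A m) \<noteq> \<infinity>" for m
  proof -
    have "emeasure \<nu> (?A m) \<le> ennreal (real (Suc m)) * (\<integral>\<^sup>+z. ennreal (wt z) * indicator UNIV z \<partial>\<nu>)"
      using nn_integral_Markov_inequality[of "\<lambda>z. ennreal (wt z)" UNIV \<nu> "ennreal (real (Suc m))"] by (simp add: sp)
    also have "\<dots> < \<infinity>" using fin by (simp add: ennreal_mult_less_top del: of_nat_Suc)
    finally show ?thesis by simp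
  qed
  thus "\<forall>a\<in>range ?A. emeasure \<nu> a \<noteq> \<infinity>" by auto
qed

text \<open>The classical proof of uniqueness of Haar measure: Tonelli for f(x + y) g(y), then the
  shift of y by x and the shift of x by y. It is an equation of products because the integrals may
  be infinite and cannot be divided by.\<close>

lemma Haar_unique:
  assumes t1: "trans_inv \<nu>1" and t2: "trans_inv \<nu>2"
    and s1: "sigma_finite_measure \<nu>1" and s2: "sigma_finite_measure \<nu>2"
    and [measurable]: "f \<in> borel_measurable borel" "g \<in> borel_measurable borel"
  shows "(\<integral>\<^sup>+z. f z \<partial>\<nu>1) * (\<integral>\<^sup>+z. g z \<partial>\<nu>2) = (\<integral>\<^sup>+z. f z \<partial>\<nu>2) * (\<integral>\<^sup>+z. g (- z) \<partial>\<nu>1)"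
proof -
  interpret pair_sigma_finite \<nu>1 \<nu>2 using s1 s2 by (rule pair_sigma_finite.intro)
  have [measurable_cong]: "sets \<nu>1 = sets borel" "sets \<nu>2 = sets borel"
    using t1 t2 by (auto simp: trans_inv_def)
  have [measurable]: "(\<lambda>p. fst p + snd p :: 'v) \<in> borel_measurable (borel \<Otimes>\<^sub>M borel)"
    "(\<lambda>p. snd p - fst p :: 'v) \<in> borel_measurable (borel \<Otimes>\<^sub>M borel)"
    by (intro measurable_continuous_pair continuous_intros)+
  have m1 [measurable]: "(\<lambda>(x, y). f (x + y) * g y) \<in> borel_measurable (\<nu>1 \<Otimes>\<^sub>M \<nu>2)"
    unfolding split_def by measurable
  have m2 [measurable]: "(\<lambda>(x, y). f y * g (y - x)) \<in> borel_measurable (\<nu>1 \<Otimes>\<^sub>M \<nu>2)"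
    unfolding split_def by measurable
  have "(\<integral>\<^sup>+z. f z \<partial>\<nu>1) * (\<integral>\<^sup>+z. g z \<partial>\<nu>2) = (\<integral>\<^sup>+y. (\<integral>\<^sup>+x. f (x + y) * g y \<partial>\<nu>1) \<partial>\<nu>2)"
    by (simp add: nn_integral_cmult[symmetric] nn_integral_multc trans_inv_nn[OF t1])
  also have "\<dots> = (\<integral>\<^sup>+x. (\<integral>\<^sup>+y. f (x + y) * g y \<partial>\<nu>2) \<partial>\<nu>1)"
    using Fubini'[OF m1] by simp
  also have "\<dots> = (\<integral>\<^sup>+x. (\<integral>\<^sup>+y. f y * g (y - x) \<partial>\<nu>2) \<partial>\<nu>1)"
  proof (rule nn_integral_cong)
    fix x
    have "(\<lambda>y. f y * g (y - x)) \<in> borel_measurable borel" by measurable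
    from trans_inv_nn[OF t2 this, of x]
    show "(\<integral>\<^sup>+y. f (x + y) * g y \<partial>\<nu>2) = (\<integral>\<^sup>+y. f y * g (y - x) \<partial>\<nu>2)"
      by (simp add: add.commute)
  qed
  also have "\<dots> = (\<integral>\<^sup>+y. (\<integral>\<^sup>+x. f y * g (y - x) \<partial>\<nu>1) \<partial>\<nu>2)"
    using Fubini'[OF m2] by simp
  also have "\<dots> = (\<integral>\<^sup>+y. f y * (\<integral>\<^sup>+x. g (- x) \<partial>\<nu>1) \<partial>\<nu>2)"
  proof (rule nn_integral_cong)
    fix y
    have "(\<lambda>x. g (y - x)) \<in> borel_measurable borel" by measurable
    from trans_inv_nn[OF t1 this, of y]
    have "(\<integral>\<^sup>+x. g (y - x) \<partial>\<nu>1) = (\<integral>\<^sup>+x. g (- x) \<partial>\<nu>1)" by simp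
    moreover have "(\<integral>\<^sup>+x. f y * g (y - x) \<partial>\<nu>1) = f y * (\<integral>\<^sup>+x. g (y - x) \<partial>\<nu>1)"
      by (rule nn_integral_cmult) measurable
    ultimately show "(\<integral>\<^sup>+x. f y * g (y - x) \<partial>\<nu>1) = f y * (\<integral>\<^sup>+x. g (- x) \<partial>\<nu>1)" by simp
  qed
  also have "\<dots> = (\<integral>\<^sup>+z. f z \<partial>\<nu>2) * (\<integral>\<^sup>+z. g (- z) \<partial>\<nu>1)"
    by (rule nn_integral_multc) measurable
  finally show ?thesis .
qed

lemma wt_minus [simp]: "wt (- z) = wt z" by (simp add: wt_def)

text \<open>The weight is even, so the reflection in \<open>Haar_unique\<close> disappears, and the
  Gaussian total masses fix the ratio of two translation-invariant measures.\<close>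

lemma Haar_unique_wt:
  assumes t1: "trans_inv \<nu>1" and t2: "trans_inv \<nu>2"
    and w1: "(\<integral>\<^sup>+z. ennreal (wt z) \<partial>\<nu>1) = ennreal c1" and w2: "(\<integral>\<^sup>+z. ennreal (wt z) \<partial>\<nu>2) = ennreal c2"
    and [measurable]: "f \<in> borel_measurable borel"
  shows "(\<integral>\<^sup>+z. f z \<partial>\<nu>1) * ennreal c2 = (\<integral>\<^sup>+z. f z \<partial>\<nu>2) * ennreal c1"
  using Haar_unique[OF t1 t2 sigma_finite_wt sigma_finite_wt, of f "\<lambda>z. ennreal (wt z)"] t1 t2 w1 w2
  by (simp add: trans_inv_def)

text \<open>An isometric parametrisation of V by m complex coordinates. It is required to be
  additive but not complex linear, so that coordinates conjugated on some of the axes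
  qualify.\<close>

definition param :: "nat \<Rightarrow> ((nat \<Rightarrow> complex) \<Rightarrow> 'v) \<Rightarrow> bool" where
  "param m L \<longleftrightarrow> continuous_on UNIV L \<and> (\<forall>x y. L (\<lambda>i. x i + y i) = L x + L y) \<and>
     (\<forall>x y. (\<forall>i<m. x i = y i) \<longrightarrow> L x = L y) \<and> surj L \<and> (\<forall>x. nm (L x) = (\<Sum>i<m. (cmod (x i))\<^sup>2))"

lemma param_cong: "param m L \<Longrightarrow> (\<And>i. i < m \<Longrightarrow> x i = y i) \<Longrightarrow> L x = L y"
  by (simp add: param_def)

lemma param_measurable: assumes "param m L" shows "L \<in> borel_measurable (CPi m)"
proof -
  \<comment> \<open>Points of \<open>CPi m\<close> are \<open>undefined\<close> beyond m; padding
    with zeros passes from its sigma-algebra to the Borel sets of the full function space, where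
    continuity of L can be used.\<close>
  have m: "(\<lambda>x i. if i < m then x i else 0) \<in> borel_measurable (CPi m)"
  proof (rule measurable_coordinatewise_then_product)
    fix i show "(\<lambda>x. if i < m then x i else 0) \<in> borel_measurable (CPi m)"
      using measurable_component_singleton[of i "{..<m}" "\<lambda>_. lborel :: complex measure"]
      by (cases "i < m") auto
  qed
  have "L \<in> borel_measurable borel"
    using assms by (intro borel_measurable_continuous_onI) (simp add: param_def)
  from measurable_compose[OF m this]
  have "(\<lambda>x. L (\<lambda>i. if i < m then x i else 0)) \<in> borel_measurable (CPi m)" .
  also have "(\<lambda>x. L (\<lambda>i. if i < m then x i else 0)) = L"
    using assms by (auto simp: param_def fun_eq_iff)
  finally show ?thesis .
qed

lemma trans_inv_param:
  assumes "param m L" shows "trans_inv (distr (CPi m) borel L)"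
  unfolding trans_inv_def
proof (intro conjI allI)
  note [measurable] = param_measurable[OF assms]
  fix a
  obtain y where y: "a = L y" using assms unfolding param_def by (meson surjD)
  have [measurable]: "(\<lambda>x. \<lambda>i\<in>{..<m}. x i + y i) \<in> measurable (CPi m) (CPi m)" by measurable
  have L: "L x + a = L (\<lambda>i\<in>{..<m}. x i + y i)" for x
  proof -
    have "L (\<lambda>i. x i + y i) = L (\<lambda>i\<in>{..<m}. x i + y i)"
      by (rule param_cong[OF assms]) simp
    thus ?thesis using assms by (simp add: param_def y)
  qed
  have "distr (distr (CPi m) borel L) borel (\<lambda>z. z + a) = distr (CPi m) borel (\<lambda>x. L x + a)"
    by (subst distr_distr) (auto simp: comp_def)
  also have "\<dots> = distr (CPi m) borel (L \<circ> (\<lambda>x. \<lambda>i\<in>{..<m}. x i + y i))"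
    by (simp add: L comp_def)
  also have "\<dots> = distr (distr (CPi m) (CPi m) (\<lambda>x. \<lambda>i\<in>{..<m}. x i + y i)) borel L"
    by (subst distr_distr) auto
  also have "\<dots> = distr (CPi m) borel L" by (simp only: CPi_translation)
  finally show "distr (distr (CPi m) borel L) borel (\<lambda>z. z + a) = distr (CPi m) borel L" .
qed simp

lemma nn_gauss_param:
  assumes "param m L" "c > 0"
  shows "(\<integral>\<^sup>+z. ennreal (exp (- c * nm z)) \<partial>distr (CPi m) borel L) = ennreal ((pi / c) ^ m)"
proof -
  note [measurable] = param_measurable[OF assms(1)]
  have "(\<integral>\<^sup>+z. ennreal (exp (- c * nm z)) \<partial>distr (CPi m) borel L) = (\<integral>\<^sup>+x. ennreal (exp (- c * nm (L x))) \<partial>CPi m)"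
    by (rule nn_integral_distr) measurable
  also have "\<dots> = ennreal ((pi / c) ^ m)"
    using assms(1) gauss_real_CPi(2)[OF assms(2), of m] by (simp add: param_def)
  finally show ?thesis .
qed

lemma param_cmb: assumes "orthonormal_basis UNIV bs" shows "param (length bs) (cmb bs)"
  unfolding param_def
proof (intro conjI allI impI)
  show "surj (cmb bs)" using cmb_crd[OF assms] by (metis surjI)
  show "nm (cmb bs x) = (\<Sum>i<length bs. (cmod (x i))\<^sup>2)" for x
    using nm_orthonormal_sum[of UNIV bs x] assms by (simp add: orthonormal_basis_def cmb_def)
  show "continuous_on UNIV (cmb bs)" by (rule continuous_cmb)
qed (auto simp: cmb_def sc_add_left sum.distrib)

text \<open>The same choice as the one made inside \<open>lebesgue_V\<close>.\<close>

definition ubs :: "'v list" where "ubs = (SOME bs. is_unitary_basis \<Omega> j bs)"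

lemma orthonormal_basis_ubs: "orthonormal_basis UNIV ubs"
  using orthonormal_basis_UNIV_exists unfolding ubs_def is_unitary_basis_orthonormal_basis by (rule someI_ex)

abbreviation "M \<equiv> lebesgue_V \<Omega> j"

lemma M_eq: "M = distr (CPi (length ubs)) borel (cmb ubs)"
  by (simp add: lebesgue_V_def Let_def ubs_def cmb_def[abs_def])

lemma sets_M [simp, measurable_cong]: "sets M = sets borel" by (simp add: M_eq)

lemma space_M [simp]: "space M = UNIV" by (simp add: M_eq)

lemma trans_inv_M: "trans_inv M"
  unfolding M_eq by (rule trans_inv_param[OF param_cmb[OF orthonormal_basis_ubs]])

definition gauss_const :: real where "gauss_const = (pi / kap) ^ length ubs"

lemma gauss_const_pos: "gauss_const > 0" using kap_pos by (simp add: gauss_const_def)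

lemma nn_exp_M: "c > 0 \<Longrightarrow> (\<integral>\<^sup>+z. ennreal (exp (- c * nm z)) \<partial>M) = ennreal ((pi / c) ^ length ubs)"
  unfolding M_eq by (rule nn_gauss_param[OF param_cmb[OF orthonormal_basis_ubs]])

lemma nn_wt_M: "(\<integral>\<^sup>+z. ennreal (wt z) \<partial>M) = ennreal gauss_const"
  unfolding wt_def gauss_const_def by (rule nn_exp_M[OF kap_pos])

text \<open>Scaled to total mass 1, so that the mean value of a holomorphic function is its value at
  0 without a constant.\<close>

definition gauss :: "'v measure" where "gauss = density M (\<lambda>z. ennreal (wt z / gauss_const))"

lemma sets_gauss [simp, measurable_cong]: "sets gauss = sets borel" by (simp add: gauss_def)

lemma space_gauss [simp]: "space gauss = UNIV" by (simp add: gauss_def)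

lemma nn_gauss: 
  assumes [measurable]: "f \<in> borel_measurable borel"
  shows "(\<integral>\<^sup>+z. f z \<partial>gauss) = (\<integral>\<^sup>+z. ennreal (wt z / gauss_const) * f z \<partial>M)"
  unfolding gauss_def by (rule nn_integral_density) auto

lemma emeasure_gauss_UNIV: "emeasure gauss UNIV = 1"
proof -
  have "emeasure gauss UNIV = (\<integral>\<^sup>+z. 1 \<partial>gauss)" by simp
  also have "\<dots> = (\<integral>\<^sup>+z. ennreal (wt z) / ennreal gauss_const \<partial>M)"
    using gauss_const_pos wt_pos by (subst nn_gauss) (auto simp: divide_ennreal less_imp_le)
  also have "\<dots> = (\<integral>\<^sup>+z. ennreal (wt z) \<partial>M) / ennreal gauss_const"
    by (rule nn_integral_divide) measurable
  also have "\<dots> = 1" using gauss_const_pos by (simp add: nn_wt_M divide_ennreal)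
  finally show ?thesis .
qed

lemma finite_gauss: "finite_measure gauss"
  by (rule finite_measureI) (simp add: emeasure_gauss_UNIV)

sublocale gauss: finite_measure gauss by (rule finite_gauss)
sublocale gauss2: pair_sigma_finite gauss gauss ..

text \<open>Both sides have the density of the weight with respect to translation-invariant
  measures, which are proportional; the Gaussian total mass fixes the factor. Hence integrals may be
  computed in any isometric parametrisation.\<close>

lemma gauss_param:
  assumes p: "param m L"
  shows "gauss = density (distr (CPi m) borel L) (\<lambda>z. ennreal (wt z / (pi / kap) ^ m))" (is "_ = ?D")
proof (rule measure_eqI)
  fix A assume "A \<in> sets gauss"
  hence [measurable]: "A \<in> sets borel" by simp
  let ?\<nu> = "distr (CPi m) borel L" and ?c = "(pi / kap) ^ m"
  have c: "?c > 0" using kap_pos by simp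
  have div: "ennreal (wt z / r) * x = ennreal (wt z) * x / ennreal r" if "r > 0" for z r x
    using that wt_pos[of z] by (simp add: divide_ennreal[symmetric] less_imp_le ennreal_times_divide mult.commute)
  have "(\<integral>\<^sup>+z. ennreal (wt z) \<partial>?\<nu>) = ennreal ?c"
    unfolding wt_def by (rule nn_gauss_param[OF p kap_pos])
  from Haar_unique_wt[OF trans_inv_M trans_inv_param[OF p] nn_wt_M this, of "\<lambda>z. ennreal (wt z) * indicator A z"]
  have eq: "(\<integral>\<^sup>+z. ennreal (wt z) * indicator A z \<partial>M) * ennreal ?c = (\<integral>\<^sup>+z. ennreal (wt z) * indicator A z \<partial>?\<nu>) * ennreal gauss_const"
    by measurable
  have "emeasure gauss A = (\<integral>\<^sup>+z. ennreal (wt z) * indicator A z / ennreal gauss_const \<partial>M)"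
    unfolding gauss_def by (subst emeasure_density) (auto simp: div[OF gauss_const_pos])
  also have "\<dots> = (\<integral>\<^sup>+z. ennreal (wt z) * indicator A z \<partial>M) / ennreal gauss_const"
    by (rule nn_integral_divide) measurable
  also have "\<dots> = (\<integral>\<^sup>+z. ennreal (wt z) * indicator A z \<partial>?\<nu>) / ennreal ?c"
  proof -
    have "(\<integral>\<^sup>+z. ennreal (wt z) * indicator A z \<partial>M) = (\<integral>\<^sup>+z. ennreal (wt z) * indicator A z \<partial>M) * ennreal ?c / ennreal ?c"
    proof (rule ennreal_mult_divide_eq[symmetric])
      show "ennreal ?c \<noteq> 0" using c by (metis ennreal_eq_0_iff not_le)
    qed (rule ennreal_neq_top)
    also have "\<dots> = (\<integral>\<^sup>+z. ennreal (wt z) * indicator A z \<partial>?\<nu>) / ennreal ?c * ennreal gauss_const"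
      unfolding eq by (simp only: ennreal_times_divide mult.commute[of _ "ennreal gauss_const"])
    finally show ?thesis using gauss_const_pos by (simp add: ennreal_mult_divide_eq)
  qed
  also have "\<dots> = (\<integral>\<^sup>+z. ennreal (wt z) * indicator A z / ennreal ?c \<partial>?\<nu>)"
    by (rule nn_integral_divide[symmetric]) measurable
  also have "\<dots> = emeasure ?D A"
    by (subst emeasure_density) (auto simp: div[OF c])
  finally show "emeasure gauss A = emeasure ?D A" .
qed simp

lemma gauss_integral_param:
  fixes f :: "'v \<Rightarrow> complex"
  assumes p: "param m L" and [measurable]: "f \<in> borel_measurable borel"
  shows "(\<integral>z. f z \<partial>gauss) = (\<integral>x. exp (- kap * (\<Sum>i<m. (cmod (x i))\<^sup>2)) *\<^sub>R f (L x) \<partial>CPi m) / of_real ((pi / kap) ^ m)"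
proof -
  note [measurable] = param_measurable[OF p]
  have "(\<integral>z. f z \<partial>gauss) = (\<integral>z. (wt z / (pi / kap) ^ m) *\<^sub>R f z \<partial>distr (CPi m) borel L)"
    unfolding gauss_param[OF p] using kap_pos wt_pos
    by (intro integral_density) (auto intro!: AE_I2 divide_nonneg_nonneg simp: less_imp_le)
  also have "\<dots> = (\<integral>x. (wt (L x) / (pi / kap) ^ m) *\<^sub>R f (L x) \<partial>CPi m)"
    by (rule integral_distr) measurable
  also have "\<dots> = (\<integral>x. (exp (- kap * (\<Sum>i<m. (cmod (x i))\<^sup>2)) *\<^sub>R f (L x)) / of_real ((pi / kap) ^ m) \<partial>CPi m)"
    using p by (intro Bochner_Integration.integral_cong) (auto simp: wt_def param_def scaleR_conv_of_real)
  finally show ?thesis by (simp only: integral_divide_zero)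
qed

text \<open>Composing an isometric parametrisation with T gives another one, and
  \<open>gauss\<close> looks the same in both.\<close>

lemma gauss_isometry:
  assumes T: "linear T" "surj T" "\<And>v. nm (T v) = nm v"
  shows "distr gauss borel T = gauss"
proof -
  have p: "param (length ubs) (cmb ubs)" by (rule param_cmb[OF orthonormal_basis_ubs])
  have cT: "continuous_on UNIV T" using continuous_on_linear[OF T(1) continuous_on_id] .
  hence [measurable]: "T \<in> borel_measurable borel" by (rule borel_measurable_continuous_onI)
  note [measurable] = param_measurable[OF p]
  have p': "param (length ubs) (T \<circ> cmb ubs)"
    unfolding param_def
  proof (intro conjI allI impI)
    show "continuous_on UNIV (T \<circ> cmb ubs)"
      by (intro continuous_on_compose continuous_cmb continuous_on_subset[OF cT]) auto
    show "surj (T \<circ> cmb ubs)" by (rule comp_surj) (use p T(2) in \<open>simp_all add: param_def\<close>)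
  next
    fix x y show "(T \<circ> cmb ubs) (\<lambda>i. x i + y i) = (T \<circ> cmb ubs) x + (T \<circ> cmb ubs) y"
      using p by (simp add: param_def linear_add[OF T(1)])
  next
    fix x y :: "nat \<Rightarrow> complex" assume "\<forall>i<length ubs. x i = y i"
    thus "(T \<circ> cmb ubs) x = (T \<circ> cmb ubs) y" using param_cong[OF p, of x y] by simp
  next
    fix x show "nm ((T \<circ> cmb ubs) x) = (\<Sum>i<length ubs. (cmod (x i))\<^sup>2)" using p T(3) by (simp add: param_def)
  qed
  have "distr gauss borel T = distr (density M (\<lambda>z. ennreal (wt (T z) / gauss_const))) borel T"
    by (simp add: gauss_def wt_def T(3))
  also have "\<dots> = density (distr M borel T) (\<lambda>z. ennreal (wt z / gauss_const))"
    by (rule density_distr[symmetric]) measurable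
  also have "distr M borel T = distr (CPi (length ubs)) borel (T \<circ> cmb ubs)"
    unfolding M_eq by (rule distr_distr) measurable
  also have "density \<dots> (\<lambda>z. ennreal (wt z / gauss_const)) = gauss"
    by (simp only: gauss_param[OF p'] gauss_const_def)
  finally show ?thesis .
qed

lemma gauss_integral_isometry:
  fixes f :: "'v \<Rightarrow> 'b::{banach, second_countable_topology}"
  assumes T: "linear T" "surj T" "\<And>v. nm (T v) = nm v" and [measurable]: "f \<in> borel_measurable borel"
  shows "(\<integral>z. f (T z) \<partial>gauss) = (\<integral>z. f z \<partial>gauss)" and "integrable gauss (\<lambda>z. f (T z)) \<longleftrightarrow> integrable gauss f"
proof -
  have [measurable]: "T \<in> borel_measurable borel"
    using continuous_on_linear[OF T(1) continuous_on_id] by (rule borel_measurable_continuous_onI)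
  have "(\<integral>z. f z \<partial>distr gauss borel T) = (\<integral>z. f (T z) \<partial>gauss)" by (rule integral_distr) measurable
  thus "(\<integral>z. f (T z) \<partial>gauss) = (\<integral>z. f z \<partial>gauss)" by (simp add: gauss_isometry[OF T])
  have "integrable (distr gauss borel T) f = integrable gauss (\<lambda>z. f (T z))" by (rule integrable_distr_eq) measurable
  thus "integrable gauss (\<lambda>z. f (T z)) \<longleftrightarrow> integrable gauss f" by (simp add: gauss_isometry[OF T])
qed

lemma gauss_integrable_M:
  fixes f :: "'v \<Rightarrow> 'b::{banach, second_countable_topology}"
  assumes [measurable]: "f \<in> borel_measurable borel"
  shows "integrable gauss f \<longleftrightarrow> integrable M (\<lambda>z. wt z *\<^sub>R f z)"
    and "(\<integral>z. f z \<partial>gauss) = (1 / gauss_const) *\<^sub>R (\<integral>z. wt z *\<^sub>R f z \<partial>M)"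
proof -
  have n: "AE z in M. 0 \<le> wt z / gauss_const" using gauss_const_pos wt_pos by (auto intro!: AE_I2 simp: less_imp_le)
  have eq: "(wt z / gauss_const) *\<^sub>R f z = (1 / gauss_const) *\<^sub>R (wt z *\<^sub>R f z)" for z by simp
  have "integrable gauss f \<longleftrightarrow> integrable M (\<lambda>z. (1 / gauss_const) *\<^sub>R (wt z *\<^sub>R f z))"
    unfolding gauss_def eq[symmetric] by (rule integrable_density) (use n in auto)
  thus "integrable gauss f \<longleftrightarrow> integrable M (\<lambda>z. wt z *\<^sub>R f z)" 
    using integrable_scaleR_right[of "1 / gauss_const" M "\<lambda>z. wt z *\<^sub>R f z"]
      integrable_scaleR_right[of gauss_const M "\<lambda>z. (1 / gauss_const) *\<^sub>R (wt z *\<^sub>R f z)"] gauss_const_pos by auto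
  have "(\<integral>z. f z \<partial>gauss) = (\<integral>z. (1 / gauss_const) *\<^sub>R (wt z *\<^sub>R f z) \<partial>M)"
    unfolding gauss_def eq[symmetric] by (rule integral_density) (use n in auto)
  thus "(\<integral>z. f z \<partial>gauss) = (1 / gauss_const) *\<^sub>R (\<integral>z. wt z *\<^sub>R f z \<partial>M)" by (simp only: integral_scaleR_right)
qed

lemma wt_shift: "wt (z + a) = exp (- kap * (2 * Re (H z a) + nm a)) * wt z"
  unfolding wt_def nm_add mult_exp_exp by (rule arg_cong[where f = exp]) (simp add: algebra_simps)

text \<open>The exponential factor is wt(z + a)/wt(z). It is the squared modulus of the multiplier
  in a Weyl operator, which is why those operators are isometric.\<close>

lemma gauss_translation:
  fixes f :: "'v \<Rightarrow> 'b::{banach, second_countable_topology}"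
  assumes [measurable]: "f \<in> borel_measurable borel"
  shows "(\<integral>z. exp (- kap * (2 * Re (H z a) + nm a)) *\<^sub>R f (z + a) \<partial>gauss) = (\<integral>z. f z \<partial>gauss)"
    and "integrable gauss (\<lambda>z. exp (- kap * (2 * Re (H z a) + nm a)) *\<^sub>R f (z + a)) \<longleftrightarrow> integrable gauss f"
proof -
  have eq: "wt z *\<^sub>R exp (- kap * (2 * Re (H z a) + nm a)) *\<^sub>R f (z + a) = wt (z + a) *\<^sub>R f (z + a)" for z
    by (simp add: wt_shift)
  have d: "distr M borel (\<lambda>z. z + a) = M" using trans_inv_M by (simp add: trans_inv_def)
  have m: "(\<lambda>z. exp (- kap * (2 * Re (H z a) + nm a)) *\<^sub>R f (z + a)) \<in> borel_measurable borel" by measurable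
  have "(\<integral>z. wt z *\<^sub>R f z \<partial>distr M borel (\<lambda>z. z + a)) = (\<integral>z. wt (z + a) *\<^sub>R f (z + a) \<partial>M)"
    by (rule integral_distr) measurable
  thus "(\<integral>z. exp (- kap * (2 * Re (H z a) + nm a)) *\<^sub>R f (z + a) \<partial>gauss) = (\<integral>z. f z \<partial>gauss)"
    by (simp only: gauss_integrable_M(2)[OF m] gauss_integrable_M(2)[OF assms] eq d)
  have "integrable (distr M borel (\<lambda>z. z + a)) (\<lambda>z. wt z *\<^sub>R f z) \<longleftrightarrow> integrable M (\<lambda>z. wt (z + a) *\<^sub>R f (z + a))"
    by (rule integrable_distr_eq) measurable
  thus "integrable gauss (\<lambda>z. exp (- kap * (2 * Re (H z a) + nm a)) *\<^sub>R f (z + a)) \<longleftrightarrow> integrable gauss f"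
    by (simp only: gauss_integrable_M(1)[OF m] gauss_integrable_M(1)[OF assms] eq d)
qed

lemma integrable_exp_gauss:
  assumes "s < kap" shows "integrable gauss (\<lambda>z. exp (s * nm z))"
proof -
  have "integrable M (\<lambda>z. exp (- (kap - s) * nm z))"
    using nn_exp_M[of "kap - s"] assms by (intro integrableI_bounded) (auto simp: ennreal_less_top)
  thus ?thesis by (subst gauss_integrable_M(1)) (auto simp: wt_def exp_add[symmetric] algebra_simps)
qed

text \<open>The image of M under the dilation is again translation invariant, so it is a multiple of
  M, and the weight only grows when z shrinks. The factor tends to 1 as r does, which the limit
  argument for dilated functions relies on.\<close>

lemma nn_gauss_scaling:
  assumes [measurable]: "f \<in> borel_measurable borel" and r: "0 < r" "r \<le> 1"
  shows "(\<integral>\<^sup>+z. f (r *\<^sub>R z) \<partial>gauss) \<le> ennreal ((1 / r\<^sup>2) ^ length ubs) * (\<integral>\<^sup>+z. f z \<partial>gauss)"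
proof -
  have ti: "trans_inv (distr M borel (\<lambda>z. r *\<^sub>R z))"
    unfolding trans_inv_def
  proof (intro conjI allI)
    fix a
    have "distr (distr M borel (\<lambda>z. r *\<^sub>R z)) borel (\<lambda>z. z + a) = distr M borel (\<lambda>z. r *\<^sub>R z + a)"
      by (subst distr_distr) (auto simp: comp_def)
    also have "(\<lambda>z. r *\<^sub>R z + a) = (\<lambda>z. r *\<^sub>R z) \<circ> (\<lambda>z. z + (1 / r) *\<^sub>R a)"
      using r by (auto simp: fun_eq_iff scaleR_add_right)
    also have "distr M borel \<dots> = distr (distr M borel (\<lambda>z. z + (1 / r) *\<^sub>R a)) borel (\<lambda>z. r *\<^sub>R z)"
      by (rule distr_distr[symmetric]) measurable
    finally show "distr (distr M borel (\<lambda>z. r *\<^sub>R z)) borel (\<lambda>z. z + a) = distr M borel (\<lambda>z. r *\<^sub>R z)"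
      using trans_inv_M by (simp add: trans_inv_def)
  qed simp
  have W: "(\<integral>\<^sup>+z. ennreal (wt z) \<partial>distr M borel (\<lambda>z. r *\<^sub>R z)) = ennreal ((1 / r\<^sup>2) ^ length ubs * gauss_const)"
  proof -
    have "(\<integral>\<^sup>+z. ennreal (wt z) \<partial>distr M borel (\<lambda>z. r *\<^sub>R z)) = (\<integral>\<^sup>+z. ennreal (exp (- (kap * r\<^sup>2) * nm z)) \<partial>M)"
      by (subst nn_integral_distr) (auto simp: wt_def nm_scaleR mult_ac)
    also have "\<dots> = ennreal ((pi / (kap * r\<^sup>2)) ^ length ubs)"
      using kap_pos r by (intro nn_exp_M) auto
    also have "(pi / (kap * r\<^sup>2)) ^ length ubs = (1 / r\<^sup>2) ^ length ubs * gauss_const"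
      by (simp add: gauss_const_def power_divide power_mult_distrib)
    finally show ?thesis .
  qed
  let ?c = "(1 / r\<^sup>2) ^ length ubs"
  have c: "?c \<ge> 0" by simp
  have le: "(\<integral>\<^sup>+z. ennreal (wt z / gauss_const) * f (r *\<^sub>R z) \<partial>M) \<le> (\<integral>\<^sup>+z. ennreal (wt (r *\<^sub>R z) / gauss_const) * f (r *\<^sub>R z) \<partial>M)"
  proof (intro nn_integral_mono mult_right_mono ennreal_leI divide_right_mono)
    fix z
    have "r\<^sup>2 * nm z \<le> 1 * nm z" using r by (intro mult_right_mono) (auto simp: power_le_one)
    thus "wt z \<le> wt (r *\<^sub>R z)" using kap_pos by (simp add: wt_def nm_scaleR)
  qed (use gauss_const_pos in auto)
  have "(\<integral>\<^sup>+z. f (r *\<^sub>R z) \<partial>gauss) = (\<integral>\<^sup>+z. ennreal (wt z / gauss_const) * f (r *\<^sub>R z) \<partial>M)"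
    by (rule nn_gauss) measurable
  also note le
  also have "(\<integral>\<^sup>+z. ennreal (wt (r *\<^sub>R z) / gauss_const) * f (r *\<^sub>R z) \<partial>M) = (\<integral>\<^sup>+z. ennreal (wt z / gauss_const) * f z \<partial>distr M borel (\<lambda>z. r *\<^sub>R z))" (is "_ = ?I")
    by (subst nn_integral_distr) auto
  also have "?I = ennreal ?c * (\<integral>\<^sup>+z. f z \<partial>gauss)"
  proof -
    have "?I * ennreal gauss_const = (\<integral>\<^sup>+z. f z \<partial>gauss) * ennreal (?c * gauss_const)"
      using Haar_unique_wt[OF ti trans_inv_M W nn_wt_M, of "\<lambda>z. ennreal (wt z / gauss_const) * f z"]
      by (simp add: nn_gauss)
    also have "\<dots> = (ennreal ?c * (\<integral>\<^sup>+z. f z \<partial>gauss)) * ennreal gauss_const"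
      using gauss_const_pos by (simp add: ennreal_mult mult_ac)
    finally have "?I * ennreal gauss_const / ennreal gauss_const = (ennreal ?c * (\<integral>\<^sup>+z. f z \<partial>gauss)) * ennreal gauss_const / ennreal gauss_const" by simp
    thus ?thesis using gauss_const_pos by (simp add: ennreal_mult_divide_eq)
  qed
  finally show ?thesis .
qed


subsection \<open>Holomorphic functions on \<open>V\<close>\<close>

abbreviation "hol \<equiv> j_holomorphic j"

lemma holI:
  assumes "\<And>z. (f has_derivative D z) (at z)" "\<And>z v. D z (j v) = \<i> * D z v"
  shows "hol f"
  using assms unfolding j_holomorphic_def by blast

lemma holE:
  assumes "hol f"
  obtains D where "\<And>z. (f has_derivative D z) (at z)" "\<And>z v. D z (j v) = \<i> * D z v"
  using assms unfolding j_holomorphic_def by metis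

lemma hol_continuous: assumes "hol f" shows "continuous_on UNIV f"
proof -
  obtain D where "\<And>z. (f has_derivative D z) (at z)" using holE[OF assms] by metis
  thus ?thesis by (auto intro!: continuous_at_imp_continuous_on has_derivative_continuous)
qed

lemma hol_measurable: "hol f \<Longrightarrow> f \<in> borel_measurable borel"
  by (intro borel_measurable_continuous_onI hol_continuous)

lemma hol_const: "hol (\<lambda>z. c)"
  by (rule holI[where D = "\<lambda>z v. 0"]) auto

lemma hol_add: assumes "hol f" "hol g" shows "hol (\<lambda>z. f z + g z)"
proof -
  from assms(1) obtain D where D: "\<And>z. (f has_derivative D z) (at z)" "\<And>z v. D z (j v) = \<i> * D z v" by (rule holE) blast
  from assms(2) obtain E where E: "\<And>z. (g has_derivative E z) (at z)" "\<And>z v. E z (j v) = \<i> * E z v" by (rule holE) blast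
  show ?thesis
    by (rule holI[OF has_derivative_add[OF D(1) E(1)]]) (simp add: D(2) E(2) algebra_simps)
qed

lemma hol_mult: assumes "hol f" "hol g" shows "hol (\<lambda>z. f z * g z)"
proof -
  from assms(1) obtain D where D: "\<And>z. (f has_derivative D z) (at z)" "\<And>z v. D z (j v) = \<i> * D z v" by (rule holE) blast
  from assms(2) obtain E where E: "\<And>z. (g has_derivative E z) (at z)" "\<And>z v. E z (j v) = \<i> * E z v" by (rule holE) blast
  show ?thesis
    by (rule holI[OF has_derivative_mult[OF D(1) E(1)]]) (simp add: D(2) E(2) algebra_simps)
qed

lemma hol_exp: assumes "hol f" shows "hol (\<lambda>z. exp (f z))"
proof -
  from assms(1) obtain D where D: "\<And>z. (f has_derivative D z) (at z)" "\<And>z v. D z (j v) = \<i> * D z v" by (rule holE) blast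
  have e: "(exp has_derivative (*) (exp w)) (at w)" for w :: complex
    using DERIV_exp unfolding has_field_derivative_def by blast
  show ?thesis
    by (rule holI[OF has_derivative_compose[OF D(1) e]]) (simp add: D(2))
qed

lemma hol_linear:
  assumes "linear f" "\<And>v. f (j v) = \<i> * f v" shows "hol f"
  by (rule holI[where D = "\<lambda>z. f"]) (use assms in \<open>auto intro!: bounded_linear_imp_has_derivative linear_bounded_linear\<close>)

lemma hol_comp_linear:
  assumes "hol f" and T: "linear T" "\<And>v. T (j v) = j (T v)"
  shows "hol (\<lambda>z. f (T z + a))"
proof -
  from assms(1) obtain D where D: "\<And>z. (f has_derivative D z) (at z)" "\<And>z v. D z (j v) = \<i> * D z v" by (rule holE) blast
  have "((\<lambda>z. T z + a) has_derivative (\<lambda>v. T v + 0)) (at z)" for z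
    by (intro has_derivative_add bounded_linear_imp_has_derivative linear_bounded_linear T(1) has_derivative_const)
  hence t: "((\<lambda>z. T z + a) has_derivative T) (at z)" for z by simp
  show ?thesis
    by (rule holI[OF has_derivative_compose[OF t D(1)]]) (simp add: D(2) T(2))
qed

lemma hol_shift: "hol f \<Longrightarrow> hol (\<lambda>z. f (z - a))"
  using hol_comp_linear[of f "\<lambda>z. z" "- a"] linear_ident by simp

lemma hol_H: "hol (\<lambda>z. H z v)"
  by (rule hol_linear) (auto intro!: linearI simp: H_simps scaleR_conv_of_real)

text \<open>H is conjugate linear in its second argument, so inserting an antilinear map there gives
  a complex bilinear form.\<close>

lemma hol_quadratic:
  assumes A: "linear A" "\<And>v. A (j v) = - j (A v)"
  shows "hol (\<lambda>z. H z (A z))"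
proof (rule holI)
  show "((\<lambda>z. H z (A z)) has_derivative (\<lambda>v. H z (A v) + H v (A z))) (at z)" for z
    by (rule bounded_bilinear.FDERIV[OF bounded_bilinear_H has_derivative_ident])
       (intro bounded_linear_imp_has_derivative linear_bounded_linear A(1))
qed (simp add: A(2) H_simps algebra_simps)

lemma hol_line:
  assumes "hol f" shows "(\<lambda>c. f (sc c z)) holomorphic_on UNIV"
proof -
  from assms obtain D where D: "\<And>z. (f has_derivative D z) (at z)" "\<And>z v. D z (j v) = \<i> * D z v" by (rule holE) blast
  have "((\<lambda>c. f (sc c z)) has_field_derivative D (sc c z) z) (at c)" for c
  proof -
    have "linear (\<lambda>c. sc c z)" by (rule linearI) (auto simp: jscale_def algebra_simps)
    hence "((\<lambda>c. sc c z) has_derivative (\<lambda>c. sc c z)) (at c)"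
      by (intro bounded_linear_imp_has_derivative) (simp add: linear_conv_bounded_linear)
    from has_derivative_compose[OF this D(1)]
    have "((\<lambda>c. f (sc c z)) has_derivative (\<lambda>d. D (sc c z) (sc d z))) (at c)" .
    moreover have "D (sc c z) (sc d z) = D (sc c z) z * d" for d
    proof -
      have l: "linear (D (sc c z))" by (rule has_derivative_linear[OF D(1)])
      have "D (sc c z) (sc d z) = D (sc c z) z * (of_real (Re d) + \<i> * of_real (Im d))"
        unfolding jscale_def[of j d] linear_add[OF l] linear_scale[OF l] D(2)
        by (simp add: scaleR_conv_of_real algebra_simps)
      thus ?thesis by (simp only: complex_eq[symmetric])
    qed
    ultimately show ?thesis by (simp add: has_field_derivative_def)
  qed
  thus ?thesis by (auto simp: holomorphic_on_open)
qed

text \<open>Cauchy's integral formula at the centre, written as a Lebesgue integral so that it can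
  be combined with Fubini.\<close>

lemma mean_value_circle:
  assumes "F holomorphic_on UNIV"
  shows "(\<integral>t. indicator {0..1} t *\<^sub>R F (exp (2 * of_real pi * \<i> * of_real t)) \<partial>lborel) = F 0"
proof -
  have "((\<lambda>u. F u / (u - 0)) has_contour_integral (2 * of_real pi * \<i> * F 0)) (circlepath 0 1)"
    by (rule Cauchy_integral_circlepath_simple) (use assms in \<open>auto intro: holomorphic_on_subset\<close>)
  hence "((\<lambda>t. F (exp (2 * of_real pi * \<i> * of_real t)) / exp (2 * of_real pi * \<i> * of_real t) *
     (2 * of_real pi * \<i> * exp (2 * of_real pi * \<i> * of_real t))) has_integral (2 * of_real pi * \<i> * F 0)) {0..1}"
    unfolding has_contour_integral_def
    by (rule has_integral_eq[rotated]) (auto simp: circlepath vector_derivative_circlepath01[unfolded circlepath, of _ 0 1, simplified])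
  from has_integral_mult_right[OF this, of "1 / (2 * of_real pi * \<i>)"]
  have "((\<lambda>t. 1 / (2 * of_real pi * \<i>) * (F (exp (2 * of_real pi * \<i> * of_real t)) / exp (2 * of_real pi * \<i> * of_real t) *
     (2 * of_real pi * \<i> * exp (2 * of_real pi * \<i> * of_real t)))) has_integral
     (1 / (2 * of_real pi * \<i>) * (2 * of_real pi * \<i> * F 0))) {0..1}" .
  moreover have "1 / (2 * of_real pi * \<i>) * (F (exp (2 * of_real pi * \<i> * of_real t)) / exp (2 * of_real pi * \<i> * of_real t) *
     (2 * of_real pi * \<i> * exp (2 * of_real pi * \<i> * of_real t))) = F (exp (2 * of_real pi * \<i> * of_real t))" for t :: real
    by (simp add: field_simps)
  moreover have "1 / (2 * of_real pi * \<i>) * (2 * of_real pi * \<i> * F 0) = F 0" by simp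
  ultimately have 1: "((\<lambda>t. F (exp (2 * of_real pi * \<i> * of_real t))) has_integral F 0) {0..1}" by (simp only:)
  have "continuous_on UNIV F" using assms by (rule holomorphic_on_imp_continuous_on)
  hence c: "continuous_on {0..1::real} (\<lambda>t. F (exp (2 * of_real pi * \<i> * of_real t)))"
    by (rule continuous_on_compose2) (auto intro!: continuous_intros)
  have "set_integrable lborel {0..1} (\<lambda>t. F (exp (2 * of_real pi * \<i> * of_real t)))"
    by (rule borel_integrable_atLeastAtMost'[OF c])
  from set_borel_integral_eq_integral(2)[OF this] show ?thesis
    using 1 by (simp add: set_lebesgue_integral_def integral_unique)
qed

lemma linear_sc: "linear (\<lambda>z. sc c z)"
  by (rule linearI) (auto simp: jscale_def algebra_simps)

lemma surj_sc: "c \<noteq> 0 \<Longrightarrow> surj (\<lambda>z. sc c z)"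
  by (rule surjI[where f = "\<lambda>z. sc (inverse c) z"]) (simp add: sc_sc)

lemma continuous_on_sc2: "continuous_on A f \<Longrightarrow> continuous_on A g \<Longrightarrow> continuous_on A (\<lambda>x. sc (f x) (g x))"
  unfolding jscale_def by (intro continuous_intros continuous_on_linear[OF linear_j])

text \<open>
  The measure is invariant under the rotations \<open>z \<mapsto> e\<^sup>i\<^sup>\<theta>z\<close>, and the mean of \<open>f\<close> over each circle
  \<open>e\<^sup>i\<^sup>\<theta>z\<close> is \<open>f(0)\<close>.
\<close>

lemma hol_mean:
  assumes f: "hol f" and I: "integrable gauss f"
  shows "(\<integral>z. f z \<partial>gauss) = f 0"
proof -
  interpret P: pair_sigma_finite lborel gauss ..
  define e where "e = (\<lambda>t::real. exp (2 * of_real pi * \<i> * of_real t) :: complex)"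
  have ne: "cmod (e t) = 1" for t by (simp add: e_def norm_exp_eq_Re)
  note [measurable] = hol_measurable[OF f]
  have rot: "(\<integral>z. f (sc (e t) z) \<partial>gauss) = (\<integral>z. f z \<partial>gauss)" "integrable gauss (\<lambda>z. f (sc (e t) z))"
    "(\<integral>z. norm (f (sc (e t) z)) \<partial>gauss) = (\<integral>z. norm (f z) \<partial>gauss)" for t
    using I gauss_integral_isometry[where T = "\<lambda>z. sc (e t) z" and f = f, OF linear_sc surj_sc]
      gauss_integral_isometry[where T = "\<lambda>z. sc (e t) z" and f = "\<lambda>z. norm (f z)", OF linear_sc surj_sc] ne[of t]
    by (auto simp: nm_sc e_def)
  have "continuous_on UNIV (\<lambda>p. f (sc (e (fst p)) (snd p)))"
    unfolding e_def
    by (intro continuous_on_compose2[OF hol_continuous[OF f]] continuous_on_sc2 continuous_intros) auto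
  from measurable_continuous_pair'[OF this]
  have [measurable]: "(\<lambda>p. f (sc (e (fst p)) (snd p))) \<in> borel_measurable (borel \<Otimes>\<^sub>M borel)" .
  \<comment> \<open>Rotation invariance makes the inner absolute integral the same for every t, so
    it is integrable over [0, 1].\<close>
  have "integrable (lborel \<Otimes>\<^sub>M gauss) (\<lambda>p. indicator {0..1} (fst p) *\<^sub>R f (sc (e (fst p)) (snd p)))"
  proof (rule P.Fubini_integrable)
    show "integrable lborel (\<lambda>x. \<integral>y. norm (indicator {0..1} (fst (x, y)) *\<^sub>R f (sc (e (fst (x, y))) (snd (x, y)))) \<partial>gauss)"
      by (simp add: rot(3))
    show "AE x in lborel. integrable gauss (\<lambda>y. indicator {0..1} (fst (x, y)) *\<^sub>R f (sc (e (fst (x, y))) (snd (x, y))))"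
      using rot(2) by simp
  qed measurable
  hence "(\<integral>z. (\<integral>t. indicator {0..1} t *\<^sub>R f (sc (e t) z) \<partial>lborel) \<partial>gauss) =
     (\<integral>t. (\<integral>z. indicator {0..1} t *\<^sub>R f (sc (e t) z) \<partial>gauss) \<partial>lborel)"
    by (intro P.Fubini_integral) (simp add: split_def)
  also have "\<dots> = (\<integral>t. indicator {0..1::real} t *\<^sub>R (\<integral>z. f z \<partial>gauss) \<partial>lborel)" using rot(1) by simp
  also have "\<dots> = (\<integral>z. f z \<partial>gauss)" by simp
  finally have "(\<integral>z. (\<integral>t. indicator {0..1} t *\<^sub>R f (sc (e t) z) \<partial>lborel) \<partial>gauss) = (\<integral>z. f z \<partial>gauss)" .
  moreover have "(\<integral>t. indicator {0..1} t *\<^sub>R f (sc (e t) z) \<partial>lborel) = f 0" for z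
    using mean_value_circle[OF hol_line[OF f, of z]] by (simp add: e_def)
  ultimately show ?thesis by (simp add: measure_def emeasure_gauss_UNIV)
qed

subsection \<open>The Fock space\<close>

abbreviation "Fk \<equiv> Fock h \<Omega> j"

definition ip :: "('v \<Rightarrow> complex) \<Rightarrow> ('v \<Rightarrow> complex) \<Rightarrow> complex" where
  "ip f g = (\<integral>z. f z * cnj (g z) \<partial>gauss)"

lemma Fock_iff: "f \<in> Fk \<longleftrightarrow> hol f \<and> integrable gauss (\<lambda>z. (cmod (f z))\<^sup>2)"
proof -
  have "integrable gauss (\<lambda>z. (cmod (f z))\<^sup>2) \<longleftrightarrow> integrable M (\<lambda>z. (cmod (f z))\<^sup>2 * wt z)" if "hol f"
  proof -
    have [measurable]: "f \<in> borel_measurable borel" by (rule hol_measurable[OF that])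
    show ?thesis by (subst gauss_integrable_M(1)) (auto simp: mult.commute)
  qed
  thus ?thesis by (auto simp: Fock_def gauss_weight_wt)
qed

lemma Fk_hol: "f \<in> Fk \<Longrightarrow> hol f" by (simp add: Fock_iff)

lemma Fk_measurable: "f \<in> Fk \<Longrightarrow> f \<in> borel_measurable borel" by (simp add: Fock_iff hol_measurable)

lemma Fk_sq: "f \<in> Fk \<Longrightarrow> integrable gauss (\<lambda>z. (cmod (f z))\<^sup>2)" by (simp add: Fock_iff)

lemma borel_cnj [measurable]: "cnj \<in> borel_measurable borel"
  by (intro borel_measurable_continuous_onI continuous_intros)

lemma FkI_bound:
  assumes "hol f" "integrable gauss g" "\<And>z. (cmod (f z))\<^sup>2 \<le> g z"
  shows "f \<in> Fk"
  unfolding Fock_iff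
proof
  have [measurable]: "f \<in> borel_measurable borel" by (rule hol_measurable[OF assms(1)])
  show "integrable gauss (\<lambda>z. (cmod (f z))\<^sup>2)"
    by (rule Bochner_Integration.integrable_bound[OF assms(2)]) (use assms(3) in \<open>auto intro!: AE_I2 order_trans[OF assms(3)]\<close>)
qed fact

lemma mult_le_half_sum_squares: "x * y \<le> (x\<^sup>2 + y\<^sup>2) / 2" for x y :: real
  using sum_squares_bound[of x y] by (simp add: mult.assoc)

lemma integrable_mult_L2:
  fixes f g :: "'v \<Rightarrow> complex"
  assumes [measurable]: "f \<in> borel_measurable borel" "g \<in> borel_measurable borel"
    and "integrable gauss (\<lambda>z. (cmod (f z))\<^sup>2)" "integrable gauss (\<lambda>z. (cmod (g z))\<^sup>2)"
  shows "integrable gauss (\<lambda>z. f z * cnj (g z))" and "integrable gauss (\<lambda>z. cmod (f z) * cmod (g z))"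
proof -
  have I: "integrable gauss (\<lambda>z. ((cmod (f z))\<^sup>2 + (cmod (g z))\<^sup>2) / 2)" using assms by auto
  show "integrable gauss (\<lambda>z. f z * cnj (g z))" "integrable gauss (\<lambda>z. cmod (f z) * cmod (g z))"
    by (rule Bochner_Integration.integrable_bound[OF I]; use mult_le_half_sum_squares in \<open>auto simp: norm_mult intro!: AE_I2\<close>)+
qed

lemma Fk_mult: "f \<in> Fk \<Longrightarrow> g \<in> Fk \<Longrightarrow> integrable gauss (\<lambda>z. f z * cnj (g z))"
  by (intro integrable_mult_L2 Fk_measurable Fk_sq)

lemma Fk_add: assumes "f \<in> Fk" "g \<in> Fk" shows "(\<lambda>z. f z + g z) \<in> Fk"
proof (rule FkI_bound)
  show "integrable gauss (\<lambda>z. 2 * (cmod (f z))\<^sup>2 + 2 * (cmod (g z))\<^sup>2)" using assms Fk_sq by auto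
  show "(cmod (f z + g z))\<^sup>2 \<le> 2 * (cmod (f z))\<^sup>2 + 2 * (cmod (g z))\<^sup>2" for z
  proof -
    have "(cmod (f z + g z))\<^sup>2 \<le> (cmod (f z) + cmod (g z))\<^sup>2" by (intro power_mono norm_triangle_ineq) auto
    also have "\<dots> \<le> 2 * (cmod (f z))\<^sup>2 + 2 * (cmod (g z))\<^sup>2"
      using sum_squares_bound[of "cmod (f z)" "cmod (g z)"] by (simp add: power2_sum)
    finally show ?thesis .
  qed
qed (use assms in \<open>auto intro: hol_add Fk_hol\<close>)

lemma Fk_cmult: assumes "f \<in> Fk" shows "(\<lambda>z. c * f z) \<in> Fk"
  using assms hol_mult[OF hol_const] by (auto simp: Fock_iff norm_mult power_mult_distrib)

lemma Fk_const: "(\<lambda>z. c) \<in> Fk"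
  by (auto simp: Fock_iff hol_const)

lemma ip_add_left: "f \<in> Fk \<Longrightarrow> g \<in> Fk \<Longrightarrow> k \<in> Fk \<Longrightarrow> ip (\<lambda>z. f z + g z) k = ip f k + ip g k"
  unfolding ip_def by (subst Bochner_Integration.integral_add[symmetric]) (auto intro: Fk_mult simp: algebra_simps)

lemma ip_cmult_left: "ip (\<lambda>z. c * f z) k = c * ip f k"
  unfolding ip_def by (simp add: mult.assoc)

lemma ip_cmult_right: "ip f (\<lambda>z. c * k z) = cnj c * ip f k"
  unfolding ip_def integral_mult_right_zero[symmetric] by (simp add: mult_ac)

lemma ip_cnj: "cnj (ip f g) = ip g f"
  unfolding ip_def by (subst Bochner_Integration.integral_cnj[symmetric]) (simp add: mult.commute)

lemma ip_self: "ip f f = of_real (\<integral>z. (cmod (f z))\<^sup>2 \<partial>gauss)"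
  unfolding ip_def complex_norm_square[symmetric] by (rule integral_complex_of_real)

text \<open>The two inner products differ by a positive constant, so the same operators are unitary
  for both; this avoids comparing the real dimension of V with the length of a unitary
  basis.\<close>

lemma Fock_inner_ip:
  assumes "f \<in> Fk" "g \<in> Fk"
  shows "Fock_inner h \<Omega> j f g = of_real (gauss_const / h ^ (dim (UNIV :: 'v set) div 2)) * ip f g"
proof -
  have [measurable]: "f \<in> borel_measurable borel" "g \<in> borel_measurable borel" using assms Fk_measurable by auto
  have "ip f g = (1 / gauss_const) *\<^sub>R (\<integral>z. wt z *\<^sub>R (f z * cnj (g z)) \<partial>M)"
    unfolding ip_def by (rule gauss_integrable_M(2)) measurable
  also have "(\<integral>z. wt z *\<^sub>R (f z * cnj (g z)) \<partial>M) = (\<integral>z. f z * cnj (g z) * of_real (wt z) \<partial>M)"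
    by (simp add: scaleR_conv_of_real mult_ac)
  finally show ?thesis
    using gauss_const_pos by (simp add: Fock_inner_def gauss_weight_wt scaleR_conv_of_real)
qed

lemma Fock_inner_eq_iff:
  assumes "f \<in> Fk" "g \<in> Fk" "f' \<in> Fk" "g' \<in> Fk"
  shows "Fock_inner h \<Omega> j f g = Fock_inner h \<Omega> j f' g' \<longleftrightarrow> ip f g = ip f' g'"
  using assms gauss_const_pos h_pos by (simp add: Fock_inner_ip)

subsection \<open>Weyl operators and coherent states\<close>

text \<open>The operator of the Heisenberg group element (v, 0); the central parameter t contributes
  a scalar phase only.\<close>

definition W :: "'v \<Rightarrow> ('v \<Rightarrow> complex) \<Rightarrow> 'v \<Rightarrow> complex" where
  "W v f z = exp (of_real kap * H z v - of_real (kap / 2 * nm v)) * f (z - v)"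

lemma hbar_kap: "complex_of_real (2 * hbar h) = 1 / of_real kap" "complex_of_real (4 * hbar h) = 2 / of_real kap"
  using h_pos by (simp_all add: hbar_def kap_def field_simps)

lemma heisenberg_op_W:
  "heisenberg_op h \<Omega> j v t f =
    (if f \<in> Fk then (\<lambda>z. exp (- \<i> * of_real t / of_real (hbar h)) * W v f z) else undefined)"
proof -
  have "exp (- \<i> * of_real t / of_real (hbar h) + H z v / of_real (2 * hbar h) - H v v / of_real (4 * hbar h)) =
    exp (- \<i> * of_real t / of_real (hbar h)) * exp (of_real kap * H z v - of_real (kap / 2 * nm v))" for z
    unfolding mult_exp_exp hbar_kap H_self by (rule arg_cong[where f = exp]) (simp add: field_simps)
  thus ?thesis unfolding heisenberg_op_def W_def by (auto simp: fun_eq_iff)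
qed

lemma W_W_neg: "W v (W (- v) f) = f"
proof
  fix z
  have "exp (of_real kap * H z v - of_real (kap / 2 * nm v)) * exp (of_real kap * H (z - v) (- v) - of_real (kap / 2 * nm (- v))) = 1"
    unfolding mult_exp_exp by (simp add: H_simps H_self algebra_simps)
  thus "W v (W (- v) f) z = f z" by (simp add: W_def mult.assoc[symmetric])
qed

text \<open>The multiplier of \<open>W v\<close> has as squared modulus exactly the density of the
  translated Gaussian measure, so unitarity reduces to \<open>gauss_translation\<close>.\<close>

lemma W_density:
  "W v f z * cnj (W v g z) = exp (- kap * (2 * Re (H z (- v)) + nm (- v))) *\<^sub>R (f (z + - v) * cnj (g (z + - v)))"
proof -
  let ?a = "of_real kap * H z v - of_real (kap / 2 * nm v)"
  have "exp ?a * cnj (exp ?a) = of_real ((cmod (exp ?a))\<^sup>2)" by (simp only: complex_norm_square)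
  also have "(cmod (exp ?a))\<^sup>2 = exp (- kap * (2 * Re (H z (- v)) + nm (- v)))"
  proof -
    have "(cmod (exp ?a))\<^sup>2 = exp (2 * Re ?a)" by (simp only: norm_exp_eq_Re exp_double)
    also have "2 * Re ?a = - kap * (2 * Re (H z (- v)) + nm (- v))" by (simp add: H_simps algebra_simps)
    finally show ?thesis .
  qed
  finally have e: "exp ?a * cnj (exp ?a) = of_real (exp (- kap * (2 * Re (H z (- v)) + nm (- v))))" .
  have "W v f z * cnj (W v g z) = (exp ?a * cnj (exp ?a)) * (f (z + - v) * cnj (g (z + - v)))"
    by (simp add: W_def mult_ac)
  thus ?thesis by (simp only: e scaleR_conv_of_real)
qed

lemma hol_W: "hol f \<Longrightarrow> hol (W v f)"
  unfolding W_def[abs_def] diff_conv_add_uminus[of "of_real kap * _"]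
  by (rule hol_mult[OF hol_exp[OF hol_add[OF hol_mult[OF hol_const hol_H] hol_const]] hol_shift])

lemma W_Fk: assumes "f \<in> Fk" shows "W v f \<in> Fk"
  unfolding Fock_iff
proof
  note [measurable] = Fk_measurable[OF assms] hol_measurable[OF hol_W[OF Fk_hol[OF assms], of v]]
  have "integrable gauss (\<lambda>z. f z * cnj (f z))" by (intro Fk_mult assms)
  hence "integrable gauss (\<lambda>z. exp (- kap * (2 * Re (H z (- v)) + nm (- v))) *\<^sub>R (f (z + - v) * cnj (f (z + - v))))"
    by (subst gauss_translation(2)) auto
  hence "integrable gauss (\<lambda>z. norm (W v f z * cnj (W v f z)))" unfolding W_density[symmetric] by (rule integrable_norm)
  thus "integrable gauss (\<lambda>z. (cmod (W v f z))\<^sup>2)" by (simp add: norm_mult power2_eq_square)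
qed (use assms hol_W Fk_hol in auto)

lemma ip_W: assumes "f \<in> Fk" "g \<in> Fk" shows "ip (W v f) (W v g) = ip f g"
proof -
  note [measurable] = Fk_measurable[OF assms(1)] Fk_measurable[OF assms(2)]
  show ?thesis unfolding ip_def W_density by (rule gauss_translation(1)) measurable
qed

lemma ip_W_left: assumes "f \<in> Fk" "g \<in> Fk" shows "ip (W v f) g = ip f (W (- v) g)"
  using ip_W[OF assms(1) W_Fk[OF assms(2)], of v "- v"] by (simp add: W_W_neg)

abbreviation "ev \<equiv> coherent h \<Omega> j"

lemma coherent_eq: "ev v z = exp (of_real kap * H z v)"
  unfolding coherent_def hbar_kap by (simp add: mult.commute)

lemma coherent_W: "ev v = (\<lambda>z. of_real (exp (kap / 2 * nm v)) * W v (\<lambda>_. 1) z)"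
  by (simp add: fun_eq_iff coherent_eq W_def exp_of_real[symmetric] mult_exp_exp)

lemma coherent_Fk: "ev v \<in> Fk"
  unfolding coherent_W by (intro Fk_cmult W_Fk Fk_const)

lemma ip_one: "f \<in> Fk \<Longrightarrow> ip f (\<lambda>_. 1) = f 0"
  using Fk_mult[of f "\<lambda>_. 1"] by (auto simp: ip_def Fk_const Fk_hol intro!: hol_mean)

text \<open>A coherent state is a multiple of a Weyl translate of the constant 1. Moving the Weyl
  operator onto f reduces the claim to the mean value at the origin.\<close>

lemma reproducing: assumes "f \<in> Fk" shows "ip f (ev v) = f v"
proof -
  have "ip f (ev v) = of_real (exp (kap / 2 * nm v)) * ip f (W (- (- v)) (\<lambda>_. 1))"
    unfolding coherent_W ip_cmult_right by simp
  also have "ip f (W (- (- v)) (\<lambda>_. 1)) = ip (W (- v) f) (\<lambda>_. 1)"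
    by (rule ip_W_left[symmetric]) (use assms Fk_const in auto)
  also have "\<dots> = W (- v) f 0" by (intro ip_one W_Fk assms)
  also have "of_real (exp (kap / 2 * nm v)) * \<dots> = f v"
    by (simp add: W_def exp_of_real[symmetric] mult.assoc[symmetric] mult_exp_exp)
  finally show ?thesis .
qed

lemma ip_coherent: "ip (ev u) (ev v) = ev u v"
  by (rule reproducing[OF coherent_Fk])

text \<open>The reproducing formula with a weighted AM-GM inequality in the role of Cauchy-Schwarz;
  hence half of the squared norm plus 1 where the norm itself would be sharp. The weight s is the
  norm of \<open>ev v\<close>.\<close>

lemma Fk_pointwise_bound:
  assumes "f \<in> Fk" shows "cmod (f v) \<le> ((\<integral>z. (cmod (f z))\<^sup>2 \<partial>gauss) + 1) / 2 * exp (kap / 2 * nm v)"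
proof -
  define s where "s = exp (kap / 2 * nm v)"
  have s: "s > 0" by (simp add: s_def)
  have ev2: "(\<integral>z. (cmod (ev v z))\<^sup>2 \<partial>gauss) = s\<^sup>2"
  proof -
    have "complex_of_real (\<integral>z. (cmod (ev v z))\<^sup>2 \<partial>gauss) = exp (of_real (kap * nm v))"
      unfolding ip_self[symmetric] ip_coherent by (simp add: coherent_eq H_self)
    also have "\<dots> = of_real (s\<^sup>2)" unfolding s_def by (simp only: exp_of_real exp_double[symmetric]) simp
    finally show ?thesis by (simp only: of_real_eq_iff)
  qed
  have b: "cmod (f z * cnj (ev v z)) \<le> (s / 2) * (cmod (f z))\<^sup>2 + (1 / (2 * s)) * (cmod (ev v z))\<^sup>2" for z
  proof -
    have "cmod (f z) * cmod (ev v z) = s * (cmod (f z) * (cmod (ev v z) / s))" using s by simp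
    also have "\<dots> \<le> s * (((cmod (f z))\<^sup>2 + (cmod (ev v z) / s)\<^sup>2) / 2)"
      using s by (intro mult_left_mono mult_le_half_sum_squares) auto
    also have "\<dots> = (s / 2) * (cmod (f z))\<^sup>2 + (1 / (2 * s)) * (cmod (ev v z))\<^sup>2"
      using s by (simp add: field_simps power2_eq_square)
    finally show ?thesis by (simp add: norm_mult)
  qed
  have "cmod (f v) = norm (\<integral>z. f z * cnj (ev v z) \<partial>gauss)"
    using reproducing[OF assms, of v] by (simp add: ip_def)
  also have "\<dots> \<le> (\<integral>z. (s / 2) * (cmod (f z))\<^sup>2 + (1 / (2 * s)) * (cmod (ev v z))\<^sup>2 \<partial>gauss)"
    by (rule norm_integral_le[OF Fk_mult[OF assms coherent_Fk] _ b]) (use assms coherent_Fk Fk_sq in auto)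
  also have "\<dots> = (s / 2) * (\<integral>z. (cmod (f z))\<^sup>2 \<partial>gauss) + (1 / (2 * s)) * s\<^sup>2"
    using Fk_sq[OF assms] Fk_sq[OF coherent_Fk, of v] by (subst Bochner_Integration.integral_add) (auto simp: ev2)
  also have "\<dots> = ((\<integral>z. (cmod (f z))\<^sup>2 \<partial>gauss) + 1) / 2 * s" using s by (simp add: field_simps power2_eq_square)
  finally show ?thesis by (simp add: s_def)
qed

subsection \<open>Unitary operators are determined by coherent states\<close>

abbreviation "FU \<equiv> Fock_unitary h \<Omega> j"

lemma FU_D:
  assumes "U \<in> FU"
  shows "U \<in> extensional Fk" "bij_betw U Fk Fk" "\<And>f. f \<in> Fk \<Longrightarrow> U f \<in> Fk"
    "\<And>f g. f \<in> Fk \<Longrightarrow> g \<in> Fk \<Longrightarrow> U (\<lambda>z. f z + g z) = (\<lambda>z. U f z + U g z)"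
    "\<And>c f. f \<in> Fk \<Longrightarrow> U (\<lambda>z. c * f z) = (\<lambda>z. c * U f z)"
    "\<And>f g. f \<in> Fk \<Longrightarrow> g \<in> Fk \<Longrightarrow> ip (U f) (U g) = ip f g"
proof -
  show b: "bij_betw U Fk Fk" and "U \<in> extensional Fk" using assms by (simp_all add: Fock_unitary_def)
  show m: "U f \<in> Fk" if "f \<in> Fk" for f using b that by (auto simp: bij_betw_def)
  show "U (\<lambda>z. f z + g z) = (\<lambda>z. U f z + U g z)" if "f \<in> Fk" "g \<in> Fk" for f g
    using assms that by (simp add: Fock_unitary_def)
  show "U (\<lambda>z. c * f z) = (\<lambda>z. c * U f z)" if "f \<in> Fk" for c f
    using assms that by (simp add: Fock_unitary_def)
  show "ip (U f) (U g) = ip f g" if "f \<in> Fk" "g \<in> Fk" for f g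
    using assms that by (subst Fock_inner_eq_iff[symmetric]) (auto simp: m Fock_unitary_def)
qed

lemma FU_I:
  assumes "U \<in> extensional Fk" "bij_betw U Fk Fk"
    "\<And>f g. f \<in> Fk \<Longrightarrow> g \<in> Fk \<Longrightarrow> U (\<lambda>z. f z + g z) = (\<lambda>z. U f z + U g z)"
    "\<And>c f. f \<in> Fk \<Longrightarrow> U (\<lambda>z. c * f z) = (\<lambda>z. c * U f z)"
    "\<And>f g. f \<in> Fk \<Longrightarrow> g \<in> Fk \<Longrightarrow> ip (U f) (U g) = ip f g"
  shows "U \<in> FU"
proof -
  have m: "U f \<in> Fk" if "f \<in> Fk" for f using assms(2) that by (auto simp: bij_betw_def)
  show ?thesis unfolding Fock_unitary_def using assms by (auto simp: m Fock_inner_eq_iff)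
qed

text \<open>The difference d of two images is orthogonal to every U e_v. Surjectivity writes d = U
  k, which turns this into k(v) = 0 for all v.\<close>

lemma FU_unique:
  assumes U: "U \<in> FU" and U': "U' \<in> FU" and eq: "\<And>v. U (ev v) = U' (ev v)"
  shows "U = U'"
proof (rule extensionalityI[OF FU_D(1)[OF U] FU_D(1)[OF U']])
  fix f assume f: "f \<in> Fk"
  define d where "d = (\<lambda>z. U f z + (- 1) * U' f z)"
  have d: "d \<in> Fk" unfolding d_def by (intro Fk_add Fk_cmult FU_D(3)[OF U] FU_D(3)[OF U'] f)
  then obtain k where k: "k \<in> Fk" "U k = d" using FU_D(2)[OF U] by (metis bij_betw_imp_surj_on imageE)
  have "k v = 0" for v
  proof -
    have "k v = ip (U k) (U (ev v))" unfolding FU_D(6)[OF U k(1) coherent_Fk] by (rule reproducing[OF k(1), symmetric])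
    also have "\<dots> = ip (U f) (U (ev v)) + ip (\<lambda>z. (- 1) * U' f z) (U (ev v))"
      unfolding k(2) d_def by (intro ip_add_left Fk_cmult FU_D(3)[OF U] FU_D(3)[OF U'] f coherent_Fk)
    also have "ip (\<lambda>z. (- 1) * U' f z) (U (ev v)) = - ip (U' f) (U' (ev v))" by (simp only: ip_cmult_left eq) simp
    finally show ?thesis by (simp add: FU_D(6)[OF U f coherent_Fk] FU_D(6)[OF U' f coherent_Fk])
  qed
  \<comment> \<open>The zero function is written as a multiple of f, so that homogeneity of U
    applies.\<close>
  hence "k = (\<lambda>z. 0 * f z)" by (simp add: fun_eq_iff)
  hence "d = (\<lambda>z. 0)" using FU_D(5)[OF U f, of 0] k(2) by simp
  thus "U f = U' f" by (simp add: d_def fun_eq_iff)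
qed


subsection \<open>Linear and antilinear parts of symplectic maps\<close>

text \<open>The j-antilinear part of g, so that g = C_g + A_g and Z_g is the inverse of C_g followed
  on A_g.\<close>

definition A_part :: "('v \<Rightarrow> 'v) \<Rightarrow> 'v \<Rightarrow> 'v" where
  "A_part g v = (1/2) *\<^sub>R (g v + j (g (j v)))"

abbreviation "C \<equiv> C_part j"
abbreviation "Z \<equiv> Z_part j"
abbreviation "Ci g \<equiv> inv_into UNIV (C g)"
abbreviation iv :: "('v \<Rightarrow> 'v) \<Rightarrow> 'v \<Rightarrow> 'v" where "iv g \<equiv> inv_into UNIV g"

lemma SpD:
  assumes "g \<in> Sp \<Omega>"
  shows "linear g" "bij g" "\<And>v w. \<Omega> (g v) (g w) = \<Omega> v w" "\<And>v. iv g (g v) = v" "\<And>v. g (iv g v) = v" "iv (iv g) = g"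
  using assms by (auto simp: Sp_def bij_is_inj bij_is_surj surj_f_inv_f inv_inv_eq)

lemma Sp_inv: assumes g: "g \<in> Sp \<Omega>" shows "iv g \<in> Sp \<Omega>"
proof -
  note G = SpD[OF g]
  have "linear (iv g)" 
  proof (rule linearI)
    fix x y show "iv g (x + y) = iv g x + iv g y"
      by (metis G(4,5) linear_add[OF G(1)])
  next
    fix r x show "iv g (r *\<^sub>R x) = r *\<^sub>R iv g x"
      by (metis G(4,5) linear_scale[OF G(1)])
  qed
  moreover have "bij (iv g)" using G(2) by (rule bij_imp_bij_inv)
  moreover have "\<Omega> (iv g v) (iv g w) = \<Omega> v w" for v w using G(3)[of "iv g v" "iv g w"] by (simp add: G(5))
  ultimately show ?thesis by (simp add: Sp_def)
qed

lemma Sp_comp: "g1 \<in> Sp \<Omega> \<Longrightarrow> g2 \<in> Sp \<Omega> \<Longrightarrow> g1 \<circ> g2 \<in> Sp \<Omega>"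
  by (auto simp: Sp_def intro: linear_compose bij_comp)

lemma Sp_id: "id \<in> Sp \<Omega>" by (auto simp: Sp_def linear_id)

lemma C_add_A: "g v = C g v + A_part g v"
  by (simp add: C_part_def A_part_def scaleR_add_right[symmetric] scaleR_diff_right) (simp add: scaleR_add_right scaleR_left.add[symmetric] flip: scaleR_add_left)

lemma C_linear: assumes "linear g" shows "linear (C g)"
  by (rule linearI) (simp_all add: C_part_def linear_add[OF assms] linear_scale[OF assms] algebra_simps)

lemma A_linear: assumes "linear g" shows "linear (A_part g)"
  by (rule linearI) (simp_all add: A_part_def linear_add[OF assms] linear_scale[OF assms] algebra_simps)

lemma C_j: assumes "linear g" shows "C g (j v) = j (C g v)"
  by (simp add: C_part_def linear_neg[OF assms] algebra_simps)

lemma A_j: assumes "linear g" shows "A_part g (j v) = - j (A_part g v)"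
  by (simp add: A_part_def linear_neg[OF assms] algebra_simps)

lemma \<Omega>_iv: assumes "g \<in> Sp \<Omega>" shows "\<Omega> (g v) w = \<Omega> v (iv g w)"
  using SpD(3)[OF assms, of v "iv g w"] by (simp add: SpD(5)[OF assms])

lemma \<Omega>_jgj: assumes "g \<in> Sp \<Omega>" shows "\<Omega> (j (g (j v))) w = \<Omega> v (j (iv g (j w)))"
  by (simp add: \<Omega>_j_left \<Omega>_iv[OF assms])

text \<open>The adjoint of a symplectic map for \<Omega> is its inverse, and j-linearity turns
  adjointness for \<Omega> into adjointness for H.\<close>

lemma H_C: assumes g: "g \<in> Sp \<Omega>" shows "H (C g v) w = H v (C (iv g) w)"
proof -
  have "\<Omega> (C g v) w = \<Omega> v (C (iv g) w)" for w
    by (simp add: C_part_def \<Omega>_simps \<Omega>_jgj[OF g] \<Omega>_iv[OF g])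
  thus ?thesis by (simp add: herm_def C_j[OF SpD(1)[OF Sp_inv[OF g]], symmetric])
qed

text \<open>The same adjointness for \<Omega>, but antilinearity changes the sign and
  conjugates.\<close>

lemma H_A: assumes g: "g \<in> Sp \<Omega>" shows "H (A_part g v) w = - H (A_part (iv g) w) v"
proof -
  have 1: "\<Omega> (A_part g v) w = \<Omega> v (A_part (iv g) w)" for w
    by (simp add: A_part_def \<Omega>_simps \<Omega>_jgj[OF g] \<Omega>_iv[OF g])
  have "H (A_part g v) w = - cnj (H v (A_part (iv g) w))"
    by (simp add: herm_def 1 A_j[OF SpD(1)[OF Sp_inv[OF g]]] \<Omega>_simps complex_eq_iff)
  thus ?thesis by (simp add: H_cnj)
qed

text \<open>The identity g^-1 g = 1 split into its j-linear part X and its j-antilinear part Y: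
  evaluating X + Y = 1 at v and at j v separates them.\<close>

lemma CC_AA:
  assumes g: "g \<in> Sp \<Omega>"
  shows "C (iv g) (C g v) + A_part (iv g) (A_part g v) = v"
    and "C (iv g) (A_part g v) + A_part (iv g) (C g v) = 0"
proof -
  note l = SpD(1)[OF g] note l' = SpD(1)[OF Sp_inv[OF g]]
  define X where "X = (\<lambda>v. C (iv g) (C g v) + A_part (iv g) (A_part g v))"
  define Y where "Y = (\<lambda>v. C (iv g) (A_part g v) + A_part (iv g) (C g v))"
  have XY: "X v + Y v = v" for v
  proof -
    have "v = iv g (g v)" by (simp add: SpD(4)[OF g])
    also have "\<dots> = C (iv g) (C g v + A_part g v) + A_part (iv g) (C g v + A_part g v)"
      by (simp only: C_add_A[of g v] C_add_A[of "iv g"])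
    finally show ?thesis by (simp add: X_def Y_def linear_add[OF C_linear[OF l']] linear_add[OF A_linear[OF l']] algebra_simps)
  qed
  have Xj: "X (j v) = j (X v)" and Yj: "Y (j v) = - j (Y v)" for v
    by (simp_all add: X_def Y_def C_j[OF l] C_j[OF l'] A_j[OF l] A_j[OF l']
        linear_neg[OF C_linear[OF l']] linear_neg[OF A_linear[OF l']])
  have "j (X v - Y v) = j v" using XY[of "j v"] by (simp add: Xj Yj)
  hence "j (j (X v - Y v)) = j (j v)" by (simp only:)
  hence d: "X v - Y v = v" unfolding j_j by (rule neg_equal_iff_equal[THEN iffD1])
  have "X v + Y v - (X v - Y v) = 0" using d XY[of v] by (simp only:) simp
  hence "(2::real) *\<^sub>R Y v = 0" by (simp add: scaleR_2)
  hence "Y v = 0" by simp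
  thus "C (iv g) (C g v) + A_part (iv g) (A_part g v) = v" "C (iv g) (A_part g v) + A_part (iv g) (C g v) = 0"
    using XY[of v] by (simp_all add: X_def Y_def)
qed

text \<open>The first identity of \<open>CC_AA\<close> tested against v; the minus sign in
  \<open>H_A\<close> makes the antilinear term positive. So C_g does not decrease norms, which gives
  its injectivity and the contraction property of its inverse.\<close>

lemma nm_C: assumes g: "g \<in> Sp \<Omega>" shows "nm (C g v) = nm v + nm (A_part g v)"
proof -
  have 1: "H (C g v) (C g v) = H v (C (iv g) (C g v))" by (rule H_C[OF g])
  have 2: "H (A_part g v) (A_part g v) = - H (A_part (iv g) (A_part g v)) v" by (rule H_A[OF g])
  have "nm (C g v) = Re (H v (C (iv g) (C g v)))" by (simp only: nm_Re 1)
  also have "\<dots> = Re (H (C (iv g) (C g v)) v)" by (metis H_cnj cnj.simps(1))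
  also have "C (iv g) (C g v) = v - A_part (iv g) (A_part g v)" using CC_AA(1)[OF g, of v] by (simp add: algebra_simps)
  also have "Re (H \<dots> v) = nm v + Re (H (A_part g v) (A_part g v))"
    by (simp only: 2 H_diff_left nm_Re) simp
  finally show ?thesis by (simp only: nm_Re)
qed

lemma C_inj: assumes g: "g \<in> Sp \<Omega>" shows "inj (C g)"
  unfolding linear_injective_0[OF C_linear[OF SpD(1)[OF g]]]
proof (intro allI impI)
  fix v assume "C g v = 0"
  hence "nm v + nm (A_part g v) = 0" using nm_C[OF g, of v] by simp
  thus "v = 0" using nm_nonneg[of v] nm_nonneg[of "A_part g v"] nm_eq_0_iff[of v] by linarith
qed

text \<open>The orthogonal complement of the range is killed by the adjoint, which is the C of the
  inverse map and hence injective.\<close>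

lemma C_surj: assumes g: "g \<in> Sp \<Omega>" shows "surj (C g)"
proof (rule ccontr)
  assume "\<not> surj (C g)"
  then obtain v where v: "v \<notin> range (C g)" by blast
  note l = SpD(1)[OF g]
  have sr: "subspace (range (C g))" by (rule linear_subspace_image[OF C_linear[OF l] subspace_UNIV])
  have jr: "j w \<in> range (C g)" if w: "w \<in> range (C g)" for w
  proof -
    obtain u where "w = C g u" using w by blast
    hence "j w = C g (j u)" by (simp only: C_j[OF l])
    thus ?thesis by blast
  qed
  obtain bs where bs: "orthonormal_basis (range (C g)) bs" using orthonormal_basis_exists[OF sr jr] by blast
  have o: "orthonormal (range (C g)) bs" using bs by (simp add: orthonormal_basis_def)
  define p where "p = (\<Sum>k<length bs. sc (H v (bs ! k)) (bs ! k))"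
  have r: "H (v - p) w = 0" if "w \<in> range (C g)" for w
  proof -
    have "H (v - p) w = (\<Sum>k<length bs. cnj (H w (bs ! k)) * H (v - p) (bs ! k))"
      by (subst orthonormal_basis_expand[OF bs that, symmetric]) (simp only: H_sum_right H_sc_right)
    also have "\<dots> = 0" by (rule sum.neutral) (use H_orthonormal_sum[OF o] in \<open>auto simp: H_diff_left p_def\<close>)
    finally show ?thesis .
  qed
  have "H (C (iv g) (v - p)) u = 0" for u
  proof -
    have "H (C (iv g) (v - p)) u = H (v - p) (C (iv (iv g)) u)" by (rule H_C[OF Sp_inv[OF g]])
    thus ?thesis using r by (simp add: SpD(6)[OF g])
  qed
  hence "nm (C (iv g) (v - p)) = 0" by (simp add: nm_Re)
  hence "C (iv g) (v - p) = C (iv g) 0" using linear_0[OF C_linear[OF SpD(1)[OF Sp_inv[OF g]]]] by simp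
  from injD[OF C_inj[OF Sp_inv[OF g]] this] have "v = p" by simp
  moreover have "p \<in> range (C g)"
  proof -
    have "sc c x \<in> range (C g)" if "x \<in> range (C g)" for c x
      using that jr unfolding jscale_def
      by (intro subspace_add[OF sr] subspace_scale[OF sr]) auto
    moreover have "bs ! k \<in> range (C g)" if "k < length bs" for k
      using o nth_mem[OF that] unfolding orthonormal_def by blast
    ultimately show ?thesis unfolding p_def
      by (intro subspace_sum[OF sr]) (simp add: lessThan_iff)
  qed
  ultimately show False using v by simp
qed

lemma C_Ci: "g \<in> Sp \<Omega> \<Longrightarrow> C g (Ci g v) = v"
  by (simp add: C_surj surj_f_inv_f)

lemma Ci_C: "g \<in> Sp \<Omega> \<Longrightarrow> Ci g (C g v) = v"
  by (simp add: C_inj)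

lemma Ci_linear: assumes g: "g \<in> Sp \<Omega>" shows "linear (Ci g)"
proof (rule linearI)
  note l = C_linear[OF SpD(1)[OF g]]
  fix x y r
  show "Ci g (x + y) = Ci g x + Ci g y"
    using Ci_C[OF g, of "Ci g x + Ci g y"] by (simp add: linear_add[OF l] C_Ci[OF g])
  show "Ci g (r *\<^sub>R x) = r *\<^sub>R Ci g x"
    using Ci_C[OF g, of "r *\<^sub>R Ci g x"] by (simp add: linear_scale[OF l] C_Ci[OF g])
qed

lemma Ci_j: assumes g: "g \<in> Sp \<Omega>" shows "Ci g (j v) = j (Ci g v)"
  using Ci_C[OF g, of "j (Ci g v)"] by (simp add: C_j[OF SpD(1)[OF g]] C_Ci[OF g])

lemma Z_eq: "Z g v = Ci g (A_part g v)"
  by (simp add: Z_part_def A_part_def)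

lemma Z_linear: assumes g: "g \<in> Sp \<Omega>" shows "linear (Z g)"
  unfolding Z_eq[abs_def] using linear_compose[OF A_linear[OF SpD(1)[OF g]] Ci_linear[OF g]] by (simp add: comp_def)

lemma Z_j: assumes g: "g \<in> Sp \<Omega>" shows "Z g (j v) = - j (Z g v)"
  by (simp add: Z_eq A_j[OF SpD(1)[OF g]] linear_neg[OF Ci_linear[OF g]] Ci_j[OF g])

lemma H_Ci: assumes g: "g \<in> Sp \<Omega>" shows "H (Ci g v) w = H v (Ci (iv g) w)"
  using H_C[OF g, of "Ci g v" "Ci (iv g) w"] by (simp add: C_Ci[OF g] C_Ci[OF Sp_inv[OF g]])

text \<open>The antilinear identity of \<open>CC_AA\<close>, solved with both C inverted. It
  expresses the antilinear part of g as minus Z of the inverse after C_g.\<close>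

lemma Z_iv: assumes g: "g \<in> Sp \<Omega>" shows "Z (iv g) v = - A_part g (Ci g v)"
proof -
  have "C (iv g) (A_part g (Ci g v)) = - A_part (iv g) v"
    using CC_AA(2)[OF g, of "Ci g v"] by (simp add: C_Ci[OF g] add_eq_0_iff2)
  hence "A_part g (Ci g v) = Ci (iv g) (- A_part (iv g) v)" by (metis Ci_C[OF Sp_inv[OF g]])
  thus ?thesis by (simp add: Z_eq linear_neg[OF Ci_linear[OF Sp_inv[OF g]]])
qed

lemma H_Z: assumes g: "g \<in> Sp \<Omega>" shows "H (Z g v) w = H (Z g w) v"
proof -
  have "H (Z g v) w = H (A_part g v) (Ci (iv g) w)" by (simp add: Z_eq H_Ci[OF g])
  also have "\<dots> = - H (A_part (iv g) (Ci (iv g) w)) v" by (rule H_A[OF g])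
  also have "A_part (iv g) (Ci (iv g) w) = - Z g w"
    using Z_iv[OF Sp_inv[OF g], of w] by (simp add: SpD(6)[OF g])
  finally show ?thesis by (simp add: H_simps)
qed

lemma H_Z': assumes g: "g \<in> Sp \<Omega>" shows "H v (Z g w) = H w (Z g v)"
  by (metis H_Z[OF g] H_cnj)

lemma nm_Ci_le: assumes g: "g \<in> Sp \<Omega>" shows "nm (Ci g v) \<le> nm v"
  using nm_C[OF g, of "Ci g v"] by (simp add: C_Ci[OF g])

text \<open>By \<open>nm_C\<close> the loss nm(v) - nm(Z v) is the squared norm of the inverse of
  the C of \<open>iv g\<close> at v, which is at least nm(v)/b when b bounds that C. The strict
  bound is what makes Gaussian kernels square integrable.\<close>

lemma Z_contraction:
  assumes g: "g \<in> Sp \<Omega>"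
  obtains r where "0 \<le> r" "r < 1" "\<And>v. cmod (H v (Z g v)) \<le> r * nm v"
proof -
  let ?g = "iv g"
  have g': "?g \<in> Sp \<Omega>" by (rule Sp_inv[OF g])
  obtain B where B: "B > 0" "\<And>v. norm (C ?g v) \<le> B * sqrt (nm v)"
    using linear_bound_nm[OF C_linear[OF SpD(1)[OF g']]] by blast
  obtain c where c: "c > 0" "\<And>v. sqrt (nm v) \<le> c * norm v" using nm_le_norm by blast
  \<comment> \<open>The added 1 makes b at least 1, hence s nonnegative.\<close>
  define b where "b = (c * B)\<^sup>2 + 1"
  have b: "b \<ge> 1" by (simp add: b_def)
  have Cb: "nm (C ?g v) \<le> b * nm v" for v
  proof -
    have "sqrt (nm (C ?g v)) \<le> c * (B * sqrt (nm v))"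
      using order_trans[OF c(2) mult_left_mono[OF B(2)]] c(1) by simp
    hence "(sqrt (nm (C ?g v)))\<^sup>2 \<le> (c * (B * sqrt (nm v)))\<^sup>2" by (intro power_mono) auto
    hence "nm (C ?g v) \<le> (c * B)\<^sup>2 * nm v" by (simp add: power_mult_distrib)
    also have "\<dots> \<le> b * nm v" unfolding b_def by (intro mult_right_mono) auto
    finally show ?thesis .
  qed
  define s where "s = 1 - 1 / b"
  have s: "0 \<le> s" "s < 1" using b by (auto simp: s_def)
  have Zb: "nm (Z g v) \<le> s * nm v" for v
  proof -
    have "Z g v = - A_part ?g (Ci ?g v)" using Z_iv[OF g', of v] by (simp add: SpD(6)[OF g])
    hence "nm (Z g v) = nm v - nm (Ci ?g v)" using nm_C[OF g', of "Ci ?g v"] by (simp add: C_Ci[OF g'])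
    moreover have "nm v \<le> b * nm (Ci ?g v)" using Cb[of "Ci ?g v"] by (simp add: C_Ci[OF g'])
    hence "nm v / b \<le> nm (Ci ?g v)" using b by (simp add: field_simps)
    ultimately show ?thesis by (simp add: s_def algebra_simps)
  qed
  show ?thesis
  proof (rule that[of "sqrt s"])
    fix v
    have "(cmod (H v (Z g v)))\<^sup>2 \<le> nm v * nm (Z g v)" by (rule cmod_H_le)
    also have "\<dots> \<le> nm v * (s * nm v)" by (intro mult_left_mono Zb) auto
    also have "\<dots> = (sqrt s * nm v)\<^sup>2" using s by (simp add: power_mult_distrib power2_eq_square)
    finally show "cmod (H v (Z g v)) \<le> sqrt s * nm v" by (rule power2_le_imp_le) (use s in auto)
  qed (use s in auto)
qed

lemma one_plus_Z: assumes g: "g \<in> Sp \<Omega>" shows "v + Z g v = Ci g (g v)"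
proof -
  have "Ci g (g v) = Ci g (C g v) + Ci g (A_part g v)"
    unfolding C_add_A[of g v] by (rule linear_add[OF Ci_linear[OF g]])
  thus ?thesis by (simp add: Ci_C[OF g] Z_eq)
qed

lemma one_plus_Z': assumes g: "g \<in> Sp \<Omega>" shows "g v + Z (iv g) (g v) = Ci (iv g) v"
  using one_plus_Z[OF Sp_inv[OF g], of "g v"] by (simp add: SpD(4)[OF g])

text \<open>The j-linear part of a product is C1 C2 + A1 A2; then A1 = C1 Z1 by definition of Z, and
  \<open>Z_iv\<close> rewrites A2.\<close>

lemma C_comp:
  assumes g1: "g1 \<in> Sp \<Omega>" and g2: "g2 \<in> Sp \<Omega>"
  shows "C (g1 \<circ> g2) v = C g1 (C g2 v - Z g1 (Z (iv g2) (C g2 v)))"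
proof -
  note l1 = SpD(1)[OF g1]
  have "C (g1 \<circ> g2) v = C g1 (C g2 v) + A_part g1 (A_part g2 v)"
  proof -
    have "g1 (g2 u) = C g1 (C g2 u) + C g1 (A_part g2 u) + A_part g1 (C g2 u) + A_part g1 (A_part g2 u)" for u
      by (simp only: C_add_A[of g2 u] C_add_A[of g1] linear_add[OF C_linear[OF l1]] linear_add[OF A_linear[OF l1]] add_ac)
    moreover have "(1/2) *\<^sub>R (x - (- x)) = x" for x :: 'v by (simp flip: scaleR_2)
    note this[of "C g1 (C g2 v) + A_part g1 (A_part g2 v)"]
    ultimately show ?thesis
      by (simp add: C_part_def[of j "g1 \<circ> g2"] C_j[OF l1] C_j[OF SpD(1)[OF g2]] A_j[OF l1] A_j[OF SpD(1)[OF g2]]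
          linear_neg[OF C_linear[OF l1]] linear_neg[OF A_linear[OF l1]])
  qed
  moreover have "A_part g1 (A_part g2 v) = - C g1 (Z g1 (Z (iv g2) (C g2 v)))"
    by (simp add: Z_iv[OF g2] Ci_C[OF g2] linear_neg[OF Z_linear[OF g1]] linear_neg[OF C_linear[OF l1]] linear_neg[OF A_linear[OF l1]] Z_eq[of g1] C_Ci[OF g1])
  ultimately show ?thesis by (simp add: linear_diff[OF C_linear[OF l1]])
qed

subsection \<open>Gaussian kernels\<close>

definition Kr :: "('v \<Rightarrow> 'v) \<Rightarrow> complex \<Rightarrow> 'v \<Rightarrow> 'v \<Rightarrow> complex" where
  "Kr g c v z = c * exp (of_real (kap / 2) * (2 * H (Ci g z) v - H z (Z (iv g) z) - H (Z g v) v))"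

text \<open>The kernel behaves like that of an adjoint operator. Holomorphy in z for the inverse map
  thereby becomes antiholomorphy in v for g.\<close>

lemma Kr_cnj: assumes g: "g \<in> Sp \<Omega>" shows "cnj (Kr g c v z) = Kr (iv g) (cnj c) z v"
proof -
  have "cnj (2 * H (Ci g z) v - H z (Z (iv g) z) - H (Z g v) v) =
     2 * H (Ci (iv g) v) z - H v (Z (iv (iv g)) v) - H (Z (iv g) z) z"
    by (simp add: H_cnj H_Ci[OF Sp_inv[OF g]] SpD(6)[OF g])
  thus ?thesis by (simp add: Kr_def exp_cnj)
qed

lemma has_parameters_Kr:
  "has_parameters h \<Omega> j U g c \<longleftrightarrow> (\<forall>v. U (ev v) = Kr g c v)"
  unfolding has_parameters_def fun_eq_iff Kr_def hbar_kap by (simp add: mult.commute)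

lemma hol_Kr: assumes g: "g \<in> Sp \<Omega>" shows "hol (Kr g c v)"
proof -
  have "hol (\<lambda>z. c * exp (of_real (kap / 2) * ((2 * H (Ci g z) v + (- 1) * H z (Z (iv g) z)) + - H (Z g v) v)))"
    by (intro hol_mult hol_const hol_exp hol_add hol_quadratic Z_linear Z_j Sp_inv g hol_linear)
       (auto intro!: linearI simp: linear_add[OF Ci_linear[OF g]] linear_scale[OF Ci_linear[OF g]] Ci_j[OF g] H_simps scaleR_conv_of_real)
  thus ?thesis by (simp add: Kr_def[abs_def])
qed

text \<open>The growth rate in z is strictly below kap/2 because Z of the inverse map is a strict
  contraction, and the mixed term is controlled since the inverse of C_g does not increase
  norms.\<close>

lemma cmod_Kr_le:
  assumes g: "g \<in> Sp \<Omega>"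
  obtains r where "0 \<le> r" "r < 1" 
    "\<And>c v z. cmod (Kr g c v z) \<le> cmod c * exp (kap * sqrt (nm v) * sqrt (nm z) + kap / 2 * (r * nm z + nm v))"
proof -
  obtain r where r: "0 \<le> r" "r < 1" "\<And>v. cmod (H v (Z (iv g) v)) \<le> r * nm v" 
    using Z_contraction[OF Sp_inv[OF g]] by blast
  obtain r' where r': "0 \<le> r'" "r' < 1" "\<And>v. cmod (H v (Z g v)) \<le> r' * nm v" 
    using Z_contraction[OF g] by blast
  show ?thesis
  proof (rule that[OF r(1,2)])
    fix c v z
    have 1: "Re (H (Ci g z) v) \<le> sqrt (nm v) * sqrt (nm z)"
    proof -
      have "Re (H (Ci g z) v) \<le> cmod (H (Ci g z) v)" by (rule complex_Re_le_cmod)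
      also have "\<dots> \<le> sqrt (nm (Ci g z) * nm v)" by (rule real_le_rsqrt[OF cmod_H_le])
      also have "\<dots> \<le> sqrt (nm z * nm v)" by (intro real_sqrt_le_mono mult_right_mono nm_Ci_le[OF g]) auto
      finally show ?thesis by (simp add: real_sqrt_mult mult.commute)
    qed
    have 2: "- Re (H z (Z (iv g) z)) \<le> r * nm z"
      using r(3)[of z] abs_Re_le_cmod[of "H z (Z (iv g) z)"] by linarith
    have "- Re (H (Z g v) v) \<le> cmod (H v (Z g v))"
      using abs_Re_le_cmod[of "H (Z g v) v"] H_cnj[of v "Z g v"] by (metis abs_le_D2 complex_mod_cnj)
    also have "\<dots> \<le> 1 * nm v" using r'(2) by (intro order_trans[OF r'(3)] mult_right_mono) auto
    finally have 3: "- Re (H (Z g v) v) \<le> nm v" by simp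
    have "kap / 2 * (2 * Re (H (Ci g z) v) + - Re (H z (Z (iv g) z)) + - Re (H (Z g v) v)) \<le>
       kap / 2 * (2 * (sqrt (nm v) * sqrt (nm z)) + r * nm z + nm v)"
      using kap_pos by (intro mult_left_mono add_mono 1 2 3) auto
    hence "kap / 2 * (2 * Re (H (Ci g z) v) - Re (H z (Z (iv g) z)) - Re (H (Z g v) v)) \<le>
       kap * sqrt (nm v) * sqrt (nm z) + kap / 2 * (r * nm z + nm v)" by (simp add: algebra_simps)
    thus "cmod (Kr g c v z) \<le> cmod c * exp (kap * sqrt (nm v) * sqrt (nm z) + kap / 2 * (r * nm z + nm v))"
      by (simp add: Kr_def norm_mult norm_exp_eq_Re mult_left_mono)
  qed
qed

lemma integrable_exp_gauss2:
  assumes "s < kap" shows "integrable gauss (\<lambda>z. exp (s * nm z + R * sqrt (nm z)))"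
proof (rule Bochner_Integration.integrable_bound)
  \<comment> \<open>Half of the gap below the critical rate \<open>kap\<close> absorbs the linear
    term.\<close>
  define d where "d = (kap - s) / 2"
  have d: "d > 0" "s + d < kap" using assms by (auto simp: d_def field_simps)
  show "integrable gauss (\<lambda>z. exp (R\<^sup>2 / (4 * d)) * exp ((s + d) * nm z))"
    by (intro integrable_mult_right integrable_exp_gauss d)
  have "s * t\<^sup>2 + R * t \<le> R\<^sup>2 / (4 * d) + (s + d) * t\<^sup>2" for t
  proof -
    have "0 \<le> (R - 2 * d * t)\<^sup>2 / (4 * d)" using d by auto
    also have "\<dots> = R\<^sup>2 / (4 * d) - R * t + d * t\<^sup>2" using d by (simp add: field_simps power2_eq_square)
    finally show ?thesis by (simp add: algebra_simps)
  qed
  from this[of "sqrt (nm _)"]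
  have "s * nm z + R * sqrt (nm z) \<le> R\<^sup>2 / (4 * d) + (s + d) * nm z" for z
    by (metis nm_nonneg real_sqrt_pow2)
  thus "AE z in gauss. norm (exp (s * nm z + R * sqrt (nm z))) \<le> norm (exp (R\<^sup>2 / (4 * d)) * exp ((s + d) * nm z))"
    by (intro AE_I2) (simp add: mult_exp_exp)
qed measurable

lemma Kr_Fk: assumes g: "g \<in> Sp \<Omega>" shows "Kr g c v \<in> Fk"
proof -
  obtain r where r: "0 \<le> r" "r < 1" 
    and b: "\<And>c v z. cmod (Kr g c v z) \<le> cmod c * exp (kap * sqrt (nm v) * sqrt (nm z) + kap / 2 * (r * nm z + nm v))"
    using cmod_Kr_le[OF g] by blast
  show ?thesis
  proof (rule FkI_bound[OF hol_Kr[OF g]])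
    show "integrable gauss (\<lambda>z. (cmod c)\<^sup>2 * exp (kap * nm v) * exp (kap * r * nm z + 2 * kap * sqrt (nm v) * sqrt (nm z)))"
      using kap_pos r by (intro integrable_mult_right integrable_exp_gauss2) auto
    fix z
    have "(cmod (Kr g c v z))\<^sup>2 \<le> (cmod c * exp (kap * sqrt (nm v) * sqrt (nm z) + kap / 2 * (r * nm z + nm v)))\<^sup>2"
      by (intro power_mono b) auto
    also have "\<dots> = (cmod c)\<^sup>2 * exp (2 * (kap * sqrt (nm v) * sqrt (nm z) + kap / 2 * (r * nm z + nm v)))"
      by (simp only: power_mult_distrib exp_double)
    also have "2 * (kap * sqrt (nm v) * sqrt (nm z) + kap / 2 * (r * nm z + nm v)) =
       kap * nm v + (kap * r * nm z + 2 * kap * sqrt (nm v) * sqrt (nm z))" by (simp add: algebra_simps)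
    also have "(cmod c)\<^sup>2 * exp \<dots> = (cmod c)\<^sup>2 * exp (kap * nm v) * exp (kap * r * nm z + 2 * kap * sqrt (nm v) * sqrt (nm z))"
      by (simp only: exp_add mult.assoc)
    finally show "(cmod (Kr g c v z))\<^sup>2 \<le> (cmod c)\<^sup>2 * exp (kap * nm v) * exp (kap * r * nm z + 2 * kap * sqrt (nm v) * sqrt (nm z))" .
  qed
qed

text \<open>The scalar in the Weyl covariance of the kernels. It does not depend on g, so it cancels
  when kernels of different maps are divided.\<close>

definition gam :: "'v \<Rightarrow> 'v \<Rightarrow> complex" where
  "gam a v = exp (- of_real kap * (of_real (nm a / 2) + H a v))"

text \<open>The kernel form of the intertwining relation. The identities for 1 + Z turn the terms
  with g a into terms with a, after which the two exponents agree.\<close>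

lemma W_Kr:
  assumes g: "g \<in> Sp \<Omega>"
  shows "W (g a) (Kr g c v) z = gam a v * Kr g c (v + a) z"
proof -
  note g' = Sp_inv[OF g]
  let ?S = "Z (iv g)"
  have a1: "Ci g (g a) = a + Z g a" by (rule one_plus_Z[OF g, symmetric])
  have a2: "H y (g a) + H y (?S (g a)) = H (Ci g y) a" for y
    using one_plus_Z'[OF g, of a] H_Ci[OF g, of y a] by (metis H_add_right)
  have "of_real kap * H z (g a) - of_real (kap / 2 * nm (g a)) +
     of_real (kap / 2) * (2 * H (Ci g (z - g a)) v - H (z - g a) (?S (z - g a)) - H (Z g v) v) =
     of_real (kap / 2) * (2 * (H z (g a) + H z (?S (g a))) - (H (g a) (g a) + H (g a) (?S (g a)))
       + 2 * H (Ci g z) v - 2 * H (Ci g (g a)) v - H z (?S z) - H (Z g v) v)"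
    by (simp add: linear_diff[OF Ci_linear[OF g]] linear_diff[OF Z_linear[OF g']] H_diff_left H_diff_right
        H_Z'[OF g', of "g a" z] H_self field_simps)
  also have "\<dots> = of_real (kap / 2) * (2 * H (Ci g z) a - H (a + Z g a) a
       + 2 * H (Ci g z) v - 2 * H (a + Z g a) v - H z (?S z) - H (Z g v) v)"
    by (simp only: a1 a2)
  also have "\<dots> = - of_real kap * (of_real (nm a / 2) + H a v) +
     of_real (kap / 2) * (2 * H (Ci g z) (v + a) - H z (?S z) - H (Z g (v + a)) (v + a))"
    by (simp add: linear_add[OF Z_linear[OF g]] H_add_left H_add_right H_Z[OF g, of a v] H_self field_simps)
  finally have "exp (of_real kap * H z (g a) - of_real (kap / 2 * nm (g a))) *
     exp (of_real (kap / 2) * (2 * H (Ci g (z - g a)) v - H (z - g a) (?S (z - g a)) - H (Z g v) v)) =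
     gam a v * exp (of_real (kap / 2) * (2 * H (Ci g z) (v + a) - H z (?S z) - H (Z g (v + a)) (v + a)))"
    by (simp only: gam_def mult_exp_exp)
  thus ?thesis by (simp add: W_def Kr_def mult_ac)
qed


subsection \<open>The integral operators with Gaussian kernel\<close>

text \<open>Written as an inner product with a kernel of the inverse map, so that the reproducing
  formula and the adjoint rule for Weyl operators apply directly; \<open>Uop_eq\<close> is the
  integral form.\<close>

definition Uop :: "('v \<Rightarrow> 'v) \<Rightarrow> complex \<Rightarrow> ('v \<Rightarrow> complex) \<Rightarrow> 'v \<Rightarrow> complex" where
  "Uop g c f z = ip f (Kr (iv g) (cnj c) z)"

lemma Uop_eq: assumes g: "g \<in> Sp \<Omega>" shows "Uop g c f z = (\<integral>u. f u * Kr g c u z \<partial>gauss)"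
  by (simp add: Uop_def ip_def Kr_cnj[OF Sp_inv[OF g]] SpD(6)[OF g])

lemma Uop_coherent: assumes g: "g \<in> Sp \<Omega>" shows "Uop g c (ev v) = Kr g c v"
proof
  fix z
  have "Uop g c (ev v) z = cnj (ip (Kr (iv g) (cnj c) z) (ev v))" by (simp add: Uop_def ip_cnj)
  also have "\<dots> = cnj (Kr (iv g) (cnj c) z v)" by (simp add: reproducing Kr_Fk Sp_inv g)
  also have "\<dots> = Kr g c v z" by (simp add: Kr_cnj[OF Sp_inv[OF g]] SpD(6)[OF g])
  finally show "Uop g c (ev v) z = Kr g c v z" .
qed

lemma borel_Kr1 [measurable]: assumes g: "g \<in> Sp \<Omega>" shows "Kr g c v \<in> borel_measurable borel"
  by (rule hol_measurable[OF hol_Kr[OF g]])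

lemma Kr_flip: assumes g: "g \<in> Sp \<Omega>" shows "Kr g c u z = cnj (Kr (iv g) (cnj c) z u)"
  by (simp add: Kr_cnj[OF Sp_inv[OF g]] SpD(6)[OF g])

lemma borel_Kr2 [measurable]: assumes g: "g \<in> Sp \<Omega>" shows "(\<lambda>u. Kr g c u z) \<in> borel_measurable borel"
proof -
  note [measurable] = borel_Kr1[OF Sp_inv[OF g], of "cnj c" z]
  show ?thesis unfolding Kr_flip[OF g] by measurable
qed

text \<open>The factor quadratic in z leaves the integral; what remains inside depends on z through
  the exponential of a linear function, which \<open>has_derivative_exp_integral\<close>
  handles.\<close>

lemma hol_Uop:
  assumes g: "g \<in> Sp \<Omega>" and f: "f \<in> Fk" shows "hol (Uop g c f)"
proof -
  note g' = Sp_inv[OF g]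
  obtain b0 where b0: "b0 > 0" "\<And>v. sqrt (nm v) \<le> b0 * norm v" using nm_le_norm by blast
  obtain r where r: "0 \<le> r" "r < 1" "\<And>v. cmod (H v (Z g v)) \<le> r * nm v" using Z_contraction[OF g] by blast
  define \<phi> where "\<phi> = (\<lambda>u. f u * exp (- of_real (kap / 2) * H (Z g u) u))"
  define l where "l = (\<lambda>u z. of_real kap * H (Ci g z) u)"
  define b where "b = (\<lambda>u. kap * b0 * sqrt (nm u))"
  have [measurable]: "f \<in> borel_measurable borel" by (rule Fk_measurable[OF f])
  have [measurable]: "(\<lambda>u. H (Z g u) u) \<in> borel_measurable borel"
    by (intro borel_measurable_continuous_onI continuous_intros continuous_on_linear[OF Z_linear[OF g]])
  have lin: "linear (l u)" for u
    by (rule linearI)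
       (simp_all add: l_def linear_add[OF Ci_linear[OF g]] linear_scale[OF Ci_linear[OF g]] H_simps scaleR_conv_of_real algebra_simps)
  have bd: "norm (l u z) \<le> b u * norm z" for u z
  proof -
    have "cmod (H (Ci g z) u) \<le> sqrt (nm (Ci g z) * nm u)" by (rule real_le_rsqrt[OF cmod_H_le])
    also have "\<dots> \<le> sqrt (nm z * nm u)" by (intro real_sqrt_le_mono mult_right_mono nm_Ci_le[OF g]) auto
    also have "\<dots> \<le> (b0 * norm z) * sqrt (nm u)" unfolding real_sqrt_mult by (intro mult_right_mono b0) auto
    finally have "kap * cmod (H (Ci g z) u) \<le> kap * ((b0 * norm z) * sqrt (nm u))"
      using kap_pos by (intro mult_left_mono) auto
    thus ?thesis using kap_pos by (simp add: l_def b_def norm_mult mult_ac)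
  qed
  \<comment> \<open>AM-GM separates the square integrable f from a Gaussian of rate kap r < kap,
    which leaves room for any linear exponent.\<close>
  have int: "integrable gauss (\<lambda>u. norm (\<phi> u) * exp (R * b u))" for R
  proof (rule Bochner_Integration.integrable_bound)
    show "integrable gauss (\<lambda>u. ((cmod (f u))\<^sup>2 + exp (kap * r * nm u + (2 * R * (kap * b0)) * sqrt (nm u))) / 2)"
      using kap_pos r Fk_sq[OF f] by (intro integrable_divide Bochner_Integration.integrable_add integrable_exp_gauss2) auto
    show "(\<lambda>u. norm (\<phi> u) * exp (R * b u)) \<in> borel_measurable gauss" unfolding \<phi>_def b_def by measurable
    show "AE u in gauss. norm (norm (\<phi> u) * exp (R * b u)) \<le>
        norm (((cmod (f u))\<^sup>2 + exp (kap * r * nm u + (2 * R * (kap * b0)) * sqrt (nm u))) / 2)"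
    proof (rule AE_I2)
      fix u
      have "cmod (H (Z g u) u) = cmod (H u (Z g u))" by (metis H_cnj complex_mod_cnj)
      hence "- Re (H (Z g u) u) \<le> r * nm u"
        using r(3)[of u] abs_Re_le_cmod[of "H (Z g u) u"] by linarith
      hence "kap / 2 * (- Re (H (Z g u) u)) \<le> kap / 2 * (r * nm u)" using kap_pos by (intro mult_left_mono) auto
      hence "norm (\<phi> u) \<le> cmod (f u) * exp (kap / 2 * (r * nm u))"
        by (simp add: \<phi>_def norm_mult norm_exp_eq_Re mult_left_mono)
      hence "norm (\<phi> u) * exp (R * b u) \<le> cmod (f u) * exp (kap / 2 * (r * nm u)) * exp (R * b u)"
        by (intro mult_right_mono) auto
      also have "\<dots> = cmod (f u) * exp (kap / 2 * (r * nm u) + R * b u)" by (simp add: exp_add)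
      also have "\<dots> \<le> ((cmod (f u))\<^sup>2 + (exp (kap / 2 * (r * nm u) + R * b u))\<^sup>2) / 2" by (rule mult_le_half_sum_squares)
      also have "(exp (kap / 2 * (r * nm u) + R * b u))\<^sup>2 = exp (2 * (kap / 2 * (r * nm u) + R * b u))" by (rule exp_double[symmetric])
      also have "2 * (kap / 2 * (r * nm u) + R * b u) = kap * r * nm u + (2 * R * (kap * b0)) * sqrt (nm u)"
        by (simp add: b_def algebra_simps)
      finally show "norm (norm (\<phi> u) * exp (R * b u)) \<le>
        norm (((cmod (f u))\<^sup>2 + exp (kap * r * nm u + (2 * R * (kap * b0)) * sqrt (nm u))) / 2)" by simp
    qed
  qed
  have b0': "b u \<ge> 0" for u using kap_pos b0(1) by (simp add: b_def)
  have m: "\<phi> \<in> borel_measurable gauss" "b \<in> borel_measurable gauss" "(\<lambda>u. l u z) \<in> borel_measurable gauss" for z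
    unfolding \<phi>_def b_def l_def by measurable
  note D = has_derivative_exp_integral[of l b \<phi> gauss, OF lin bd b0' m int]
  have h1: "hol (\<lambda>z. \<integral>u. \<phi> u * exp (l u z) \<partial>gauss)"
  proof (rule holI[OF D])
    fix z v
    have "(\<integral>u. \<phi> u * l u (j v) * exp (l u z) \<partial>gauss) = (\<integral>u. \<i> * (\<phi> u * l u v * exp (l u z)) \<partial>gauss)"
      by (rule Bochner_Integration.integral_cong) (simp_all add: l_def Ci_j[OF g] H_simps)
    also have "\<dots> = \<i> * (\<integral>u. \<phi> u * l u v * exp (l u z) \<partial>gauss)" by (rule integral_mult_right_zero)
    finally show "(\<integral>u. \<phi> u * l u (j v) * exp (l u z) \<partial>gauss) = \<i> * (\<integral>u. \<phi> u * l u v * exp (l u z) \<partial>gauss)" .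
  qed
  have "Uop g c f z = c * exp (- of_real (kap / 2) * H z (Z (iv g) z)) * (\<integral>u. \<phi> u * exp (l u z) \<partial>gauss)" for z
  proof -
    have "f u * Kr g c u z = c * exp (- of_real (kap / 2) * H z (Z (iv g) z)) * (\<phi> u * exp (l u z))" for u
    proof -
      have "exp (- of_real (kap / 2) * H z (Z (iv g) z)) * (exp (- of_real (kap / 2) * H (Z g u) u) * exp (l u z)) =
        exp (of_real (kap / 2) * (2 * H (Ci g z) u - H z (Z (iv g) z) - H (Z g u) u))"
        unfolding mult_exp_exp l_def by (rule arg_cong[where f = exp]) (simp add: field_simps)
      thus ?thesis by (simp add: Kr_def \<phi>_def mult_ac)
    qed
    thus ?thesis by (simp only: Uop_eq[OF g] integral_mult_right_zero)
  qed
  moreover have "hol (\<lambda>z. c * exp (- of_real (kap / 2) * H z (Z (iv g) z)) * (\<integral>u. \<phi> u * exp (l u z) \<partial>gauss))"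
    by (intro hol_mult hol_const hol_exp hol_quadratic Z_linear Z_j g' h1)
  ultimately show ?thesis by (metis (no_types, lifting) ext)
qed

lemma Uop_add:
  assumes g: "g \<in> Sp \<Omega>" and "f1 \<in> Fk" "f2 \<in> Fk"
  shows "Uop g c (\<lambda>z. f1 z + f2 z) = (\<lambda>z. Uop g c f1 z + Uop g c f2 z)"
  using assms by (simp add: fun_eq_iff Uop_def ip_add_left Kr_Fk Sp_inv)

lemma Uop_cmult: "Uop g c (\<lambda>z. a * f z) = (\<lambda>z. a * Uop g c f z)"
  by (simp add: fun_eq_iff Uop_def ip_cmult_left)

lemma gam_W: "cnj (gam (- b) z) = exp (of_real kap * H z b - of_real (kap / 2 * nm b))"
proof -
  have "cnj (- of_real kap * (of_real (nm (- b) / 2) + H (- b) z)) = of_real kap * H z b - of_real (kap / 2 * nm b)"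
    by (simp add: H_cnj H_simps algebra_simps)
  thus ?thesis by (simp only: gam_def exp_cnj)
qed

text \<open>Moved across the inner product, the Weyl operator acts on the kernel of the inverse map,
  where \<open>W_Kr\<close> turns it into a shift of the parameter.\<close>

lemma Uop_W:
  assumes g: "g \<in> Sp \<Omega>" and f: "f \<in> Fk"
  shows "Uop g c (W v f) = W (g v) (Uop g c f)"
proof
  fix z
  note g' = Sp_inv[OF g]
  have e: "iv g (- g v) = - v" by (simp add: linear_neg[OF SpD(1)[OF g']] SpD(4)[OF g])
  have "Uop g c (W v f) z = ip f (W (- v) (Kr (iv g) (cnj c) z))"
    unfolding Uop_def by (rule ip_W_left[OF f Kr_Fk[OF g']])
  also have "W (- v) (Kr (iv g) (cnj c) z) = (\<lambda>u. gam (- g v) z * Kr (iv g) (cnj c) (z - g v) u)"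
    using W_Kr[OF g', of "- g v" "cnj c" z] by (simp add: e fun_eq_iff)
  also have "ip f \<dots> = cnj (gam (- g v) z) * Uop g c f (z - g v)"
    by (simp add: ip_cmult_right Uop_def)
  also have "\<dots> = W (g v) (Uop g c f) z" by (simp only: gam_W W_def)
  finally show "Uop g c (W v f) z = W (g v) (Uop g c f) z" .
qed

subsection \<open>Composition of Gaussian kernels\<close>

text \<open>The derivative vanishes on all \<open>(gj + jg)v = 2j C\<^sub>g v\<close>, and \<open>C\<^sub>g\<close> is onto.\<close>

lemma hol_antihol_const:
  assumes g: "g \<in> Sp \<Omega>" and r: "hol \<rho>" and a: "hol (\<lambda>v. cnj (\<rho> (- g v)))"
  shows "\<rho> z = \<rho> 0"
proof -
  from r obtain D where D: "\<And>z. (\<rho> has_derivative D z) (at z)" "\<And>z v. D z (j v) = \<i> * D z v" by (rule holE) blast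
  from a obtain E where E: "\<And>v. ((\<lambda>v. cnj (\<rho> (- g v))) has_derivative E v) (at v)" "\<And>v u. E v (j u) = \<i> * E v u" by (rule holE) blast
  note l = SpD(1)[OF g]
  have "D z = (\<lambda>u. 0)" for z
  proof -
    define v where "v = - iv g z"
    have z: "- g v = z" by (simp add: v_def linear_neg[OF l] SpD(5)[OF g])
    have lD: "linear (D z)" by (rule has_derivative_linear[OF D(1)])
    have "linear (\<lambda>v. - g v)" by (rule linearI) (simp_all add: linear_add[OF l] linear_scale[OF l])
    hence "((\<lambda>v. - g v) has_derivative (\<lambda>v. - g v)) (at v)"
      by (intro bounded_linear_imp_has_derivative linear_bounded_linear)
    from has_derivative_compose[OF this D(1)]
    have "((\<lambda>v. \<rho> (- g v)) has_derivative (\<lambda>u. D z (- g u))) (at v)" by (simp only: z)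
    hence "((\<lambda>v. cnj (\<rho> (- g v))) has_derivative (\<lambda>u. cnj (D z (- g u)))) (at v)"
      by (rule has_derivative_cnj)
    from has_derivative_unique[OF this E(1)] have e: "E v u = cnj (D z (- g u))" for u by (simp add: fun_eq_iff)
    have "D z (g (j u)) + \<i> * D z (g u) = 0" for u
    proof -
      have "cnj (D z (- g (j u))) = \<i> * cnj (D z (- g u))" using E(2)[of v u] by (simp only: e)
      hence "D z (- g (j u)) = - \<i> * D z (- g u)"
        by (metis complex_cnj_cnj complex_cnj_i complex_cnj_mult)
      hence "\<i> * D z (g u) = - D z (g (j u))" by (simp add: linear_neg[OF lD])
      thus ?thesis by simp
    qed
    hence s: "D z (g (j u) + j (g u)) = 0" for u by (simp add: linear_add[OF lD] D(2))
    show ?thesis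
    proof
      fix w
      define u where "u = Ci g (- j ((1/2) *\<^sub>R w))"
      have Cu: "C g u = - j ((1/2) *\<^sub>R w)" by (simp add: u_def C_Ci[OF g])
      have "g (j u) + j (g u) = 2 *\<^sub>R j (C g u)"
        by (simp add: C_part_def algebra_simps)
      also have "\<dots> = w" by (simp add: Cu)
      finally show "D z w = 0" using s[of u] by simp
    qed
  qed
  hence "(\<rho> has_derivative (\<lambda>u. 0)) (at z)" for z using D(1) by simp
  thus ?thesis using has_derivative_zero_unique[of UNIV \<rho> z 0] by auto
qed

lemma Kr_scale: "Kr g c v z = c * Kr g 1 v z" by (simp add: Kr_def)

text \<open>The constant J of the composition rule, read off at v = z = 0, where the kernel of the
  product map with parameter 1 has the value 1.\<close>

definition Jint :: "('v \<Rightarrow> 'v) \<Rightarrow> ('v \<Rightarrow> 'v) \<Rightarrow> complex" where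
  "Jint g1 g2 = ip (Kr g2 1 0) (Kr (iv g1) 1 0)"

lemma Kr_nonzero: "c \<noteq> 0 \<Longrightarrow> Kr g c v z \<noteq> 0" by (simp add: Kr_def)

lemma Kr_0: assumes "g \<in> Sp \<Omega>" shows "Kr g 1 0 z = exp (- of_real (kap / 2) * H z (Z (iv g) z))"
  by (simp add: Kr_def linear_0[OF Z_linear[OF assms]])

lemma divide_exp_neg: "x / exp (- a * b) = x * exp (a * b)" for a b x :: complex
  by (simp add: exp_minus divide_inverse)

text \<open>The two scalar factors are those acquired by inner products of kernels under the same
  shift, so the quotient of the two quantities is invariant.\<close>

lemma Kr_covariant:
  assumes g: "g \<in> Sp \<Omega>"
  shows "gam a v * cnj (gam (g a) z) * Kr g 1 (v + a) (z + g a) = Kr g 1 v z"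
proof -
  let ?b = "g a"
  have 1: "gam a v * Kr g 1 (v + a) (z + ?b) = exp (of_real kap * H (z + ?b) ?b - of_real (kap / 2 * nm ?b)) * Kr g 1 v z"
    using W_Kr[OF g, of a 1 v "z + ?b"] by (simp add: W_def)
  have 2: "cnj (gam ?b z) * exp (of_real kap * H (z + ?b) ?b - of_real (kap / 2 * nm ?b)) = 1"
  proof -
    have "cnj (gam ?b z) = exp (cnj (- of_real kap * (of_real (nm ?b / 2) + H ?b z)))"
      by (simp only: gam_def exp_cnj)
    also have "\<dots> * exp (of_real kap * H (z + ?b) ?b - of_real (kap / 2 * nm ?b)) = 1"
      unfolding mult_exp_exp by (simp add: H_cnj H_simps H_self algebra_simps)
    finally show ?thesis .
  qed
  have "gam a v * cnj (gam ?b z) * Kr g 1 (v + a) (z + ?b) = cnj (gam ?b z) * (gam a v * Kr g 1 (v + a) (z + ?b))"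
    by (simp only: mult_ac)
  also have "\<dots> = (cnj (gam ?b z) * exp (of_real kap * H (z + ?b) ?b - of_real (kap / 2 * nm ?b))) * Kr g 1 v z"
    by (simp only: 1 mult.assoc)
  finally show ?thesis by (simp only: 2 mult_1_left)
qed

text \<open>
  The quotient of both sides depends only on \<open>z - g\<^sub>1g\<^sub>2v\<close> by covariance; as a function of it, it is
  holomorphic in \<open>z\<close> and antiholomorphic in \<open>v\<close>.
\<close>

lemma ip_Kr_Kr_1:
  assumes g1: "g1 \<in> Sp \<Omega>" and g2: "g2 \<in> Sp \<Omega>"
  shows "ip (Kr g2 1 v) (Kr (iv g1) 1 z) = Jint g1 g2 * Kr (g1 \<circ> g2) 1 v z"
proof -
  note g12 = Sp_comp[OF g1 g2] note i1 = Sp_inv[OF g1]  note i2 = Sp_inv[OF g2] note i12 = Sp_inv[OF g12]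
  let ?g = "g1 \<circ> g2"
  define N where "N = (\<lambda>v z. ip (Kr g2 1 v) (Kr (iv g1) 1 z))"
  define R where "R = (\<lambda>v z. N v z / Kr ?g 1 v z)"
  define \<rho> where "\<rho> = (\<lambda>z. R 0 z)"
  have N1: "N v z = Uop g1 1 (Kr g2 1 v) z" for v z by (simp add: N_def Uop_def)
  have N2: "cnj (N v z) = Uop (iv g2) 1 (Kr (iv g1) 1 z) v" for v z
    by (simp add: N_def Uop_def ip_cnj SpD(6)[OF g2])
  have Ncov: "gam a v * cnj (gam (?g a) z) * N (v + a) (z + ?g a) = N v z" for a v z
  proof -
    have "N v z = ip (W (g2 a) (Kr g2 1 v)) (W (iv g1 (?g a)) (Kr (iv g1) 1 z))"
      unfolding N_def by (simp add: SpD(4)[OF g1] ip_W Kr_Fk g2 i1)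
    also have "W (g2 a) (Kr g2 1 v) = (\<lambda>u. gam a v * Kr g2 1 (v + a) u)"
      by (simp add: fun_eq_iff W_Kr[OF g2])
    also have "W (iv g1 (?g a)) (Kr (iv g1) 1 z) = (\<lambda>u. gam (?g a) z * Kr (iv g1) 1 (z + ?g a) u)"
      by (simp add: fun_eq_iff W_Kr[OF i1])
    finally show ?thesis by (simp add: N_def ip_cmult_left ip_cmult_right mult_ac)
  qed
  have gam0: "gam a v \<noteq> 0" for a v by (simp add: gam_def)
  have Rcov: "R (v + a) (z + ?g a) = R v z" for a v z
  proof -
    have "R v z = (gam a v * cnj (gam (?g a) z) * N (v + a) (z + ?g a)) / (gam a v * cnj (gam (?g a) z) * Kr ?g 1 (v + a) (z + ?g a))"
      by (simp only: R_def Ncov Kr_covariant[OF g12])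
    thus ?thesis by (simp add: R_def gam0)
  qed
  have R\<rho>: "R v z = \<rho> (z - ?g v)" for v z
    using Rcov[of v "- v" z] by (simp add: \<rho>_def linear_neg[OF SpD(1)[OF g12], unfolded comp_def])
  have h1: "hol \<rho>"
  proof -
    have "\<rho> = (\<lambda>z. N 0 z * exp (of_real (kap / 2) * H z (Z (iv ?g) z)))"
      unfolding \<rho>_def R_def Kr_0[OF g12] divide_exp_neg by (rule refl)
    moreover have "hol (\<lambda>z. N 0 z * exp (of_real (kap / 2) * H z (Z (iv ?g) z)))"
      unfolding N1 by (intro hol_mult hol_exp hol_const hol_quadratic Z_linear Z_j i12 hol_Uop g1 Kr_Fk g2)
    ultimately show ?thesis by (simp only:)
  qed
  have h2: "hol (\<lambda>v. cnj (\<rho> (- ?g v)))"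
  proof -
    have "cnj (\<rho> (- ?g v)) = cnj (N v 0) * exp (of_real (kap / 2) * H v (Z ?g v))" for v
    proof -
      have "cnj (\<rho> (- ?g v)) = cnj (N v 0) / cnj (Kr ?g 1 v 0)" 
        using R\<rho>[of v 0] by (metis R_def complex_cnj_divide diff_0)
      also have "cnj (Kr ?g 1 v 0) = exp (- of_real (kap / 2) * H v (Z ?g v))"
        unfolding Kr_cnj[OF g12] complex_cnj_one Kr_0[OF i12] SpD(6)[OF g12] by (rule refl)
      finally show ?thesis by (simp only: divide_exp_neg)
    qed
    moreover have "hol (\<lambda>v. cnj (N v 0) * exp (of_real (kap / 2) * H v (Z ?g v)))"
      unfolding N2 by (intro hol_mult hol_exp hol_const hol_quadratic Z_linear Z_j g12 hol_Uop i2 Kr_Fk i1)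
    ultimately show ?thesis by (simp only:)
  qed
  have "R v z = \<rho> 0" unfolding R\<rho> by (rule hol_antihol_const[OF g12 h1 h2])
  also have "\<rho> 0 = Jint g1 g2"
    unfolding \<rho>_def R_def N_def Jint_def Kr_0[OF g12] by simp
  finally have "N v z / Kr ?g 1 v z = Jint g1 g2" by (simp add: R_def)
  hence "N v z = Jint g1 g2 * Kr ?g 1 v z" using Kr_nonzero[of 1 ?g v z] by (metis nonzero_divide_eq_eq one_neq_zero)
  thus ?thesis by (simp only: N_def)
qed

lemma ip_Kr_Kr:
  assumes g1: "g1 \<in> Sp \<Omega>" and g2: "g2 \<in> Sp \<Omega>"
  shows "ip (Kr g2 c2 v) (Kr (iv g1) c1 z) = c2 * cnj c1 * Jint g1 g2 * Kr (g1 \<circ> g2) 1 v z"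
proof -
  have "Kr g2 c2 v = (\<lambda>u. c2 * Kr g2 1 v u)" "Kr (iv g1) c1 z = (\<lambda>u. c1 * Kr (iv g1) 1 z u)"
    by (rule ext, rule Kr_scale)+
  thus ?thesis by (simp add: ip_cmult_left ip_cmult_right ip_Kr_Kr_1[OF g1 g2])
qed

lemma Kr_id: "Kr id 1 v z = ev v z"
proof -
  have C: "C id = id" by (simp add: fun_eq_iff C_part_def flip: scaleR_2)
  have "Z id v = 0" for v by (simp add: Z_eq A_part_def linear_0[OF Ci_linear[OF Sp_id]])
  thus ?thesis by (simp add: Kr_def C coherent_eq)
qed

subsection \<open>Unitarity\<close>

text \<open>Via the composition rule, the kernels of g with parameter c have the inner products of
  the coherent states, and likewise for the inverse map. This expresses the modulus condition on the
  parameter; having both equations makes it symmetric under inversion.\<close>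

definition normalised :: "('v \<Rightarrow> 'v) \<Rightarrow> complex \<Rightarrow> bool" where
  "normalised g c \<longleftrightarrow> g \<in> Sp \<Omega> \<and> c * cnj c * Jint (iv g) g = 1 \<and> c * cnj c * Jint g (iv g) = 1"

lemma normalised_inv: "normalised g c \<Longrightarrow> normalised (iv g) (cnj c)"
  by (auto simp: normalised_def Sp_inv SpD(6) mult_ac)

lemma normalised_Sp: "normalised g c \<Longrightarrow> g \<in> Sp \<Omega>" by (simp add: normalised_def)

lemma ip_Kr_normalised: assumes "normalised g c" shows "ip (Kr g c u) (Kr g c v) = ev u v"
proof -
  have g: "g \<in> Sp \<Omega>" using assms by (simp add: normalised_def)
  have "iv g \<circ> g = id" using SpD(4)[OF g] by (simp add: fun_eq_iff)
  thus ?thesis using ip_Kr_Kr[OF Sp_inv[OF g] g, of c u c v] assms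
    by (simp add: SpD(6)[OF g] normalised_def Kr_id)
qed

lemma norm_Kr_normalised: assumes "normalised g c" shows "(\<integral>v. (cmod (Kr g c u v))\<^sup>2 \<partial>gauss) = exp (kap * nm u)"
proof -
  have "complex_of_real (\<integral>v. (cmod (Kr g c u v))\<^sup>2 \<partial>gauss) = of_real (exp (kap * nm u))"
    unfolding ip_self[symmetric] ip_Kr_normalised[OF assms] by (simp add: coherent_eq H_self exp_of_real[symmetric])
  thus ?thesis by (simp only: of_real_eq_iff)
qed

text \<open>Every Fock function satisfies such a bound with r = 1. The slack r < 1 is what makes the
  double integrals below absolutely convergent.\<close>

definition nice :: "('v \<Rightarrow> complex) \<Rightarrow> bool" where
  "nice f \<longleftrightarrow> f \<in> Fk \<and> (\<exists>r<1. \<exists>B. \<forall>z. cmod (f z) \<le> B * exp (kap / 2 * (r * nm z)))"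

lemma nice_integrable:
  assumes "nice f" shows "integrable gauss (\<lambda>u. cmod (f u) * exp (kap / 2 * nm u))"
proof -
  from assms obtain r B where r: "r < 1" and B: "\<And>z. cmod (f z) \<le> B * exp (kap / 2 * (r * nm z))" and f: "f \<in> Fk"
    by (auto simp: nice_def)
  note [measurable] = Fk_measurable[OF f]
  have "kap / 2 * (1 + r) < kap / 2 * 2" using kap_pos r by (intro mult_strict_left_mono) auto
  hence "integrable gauss (\<lambda>u. B * exp (kap / 2 * (1 + r) * nm u))"
    by (intro integrable_mult_right integrable_exp_gauss) simp
  thus ?thesis
  proof (rule Bochner_Integration.integrable_bound)
    show "AE u in gauss. norm (cmod (f u) * exp (kap / 2 * nm u)) \<le> norm (B * exp (kap / 2 * (1 + r) * nm u))"
    proof (rule AE_I2)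
      fix u
      have "cmod (f u) * exp (kap / 2 * nm u) \<le> B * exp (kap / 2 * (r * nm u)) * exp (kap / 2 * nm u)"
        by (intro mult_right_mono B) auto
      also have "\<dots> = B * exp (kap / 2 * (1 + r) * nm u)" by (simp add: mult.assoc mult_exp_exp) (simp add: algebra_simps)
      finally have "cmod (f u) * exp (kap / 2 * nm u) \<le> B * exp (kap / 2 * (1 + r) * nm u)" .
      moreover have "0 \<le> cmod (f u) * exp (kap / 2 * nm u)" by simp
      ultimately show "norm (cmod (f u) * exp (kap / 2 * nm u)) \<le> norm (B * exp (kap / 2 * (1 + r) * nm u))"
        by (metis abs_of_nonneg order_trans real_norm_def)
    qed
  qed measurable
qed

text \<open>A Cauchy-Schwarz estimate in AM-GM form, with a free parameter t by which the term in
  \<open>\<phi>\<close> can later be absorbed.\<close>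

lemma ip_Kr_bound:
  assumes n: "normalised g c" and [measurable]: "\<phi> \<in> borel_measurable borel"
    and \<phi>: "integrable gauss (\<lambda>z. (cmod (\<phi> z))\<^sup>2)" and t: "t > 0"
  shows "(\<integral>v. cmod (Kr g c u v) * cmod (\<phi> v) \<partial>gauss) \<le> exp (kap / 2 * nm u) * ((t + (\<integral>z. (cmod (\<phi> z))\<^sup>2 \<partial>gauss) / t) / 2)"
proof -
  have g: "g \<in> Sp \<Omega>" using n by (rule normalised_Sp)
  note [measurable] = borel_Kr1[OF g]
  note K2 = Fk_sq[OF Kr_Fk[OF g, of c u]]
  \<comment> \<open>The kernel has norm exp(kap/2 nm(u)); this weight makes both AM-GM terms carry
    exactly that factor.\<close>
  define s where "s = t * exp (- (kap / 2 * nm u))"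
  have s: "s > 0" using t by (simp add: s_def)
  have e: "exp (kap * nm u) = exp (kap / 2 * nm u) * exp (kap / 2 * nm u)" by (simp add: mult_exp_exp)
  have "(\<integral>v. cmod (Kr g c u v) * cmod (\<phi> v) \<partial>gauss) \<le> (\<integral>v. s / 2 * (cmod (Kr g c u v))\<^sup>2 + 1 / (2 * s) * (cmod (\<phi> v))\<^sup>2 \<partial>gauss)"
  proof (rule integral_mono)
    show "integrable gauss (\<lambda>v. cmod (Kr g c u v) * cmod (\<phi> v))" by (intro integrable_mult_L2 K2 \<phi>) measurable
    fix v
    have "cmod (Kr g c u v) * cmod (\<phi> v) = s * (cmod (Kr g c u v) * (cmod (\<phi> v) / s))" using s by simp
    also have "\<dots> \<le> s * (((cmod (Kr g c u v))\<^sup>2 + (cmod (\<phi> v) / s)\<^sup>2) / 2)"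
      using s by (intro mult_left_mono mult_le_half_sum_squares) auto
    also have "\<dots> = s / 2 * (cmod (Kr g c u v))\<^sup>2 + 1 / (2 * s) * (cmod (\<phi> v))\<^sup>2"
      using s by (simp add: field_simps power2_eq_square)
    finally show "cmod (Kr g c u v) * cmod (\<phi> v) \<le> s / 2 * (cmod (Kr g c u v))\<^sup>2 + 1 / (2 * s) * (cmod (\<phi> v))\<^sup>2" .
  qed (use K2 \<phi> in auto)
  also have "\<dots> = s / 2 * exp (kap * nm u) + 1 / (2 * s) * (\<integral>z. (cmod (\<phi> z))\<^sup>2 \<partial>gauss)"
    using K2 \<phi> by (subst Bochner_Integration.integral_add) (auto simp: norm_Kr_normalised[OF n])
  also have "\<dots> = exp (kap / 2 * nm u) * ((t + (\<integral>z. (cmod (\<phi> z))\<^sup>2 \<partial>gauss) / t) / 2)"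
    using t by (simp add: s_def e exp_minus field_simps)
  finally show ?thesis .
qed

lemma borel_Kr_pair: assumes g: "g \<in> Sp \<Omega>" shows "(\<lambda>p. Kr g c (fst p) (snd p)) \<in> borel_measurable (borel \<Otimes>\<^sub>M borel)"
  unfolding Kr_def
  by (intro measurable_continuous_pair continuous_intros continuous_on_linear[OF Ci_linear[OF g]]
      continuous_on_linear[OF Z_linear[OF g]] continuous_on_linear[OF Z_linear[OF Sp_inv[OF g]]])

text \<open>The inner integral over v is bounded by |f(u)| times exp(kap/2 nm(u)), integrable as f
  is nice. The function \<open>\<phi>\<close> is square integrable but not assumed holomorphic,
  because truncations will be inserted.\<close>

lemma Uop_nice_Fubini:
  assumes n: "normalised g c" and f: "nice f" and [measurable]: "\<phi> \<in> borel_measurable borel"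
    and \<phi>: "integrable gauss (\<lambda>z. (cmod (\<phi> z))\<^sup>2)"
  shows "ip (Uop g c f) \<phi> = (\<integral>u. f u * ip (Kr g c u) \<phi> \<partial>gauss)"
    and "integrable gauss (\<lambda>v. Uop g c f v * cnj (\<phi> v))"
    and "t > 0 \<Longrightarrow> cmod (ip (Uop g c f) \<phi>) \<le>
       (\<integral>u. cmod (f u) * exp (kap / 2 * nm u) \<partial>gauss) * ((t + (\<integral>z. (cmod (\<phi> z))\<^sup>2 \<partial>gauss) / t) / 2)"
proof -
  have g: "g \<in> Sp \<Omega>" using n by (rule normalised_Sp)
  have fF: "f \<in> Fk" using f by (simp add: nice_def)
  note [measurable] = Fk_measurable[OF fF] borel_Kr_pair[OF g] borel_Kr1[OF g] borel_Kr2[OF g]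
  have [measurable]: "(\<lambda>p. f (fst p) * Kr g c (fst p) (snd p) * cnj (\<phi> (snd p))) \<in> borel_measurable (gauss \<Otimes>\<^sub>M gauss)" by measurable
  have KI: "integrable gauss (\<lambda>v. Kr g c u v * cnj (\<phi> v))" for u
    by (intro integrable_mult_L2 Fk_sq Kr_Fk g \<phi>) measurable
  have b1: "(\<integral>v. norm (f u * Kr g c u v * cnj (\<phi> v)) \<partial>gauss) \<le> cmod (f u) * exp (kap / 2 * nm u) * ((t + (\<integral>z. (cmod (\<phi> z))\<^sup>2 \<partial>gauss) / t) / 2)" if "t > 0" for u t
  proof -
    have "(\<integral>v. norm (f u * Kr g c u v * cnj (\<phi> v)) \<partial>gauss) = cmod (f u) * (\<integral>v. cmod (Kr g c u v) * cmod (\<phi> v) \<partial>gauss)"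
      by (simp add: norm_mult mult.assoc)
    also have "\<dots> \<le> cmod (f u) * (exp (kap / 2 * nm u) * ((t + (\<integral>z. (cmod (\<phi> z))\<^sup>2 \<partial>gauss) / t) / 2))"
      by (intro mult_left_mono ip_Kr_bound[OF n _ \<phi> that]) auto
    finally show ?thesis by (simp only: mult.assoc)
  qed
  note I1 = integrable_mult_left[OF nice_integrable[OF f]]
  have I: "integrable (gauss \<Otimes>\<^sub>M gauss) (\<lambda>(u, v). f u * Kr g c u v * cnj (\<phi> v))"
    unfolding split_def
  proof (rule gauss2.Fubini_integrable)
    show "integrable gauss (\<lambda>u. \<integral>v. norm (f (fst (u, v)) * Kr g c (fst (u, v)) (snd (u, v)) * cnj (\<phi> (snd (u, v)))) \<partial>gauss)"
    proof (rule Bochner_Integration.integrable_bound[OF I1])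
      show "AE u in gauss. norm (\<integral>v. norm (f (fst (u, v)) * Kr g c (fst (u, v)) (snd (u, v)) * cnj (\<phi> (snd (u, v)))) \<partial>gauss)
         \<le> norm (cmod (f u) * exp (kap / 2 * nm u) * ((1 + (\<integral>z. (cmod (\<phi> z))\<^sup>2 \<partial>gauss) / 1) / 2))"
        using b1[of 1] by (intro AE_I2) (simp add: order_trans[OF _ abs_ge_self] integral_nonneg_AE)
    qed measurable
    show "AE u in gauss. integrable gauss (\<lambda>v. f (fst (u, v)) * Kr g c (fst (u, v)) (snd (u, v)) * cnj (\<phi> (snd (u, v))))"
      using integrable_mult_right[OF KI] by (simp add: mult.assoc)
  qed measurable
  have "(\<integral>v. (\<integral>u. f u * Kr g c u v * cnj (\<phi> v) \<partial>gauss) \<partial>gauss) = (\<integral>u. (\<integral>v. f u * Kr g c u v * cnj (\<phi> v) \<partial>gauss) \<partial>gauss)"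
    by (rule gauss2.Fubini_integral[OF I])
  moreover have L: "(\<integral>u. f u * Kr g c u v * cnj (\<phi> v) \<partial>gauss) = Uop g c f v * cnj (\<phi> v)" for v
    by (simp add: Uop_eq[OF g])
  moreover have R: "(\<integral>v. f u * Kr g c u v * cnj (\<phi> v) \<partial>gauss) = f u * ip (Kr g c u) \<phi>" for u
    by (simp add: ip_def mult.assoc)
  ultimately show eq: "ip (Uop g c f) \<phi> = (\<integral>u. f u * ip (Kr g c u) \<phi> \<partial>gauss)"
    by (simp only: ip_def[of "Uop g c f"])
  have "integrable gauss (\<lambda>v. \<integral>u. f u * Kr g c u v * cnj (\<phi> v) \<partial>gauss)"
    using gauss2.integrable_snd[OF I] by simp
  thus "integrable gauss (\<lambda>v. Uop g c f v * cnj (\<phi> v))" by (simp only: L)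
  show "cmod (ip (Uop g c f) \<phi>) \<le>
       (\<integral>u. cmod (f u) * exp (kap / 2 * nm u) \<partial>gauss) * ((t + (\<integral>z. (cmod (\<phi> z))\<^sup>2 \<partial>gauss) / t) / 2)" if t: "t > 0"
  proof -
    have i2: "integrable gauss (\<lambda>u. \<integral>v. f u * Kr g c u v * cnj (\<phi> v) \<partial>gauss)" using gauss2.integrable_fst[OF I] by simp
    have "cmod (\<integral>u. (\<integral>v. f u * Kr g c u v * cnj (\<phi> v) \<partial>gauss) \<partial>gauss) \<le>
       (\<integral>u. cmod (f u) * exp (kap / 2 * nm u) * ((t + (\<integral>z. (cmod (\<phi> z))\<^sup>2 \<partial>gauss) / t) / 2) \<partial>gauss)"
      by (rule norm_integral_le[OF i2 I1]) (rule order_trans[OF integral_norm_bound b1[OF t]])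
    also have "(\<integral>u. (\<integral>v. f u * Kr g c u v * cnj (\<phi> v) \<partial>gauss) \<partial>gauss) = ip (Uop g c f) \<phi>"
      unfolding eq by (simp only: R)
    finally show ?thesis by simp
  qed
qed

text \<open>By Fubini the pairing involves only inner products of kernels, which are those of
  coherent states; the reproducing formula finishes.\<close>

lemma Uop_inverse_nice:
  assumes n: "normalised g c" and f: "nice f"
  shows "ip (Uop g c f) (Kr g c z) = f z"
proof -
  have g: "g \<in> Sp \<Omega>" using n by (rule normalised_Sp)
  have "ip (Uop g c f) (Kr g c z) = (\<integral>u. f u * ip (Kr g c u) (Kr g c z) \<partial>gauss)"
    by (intro Uop_nice_Fubini(1)[OF n f] Fk_sq Kr_Fk g borel_Kr1)
  also have "\<dots> = ip f (ev z)"
  proof -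
    have "cnj (ev z u) = ev u z" for u by (metis ip_cnj ip_coherent)
    thus ?thesis by (simp add: ip_Kr_normalised[OF n]) (simp add: ip_def)
  qed
  also have "\<dots> = f z" using f by (simp add: reproducing nice_def)
  finally show ?thesis .
qed

text \<open>
  Square integrability of \<open>U f\<close>: the truncations \<open>\<phi>\<close> of \<open>U f\<close> satisfy \<open>\<parallel>\<phi>\<parallel>\<^sup>2 = \<langle>U f, \<phi>\<rangle>\<close>, and the AM-GM bound
  of the right-hand side absorbs half of \<open>\<parallel>\<phi>\<parallel>\<^sup>2\<close>.
\<close>

lemma Uop_nice:
  assumes n: "normalised g c" and f: "nice f"
  shows "Uop g c f \<in> Fk" and "(\<integral>z. (cmod (Uop g c f z))\<^sup>2 \<partial>gauss) = (\<integral>z. (cmod (f z))\<^sup>2 \<partial>gauss)"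
proof -
  have g: "g \<in> Sp \<Omega>" using n by (rule normalised_Sp)
  have fF: "f \<in> Fk" using f by (simp add: nice_def)
  have h: "hol (Uop g c f)" by (rule hol_Uop[OF g fF])
  define Uf where "Uf = Uop g c f"
  have [measurable]: "Uf \<in> borel_measurable borel" using h unfolding Uf_def by (rule hol_measurable)
  \<comment> \<open>The constant of the AM-GM bound itself; the added 1 keeps it positive for the
    division.\<close>
  define t where "t = (\<integral>u. cmod (f u) * exp (kap / 2 * nm u) \<partial>gauss) + 1"
  have t: "t \<ge> 1" by (simp add: t_def integral_nonneg_AE)
  define \<phi> where "\<phi> = (\<lambda>m::nat. \<lambda>z. if cmod (Uf z) \<le> real m then Uf z else 0)"
  have [measurable]: "\<phi> m \<in> borel_measurable borel" for m unfolding \<phi>_def by measurable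
  have \<phi>I: "integrable gauss (\<lambda>z. (cmod (\<phi> m z))\<^sup>2)" for m
  proof (rule Bochner_Integration.integrable_bound[of gauss "\<lambda>_. (real m)\<^sup>2"])
    show "AE x in gauss. norm ((cmod (\<phi> m x))\<^sup>2) \<le> norm ((real m)\<^sup>2)" by (intro AE_I2) (auto simp: \<phi>_def intro!: power_mono)
  qed auto
  have \<phi>b: "(\<integral>z. (cmod (\<phi> m z))\<^sup>2 \<partial>gauss) \<le> t\<^sup>2" for m
  proof -
    let ?x = "\<integral>z. (cmod (\<phi> m z))\<^sup>2 \<partial>gauss"
    have "ip Uf (\<phi> m) = ip (\<phi> m) (\<phi> m)" unfolding ip_def by (rule Bochner_Integration.integral_cong) (auto simp: \<phi>_def)
    hence "cmod (ip Uf (\<phi> m)) = \<bar>?x\<bar>" by (simp only: ip_self norm_of_real)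
    hence "?x = cmod (ip Uf (\<phi> m))" by (simp add: integral_nonneg_AE)
    also have "\<dots> \<le> (\<integral>u. cmod (f u) * exp (kap / 2 * nm u) \<partial>gauss) * ((t + ?x / t) / 2)"
      unfolding Uf_def by (rule Uop_nice_Fubini(3)[OF n f _ \<phi>I]) (use t in auto)
    also have "\<dots> \<le> t * ((t + ?x / t) / 2)"
      using t by (intro mult_right_mono divide_nonneg_nonneg add_nonneg_nonneg) (auto simp: t_def integral_nonneg_AE)
    also have "\<dots> = (t\<^sup>2 + ?x) / 2" using t by (simp add: field_simps power2_eq_square)
    finally show ?thesis by simp
  qed
  have "(\<integral>\<^sup>+z. ennreal ((cmod (Uf z))\<^sup>2) \<partial>gauss) \<le> liminf (\<lambda>m. \<integral>\<^sup>+z. ennreal ((cmod (\<phi> m z))\<^sup>2) \<partial>gauss)"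
  proof -
    have "(\<integral>\<^sup>+z. ennreal ((cmod (Uf z))\<^sup>2) \<partial>gauss) = (\<integral>\<^sup>+z. liminf (\<lambda>m. ennreal ((cmod (\<phi> m z))\<^sup>2)) \<partial>gauss)"
    proof (rule nn_integral_cong)
      fix z
      have "eventually (\<lambda>m. cmod (Uf z) \<le> real m) sequentially"
        by (rule eventually_sequentiallyI[of "nat \<lceil>cmod (Uf z)\<rceil>"]) linarith
      hence "eventually (\<lambda>m. ennreal ((cmod (\<phi> m z))\<^sup>2) = ennreal ((cmod (Uf z))\<^sup>2)) sequentially"
        by (rule eventually_mono) (simp add: \<phi>_def)
      hence "(\<lambda>m. ennreal ((cmod (\<phi> m z))\<^sup>2)) \<longlonglongrightarrow> ennreal ((cmod (Uf z))\<^sup>2)"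
        by (rule tendsto_eventually)
      thus "ennreal ((cmod (Uf z))\<^sup>2) = liminf (\<lambda>m. ennreal ((cmod (\<phi> m z))\<^sup>2))"
        by (intro lim_imp_Liminf[symmetric]) auto
    qed
    also have "\<dots> \<le> liminf (\<lambda>m. \<integral>\<^sup>+z. ennreal ((cmod (\<phi> m z))\<^sup>2) \<partial>gauss)"
      by (rule nn_integral_liminf) measurable
    finally show ?thesis .
  qed
  also have "\<dots> \<le> ennreal (t\<^sup>2)"
  proof (rule Liminf_le)
    show "eventually (\<lambda>m. (\<integral>\<^sup>+z. ennreal ((cmod (\<phi> m z))\<^sup>2) \<partial>gauss) \<le> ennreal (t\<^sup>2)) sequentially"
      using \<phi>b by (intro always_eventually allI) (simp add: nn_integral_eq_integral[OF \<phi>I] ennreal_leI)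
  qed simp
  finally have "(\<integral>\<^sup>+z. ennreal ((cmod (Uf z))\<^sup>2) \<partial>gauss) < \<infinity>" by (simp add: le_less_trans ennreal_less_top)
  hence "integrable gauss (\<lambda>z. (cmod (Uf z))\<^sup>2)" by (intro integrableI_bounded) auto
  thus F: "Uop g c f \<in> Fk" using h by (simp add: Fock_iff Uf_def)
  have "ip (Uop g c f) (Uop g c f) = (\<integral>u. f u * ip (Kr g c u) (Uop g c f) \<partial>gauss)"
    by (rule Uop_nice_Fubini(1)[OF n f Fk_measurable[OF F] Fk_sq[OF F]])
  also have "\<dots> = ip f f"
  proof -
    have "ip (Kr g c u) (Uop g c f) = cnj (f u)" for u
      by (metis ip_cnj Uop_inverse_nice[OF n f])
    thus ?thesis by (simp add: ip_def)
  qed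
  finally show "(\<integral>z. (cmod (Uop g c f z))\<^sup>2 \<partial>gauss) = (\<integral>z. (cmod (f z))\<^sup>2 \<partial>gauss)"
    unfolding ip_self by (simp only: of_real_eq_iff)
qed


section \<open>Dilations and the passage to the whole Fock space\<close>

definition dil_factor :: "nat \<Rightarrow> real" where "dil_factor m = 1 - 1 / (real m + 2)"

text \<open>The shift by 2 in the denominator keeps the factors at least 1/2, so the norms of all
  dilations of f have a common bound.\<close>

lemma dil_factor: "1 / 2 \<le> dil_factor m" "dil_factor m < 1" "0 < dil_factor m"
  by (auto simp: dil_factor_def field_simps)

lemma dil_factor_lim: "dil_factor \<longlonglongrightarrow> 1"
  unfolding dil_factor_def by real_asymp

definition dil :: "nat \<Rightarrow> ('v \<Rightarrow> complex) \<Rightarrow> 'v \<Rightarrow> complex" where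
  "dil m f z = f (dil_factor m *\<^sub>R z)"

abbreviation "sq f \<equiv> (\<integral>z. (cmod (f z))\<^sup>2 \<partial>gauss)"

lemma sq_nonneg: "sq f \<ge> 0" by (simp add: integral_nonneg_AE)

lemma nn_sq: "f \<in> Fk \<Longrightarrow> (\<integral>\<^sup>+z. ennreal ((cmod (f z))\<^sup>2) \<partial>gauss) = ennreal (sq f)"
  by (intro nn_integral_eq_integral Fk_sq) auto

text \<open>The pointwise bound for f, taken at r z, has the growth rate r^2 < 1.\<close>

lemma dil_nice: assumes f: "f \<in> Fk" shows "nice (dil m f)"
proof -
  define B where "B = (sq f + 1) / 2"
  have B: "B \<ge> 0" by (simp add: B_def sq_nonneg)
  have r2: "(dil_factor m)\<^sup>2 < 1" using dil_factor[of m] by (simp add: power_less_one_iff)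
  have b: "cmod (dil m f z) \<le> B * exp (kap / 2 * ((dil_factor m)\<^sup>2 * nm z))" for z
    using Fk_pointwise_bound[OF f, of "dil_factor m *\<^sub>R z"] by (simp add: dil_def B_def nm_scaleR)
  have "dil m f \<in> Fk"
  proof (rule FkI_bound)
    have "hol (\<lambda>z. f (dil_factor m *\<^sub>R z + 0))"
      by (rule hol_comp_linear[OF Fk_hol[OF f]]) (auto intro!: linearI simp: scaleR_add_right)
    thus "hol (dil m f)" by (simp add: dil_def[abs_def])
    show "integrable gauss (\<lambda>z. B\<^sup>2 * exp (kap * (dil_factor m)\<^sup>2 * nm z))"
      using kap_pos r2 by (intro integrable_mult_right integrable_exp_gauss) simp
    fix z
    have "(cmod (dil m f z))\<^sup>2 \<le> (B * exp (kap / 2 * ((dil_factor m)\<^sup>2 * nm z)))\<^sup>2" by (intro power_mono b) auto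
    also have "\<dots> = B\<^sup>2 * exp (2 * (kap / 2 * ((dil_factor m)\<^sup>2 * nm z)))" by (simp only: power_mult_distrib exp_double)
    also have "2 * (kap / 2 * ((dil_factor m)\<^sup>2 * nm z)) = kap * (dil_factor m)\<^sup>2 * nm z" by simp
    finally show "(cmod (dil m f z))\<^sup>2 \<le> B\<^sup>2 * exp (kap * (dil_factor m)\<^sup>2 * nm z)" .
  qed
  thus ?thesis using b r2 unfolding nice_def by blast
qed

lemma dil_Fk: "f \<in> Fk \<Longrightarrow> dil m f \<in> Fk"
  using dil_nice by (simp add: nice_def)

lemma sq_dil: assumes f: "f \<in> Fk" shows "sq (dil m f) \<le> (1 / (dil_factor m)\<^sup>2) ^ length ubs * sq f"
proof -
  note [measurable] = Fk_measurable[OF f]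
  have "ennreal (sq (dil m f)) = (\<integral>\<^sup>+z. ennreal ((cmod (f (dil_factor m *\<^sub>R z)))\<^sup>2) \<partial>gauss)"
    using nn_sq[OF dil_Fk[OF f], of m] by (simp only: dil_def)
  also have "\<dots> \<le> ennreal ((1 / (dil_factor m)\<^sup>2) ^ length ubs) * (\<integral>\<^sup>+z. ennreal ((cmod (f z))\<^sup>2) \<partial>gauss)"
    by (rule nn_gauss_scaling) (use dil_factor[of m] in auto)
  also have "\<dots> = ennreal ((1 / (dil_factor m)\<^sup>2) ^ length ubs * sq f)"
    by (simp only: nn_sq[OF f]) (simp add: ennreal_mult sq_nonneg)
  finally show ?thesis by (subst (asm) ennreal_le_iff) (auto simp: sq_nonneg)
qed

lemma dil_lim: assumes "f \<in> Fk" shows "(\<lambda>m. dil m f z) \<longlonglongrightarrow> f z"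
proof -
  have "(\<lambda>m. dil_factor m *\<^sub>R z) \<longlonglongrightarrow> 1 *\<^sub>R z" by (intro tendsto_intros dil_factor_lim)
  moreover have "isCont f (1 *\<^sub>R z)"
    using hol_continuous[OF Fk_hol[OF assms]] by (simp add: continuous_on_eq_continuous_at)
  ultimately have "(\<lambda>m. f (dil_factor m *\<^sub>R z)) \<longlonglongrightarrow> f (1 *\<^sub>R z)" by (rule isCont_tendsto_compose[rotated])
  thus ?thesis by (simp add: dil_def)
qed

lemma Kr_exp_integrable:
  assumes g: "g \<in> Sp \<Omega>" shows "integrable gauss (\<lambda>u. B * exp (kap / 2 * nm u) * cmod (Kr g c v u))"
proof -
  obtain r where r: "0 \<le> r" "r < 1" 
    and b: "\<And>c v z. cmod (Kr g c v z) \<le> cmod c * exp (kap * sqrt (nm v) * sqrt (nm z) + kap / 2 * (r * nm z + nm v))"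
    using cmod_Kr_le[OF g] by blast
  note [measurable] = borel_Kr1[OF g]
  have "kap / 2 * (1 + r) < kap / 2 * 2" using kap_pos r by (intro mult_strict_left_mono) auto
  hence "integrable gauss (\<lambda>u. \<bar>B\<bar> * cmod c * exp (kap / 2 * nm v) * exp (kap / 2 * (1 + r) * nm u + (kap * sqrt (nm v)) * sqrt (nm u)))"
    by (intro integrable_mult_right integrable_exp_gauss2) simp
  thus ?thesis
  proof (rule Bochner_Integration.integrable_bound)
    show "AE u in gauss. norm (B * exp (kap / 2 * nm u) * cmod (Kr g c v u)) \<le>
        norm (\<bar>B\<bar> * cmod c * exp (kap / 2 * nm v) * exp (kap / 2 * (1 + r) * nm u + (kap * sqrt (nm v)) * sqrt (nm u)))"
    proof (rule AE_I2)
      fix u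
      have "norm (B * exp (kap / 2 * nm u) * cmod (Kr g c v u)) = \<bar>B\<bar> * exp (kap / 2 * nm u) * cmod (Kr g c v u)"
        by (simp add: abs_mult)
      also have "\<dots> \<le> \<bar>B\<bar> * exp (kap / 2 * nm u) * (cmod c * exp (kap * sqrt (nm v) * sqrt (nm u) + kap / 2 * (r * nm u + nm v)))"
        by (intro mult_left_mono b) auto
      also have "\<dots> = \<bar>B\<bar> * cmod c * (exp (kap / 2 * nm u) * exp (kap * sqrt (nm v) * sqrt (nm u) + kap / 2 * (r * nm u + nm v)))"
        by (simp only: mult_ac)
      also have "exp (kap / 2 * nm u) * exp (kap * sqrt (nm v) * sqrt (nm u) + kap / 2 * (r * nm u + nm v)) =
          exp (kap / 2 * nm v) * exp (kap / 2 * (1 + r) * nm u + (kap * sqrt (nm v)) * sqrt (nm u))"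
        unfolding mult_exp_exp by (rule arg_cong[where f = exp]) (simp add: field_simps)
      finally show "norm (B * exp (kap / 2 * nm u) * cmod (Kr g c v u)) \<le>
        norm (\<bar>B\<bar> * cmod c * exp (kap / 2 * nm v) * exp (kap / 2 * (1 + r) * nm u + (kap * sqrt (nm v)) * sqrt (nm u)))"
        by (simp add: mult.assoc)
    qed
  qed measurable
qed

text \<open>Dominated convergence: the kernel grows at a rate strictly below that of a general Fock
  function, so a common bound of Fock type on the \<open>F m\<close> leaves an integrable
  majorant.\<close>

lemma ip_Kr_tendsto:
  assumes g: "g \<in> Sp \<Omega>" and F: "\<And>m. F m \<in> Fk" and f: "f \<in> Fk"
    and lim: "\<And>z. (\<lambda>m. F m z) \<longlonglongrightarrow> f z" and B: "\<And>m z. cmod (F m z) \<le> B * exp (kap / 2 * nm z)"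
  shows "(\<lambda>m. ip (F m) (Kr g c v)) \<longlonglongrightarrow> ip f (Kr g c v)"
  unfolding ip_def
proof (rule integral_dominated_convergence[where w = "\<lambda>u. B * exp (kap / 2 * nm u) * cmod (Kr g c v u)"])
  note [measurable] = borel_Kr1[OF g] Fk_measurable[OF f] Fk_measurable[OF F]
  show "(\<lambda>z. f z * cnj (Kr g c v z)) \<in> borel_measurable gauss" "(\<lambda>z. F m z * cnj (Kr g c v z)) \<in> borel_measurable gauss" for m
    by measurable
  show "AE z in gauss. (\<lambda>m. F m z * cnj (Kr g c v z)) \<longlonglongrightarrow> f z * cnj (Kr g c v z)"
    by (intro AE_I2 tendsto_mult lim tendsto_const)
  show "AE z in gauss. norm (F m z * cnj (Kr g c v z)) \<le> B * exp (kap / 2 * nm z) * cmod (Kr g c v z)" for m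
    by (intro AE_I2) (simp only: norm_mult complex_mod_cnj, intro mult_right_mono B norm_ge_zero)
qed (rule Kr_exp_integrable[OF g])

lemma sq_dil_le: assumes f: "f \<in> Fk" shows "sq (dil m f) \<le> 4 ^ length ubs * sq f"
proof -
  have "(1/2)\<^sup>2 \<le> (dil_factor m)\<^sup>2" using dil_factor[of m] by (intro power_mono) auto
  hence "1 / (dil_factor m)\<^sup>2 \<le> 4" using dil_factor[of m] by (simp add: field_simps power2_eq_square)
  hence "(1 / (dil_factor m)\<^sup>2) ^ length ubs * sq f \<le> 4 ^ length ubs * sq f"
    by (intro mult_right_mono power_mono) (auto simp: sq_nonneg)
  thus ?thesis using sq_dil[OF f, of m] by linarith
qed

lemma pointwise_bound_le:
  assumes "f \<in> Fk" "sq f \<le> s" shows "cmod (f z) \<le> (s + 1) / 2 * exp (kap / 2 * nm z)"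
  using assms(2) by (intro order_trans[OF Fk_pointwise_bound[OF assms(1)]] mult_right_mono) auto

lemma Uop_dil_lim:
  assumes g: "g \<in> Sp \<Omega>" and f: "f \<in> Fk" shows "(\<lambda>m. Uop g c (dil m f) z) \<longlonglongrightarrow> Uop g c f z"
  unfolding Uop_def
  by (rule ip_Kr_tendsto[OF Sp_inv[OF g] dil_Fk[OF f] f dil_lim[OF f] pointwise_bound_le[OF dil_Fk[OF f] sq_dil_le[OF f]]])

text \<open>Dilations preserve pointwise convergence of the images, and their norms exceed that of f
  by factors tending to 1; Fatou's lemma then gives membership and contraction. Equality of norms
  has to wait for the inverse.\<close>

lemma Uop_Fk:
  assumes n: "normalised g c" and f: "f \<in> Fk"
  shows "Uop g c f \<in> Fk" and "sq (Uop g c f) \<le> sq f"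
proof -
  have g: "g \<in> Sp \<Omega>" using n by (rule normalised_Sp)
  have h: "hol (Uop g c f)" by (rule hol_Uop[OF g f])
  note [measurable] = hol_measurable[OF h] Fk_measurable[OF Uop_nice(1)[OF n dil_nice[OF f]]]
  have "(\<integral>\<^sup>+z. ennreal ((cmod (Uop g c f z))\<^sup>2) \<partial>gauss) = (\<integral>\<^sup>+z. liminf (\<lambda>m. ennreal ((cmod (Uop g c (dil m f) z))\<^sup>2)) \<partial>gauss)"
  proof (rule nn_integral_cong)
    fix z
    have "(\<lambda>m. ennreal ((cmod (Uop g c (dil m f) z))\<^sup>2)) \<longlonglongrightarrow> ennreal ((cmod (Uop g c f z))\<^sup>2)"
      by (intro tendsto_ennrealI tendsto_intros Uop_dil_lim[OF g f])
    thus "ennreal ((cmod (Uop g c f z))\<^sup>2) = liminf (\<lambda>m. ennreal ((cmod (Uop g c (dil m f) z))\<^sup>2))"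
      by (intro lim_imp_Liminf[symmetric]) auto
  qed
  also have "\<dots> \<le> liminf (\<lambda>m. \<integral>\<^sup>+z. ennreal ((cmod (Uop g c (dil m f) z))\<^sup>2) \<partial>gauss)"
    by (rule nn_integral_liminf) measurable
  also have "\<dots> \<le> liminf (\<lambda>m. ennreal ((1 / (dil_factor m)\<^sup>2) ^ length ubs * sq f))"
    by (intro Liminf_mono always_eventually allI)
       (simp only: nn_sq[OF Uop_nice(1)[OF n dil_nice[OF f]]] Uop_nice(2)[OF n dil_nice[OF f]], intro ennreal_leI sq_dil f)
  also have "\<dots> = ennreal ((1 / 1\<^sup>2) ^ length ubs * sq f)"
    by (intro lim_imp_Liminf tendsto_ennrealI tendsto_intros dil_factor_lim) auto
  finally have le: "(\<integral>\<^sup>+z. ennreal ((cmod (Uop g c f z))\<^sup>2) \<partial>gauss) \<le> ennreal (sq f)" by simp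
  hence "(\<integral>\<^sup>+z. ennreal ((cmod (Uop g c f z))\<^sup>2) \<partial>gauss) < \<infinity>" by (simp add: le_less_trans ennreal_less_top)
  hence "integrable gauss (\<lambda>z. (cmod (Uop g c f z))\<^sup>2)" by (intro integrableI_bounded) auto
  thus F: "Uop g c f \<in> Fk" using h by (simp add: Fock_iff)
  show "sq (Uop g c f) \<le> sq f" using le unfolding nn_sq[OF F] by (subst (asm) ennreal_le_iff) (auto simp: sq_nonneg)
qed

text \<open>The inversion formula for the dilations, passed to the limit on both sides; the uniform
  norm bound supplies the majorant for \<open>ip_Kr_tendsto\<close>.\<close>

lemma Uop_inverse:
  assumes n: "normalised g c" and f: "f \<in> Fk" shows "Uop (iv g) (cnj c) (Uop g c f) = f"
proof
  fix z
  have g: "g \<in> Sp \<Omega>" using n by (rule normalised_Sp)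
  have s: "sq (Uop g c (dil m f)) \<le> 4 ^ length ubs * sq f" for m
    using sq_dil_le[OF f, of m] Uop_nice(2)[OF n dil_nice[OF f]] by simp
  have "(\<lambda>m. ip (Uop g c (dil m f)) (Kr g c z)) \<longlonglongrightarrow> ip (Uop g c f) (Kr g c z)"
    by (rule ip_Kr_tendsto[OF g Uop_nice(1)[OF n dil_nice[OF f]] Uop_Fk(1)[OF n f] Uop_dil_lim[OF g f]
        pointwise_bound_le[OF Uop_nice(1)[OF n dil_nice[OF f]] s]])
  moreover have "ip (Uop g c (dil m f)) (Kr g c z) = dil m f z" for m
    by (rule Uop_inverse_nice[OF n dil_nice[OF f]])
  ultimately have "(\<lambda>m. dil m f z) \<longlonglongrightarrow> ip (Uop g c f) (Kr g c z)" by simp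
  hence "ip (Uop g c f) (Kr g c z) = f z" using LIMSEQ_unique dil_lim[OF f] by blast
  thus "Uop (iv g) (cnj c) (Uop g c f) z = f z" by (simp add: Uop_def SpD(6)[OF g])
qed

text \<open>Both the operator and its inverse are contractions.\<close>

lemma Uop_sq: assumes n: "normalised g c" and f: "f \<in> Fk" shows "sq (Uop g c f) = sq f"
  using Uop_Fk(2)[OF normalised_inv[OF n] Uop_Fk(1)[OF n f]] Uop_Fk(2)[OF n f] by (simp add: Uop_inverse[OF n f])

lemma sq_add: assumes "f \<in> Fk" "k \<in> Fk" shows "sq (\<lambda>z. f z + k z) = sq f + 2 * Re (ip f k) + sq k"
proof -
  have I: "integrable gauss (\<lambda>z. Re (f z * cnj (k z)))" using integrable_Re[OF Fk_mult[OF assms]] .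
  have "sq (\<lambda>z. f z + k z) = (\<integral>z. (cmod (f z))\<^sup>2 + 2 * Re (f z * cnj (k z)) + (cmod (k z))\<^sup>2 \<partial>gauss)"
  proof (rule Bochner_Integration.integral_cong[OF refl])
    fix z
    show "(cmod (f z + k z))\<^sup>2 = (cmod (f z))\<^sup>2 + 2 * Re (f z * cnj (k z)) + (cmod (k z))\<^sup>2"
      unfolding cmod_power2 by (simp add: power2_eq_square algebra_simps)
  qed
  also have "\<dots> = sq f + 2 * Re (ip f k) + sq k"
  proof -
    have "(\<integral>z. a z + 2 * b z + c z \<partial>gauss) = (\<integral>z. a z \<partial>gauss) + 2 * (\<integral>z. b z \<partial>gauss) + (\<integral>z. c z \<partial>gauss)"
      if "integrable gauss a" "integrable gauss b" "integrable gauss c" for a b c :: "'v \<Rightarrow> real" using that by simp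
    from this[OF Fk_sq[OF assms(1)] I Fk_sq[OF assms(2)]] show ?thesis
      by (simp only: ip_def integral_Re[OF Fk_mult[OF assms]])
  qed
  finally show ?thesis .
qed

text \<open>Polarisation: the norm of a sum gives real parts, and replacing f by -i f gives
  imaginary parts.\<close>

lemma Uop_ip: assumes n: "normalised g c" and f: "f \<in> Fk" and k: "k \<in> Fk" shows "ip (Uop g c f) (Uop g c k) = ip f k"
proof -
  have g: "g \<in> Sp \<Omega>" using n by (rule normalised_Sp)
  have Re: "Re (ip (Uop g c f) (Uop g c k)) = Re (ip f k)" if f: "f \<in> Fk" for f
    using Uop_sq[OF n Fk_add[OF f k]] sq_add[OF f k] sq_add[OF Uop_Fk(1)[OF n f] Uop_Fk(1)[OF n k]]
    by (simp add: Uop_add[OF g f k] Uop_sq[OF n f] Uop_sq[OF n k])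
  have "Re (ip (Uop g c (\<lambda>z. - \<i> * f z)) (Uop g c k)) = Re (ip (\<lambda>z. - \<i> * f z) k)"
    by (rule Re[OF Fk_cmult[OF f]])
  hence "Im (ip (Uop g c f) (Uop g c k)) = Im (ip f k)"
    unfolding Uop_cmult ip_cmult_left by simp
  thus ?thesis using Re[OF f] by (simp add: complex_eq_iff)
qed

section \<open>Operators restricted to the Fock space and their membership in Mp^c\<close>

definition UO :: "('v \<Rightarrow> 'v) \<Rightarrow> complex \<Rightarrow> ('v \<Rightarrow> complex) \<Rightarrow> ('v \<Rightarrow> complex)" where
  "UO g c = restrict (Uop g c) Fk"

lemma UO_FU: assumes n: "normalised g c" shows "UO g c \<in> FU"
proof (rule FU_I)
  have g: "g \<in> Sp \<Omega>" using n by (rule normalised_Sp)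
  have "bij_betw (Uop g c) Fk Fk"
  proof (rule bij_betw_byWitness[where f' = "Uop (iv g) (cnj c)"])
    show "\<forall>f\<in>Fk. Uop (iv g) (cnj c) (Uop g c f) = f" using Uop_inverse[OF n] by blast
    show "\<forall>f\<in>Fk. Uop g c (Uop (iv g) (cnj c) f) = f"
      using Uop_inverse[OF normalised_inv[OF n]] by (simp add: SpD(6)[OF g])
  qed (use Uop_Fk(1)[OF n] Uop_Fk(1)[OF normalised_inv[OF n]] in auto)
  thus "bij_betw (UO g c) Fk Fk" unfolding UO_def by simp
qed (use Uop_add[OF normalised_Sp[OF n]] Uop_cmult Uop_ip[OF n] Fk_add Fk_cmult in \<open>auto simp: UO_def\<close>)

lemma UO_parameters: assumes n: "normalised g c" shows "has_parameters h \<Omega> j (UO g c) g c"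
  by (simp add: has_parameters_Kr UO_def coherent_Fk Uop_coherent[OF normalised_Sp[OF n]])

lemma U_op_UO: assumes n: "normalised g c" shows "U_op h \<Omega> j g c = UO g c"
  unfolding U_op_def
proof (rule the_equality)
  fix U assume "U \<in> FU \<and> has_parameters h \<Omega> j U g c"
  thus "U = UO g c" using UO_parameters[OF n] by (intro FU_unique UO_FU[OF n]) (auto simp: has_parameters_Kr)
qed (use UO_FU[OF n] UO_parameters[OF n] in auto)

lemma heis_eq: "f \<in> Fk \<Longrightarrow> heisenberg_op h \<Omega> j v t f = (\<lambda>z. exp (- \<i> * of_real t / of_real (hbar h)) * W v f z)"
  by (simp add: heisenberg_op_W)

lemma heis_Fk: "f \<in> Fk \<Longrightarrow> heisenberg_op h \<Omega> j v t f \<in> Fk"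
  unfolding heis_eq by (intro Fk_cmult W_Fk)

lemma UO_Mpc: assumes n: "normalised g c" shows "(UO g c, g) \<in> carrier (Mpc h \<Omega> j)"
proof -
  have g: "g \<in> Sp \<Omega>" using n by (rule normalised_Sp)
  have "heisenberg_op h \<Omega> j (g v) t f = UO g c (heisenberg_op h \<Omega> j v t (inv_into Fk (UO g c) f))" if f: "f \<in> Fk" for f v t
  proof -
    define k where "k = inv_into Fk (UO g c) f"
    have b: "bij_betw (UO g c) Fk Fk" by (rule FU_D(2)[OF UO_FU[OF n]])
    have k: "k \<in> Fk" "UO g c k = f"
      using b f unfolding k_def by (auto simp: bij_betw_def f_inv_into_f inv_into_into)
    have Uk: "Uop g c k = f" using k by (simp add: UO_def)
    have "UO g c (heisenberg_op h \<Omega> j v t k) = Uop g c (heisenberg_op h \<Omega> j v t k)"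
      by (simp add: UO_def heis_Fk k(1))
    also have "\<dots> = (\<lambda>z. exp (- \<i> * of_real t / of_real (hbar h)) * W (g v) f z)"
      unfolding heis_eq[OF k(1)] Uop_cmult Uop_W[OF g k(1)] Uk by (rule refl)
    finally show ?thesis by (simp add: heis_eq[OF f] k_def)
  qed
  thus ?thesis by (simp add: Mpc_def UO_FU[OF n] g)
qed

subsection \<open>The group \<open>Mp\<^sup>c\<close>\<close>

lemma FU_compose: assumes U: "U \<in> FU" and V: "V \<in> FU" shows "compose Fk U V \<in> FU"
proof (rule FU_I)
  show "bij_betw (compose Fk U V) Fk Fk" by (rule bij_betw_compose[OF FU_D(2)[OF V] FU_D(2)[OF U]])
  show "compose Fk U V (\<lambda>z. f z + g z) = (\<lambda>z. compose Fk U V f z + compose Fk U V g z)" if "f \<in> Fk" "g \<in> Fk" for f g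
    using that by (simp add: compose_def Fk_add FU_D(3,4)[OF V] FU_D(4)[OF U])
  show "compose Fk U V (\<lambda>z. c * f z) = (\<lambda>z. c * compose Fk U V f z)" if "f \<in> Fk" for c f
    using that by (simp add: compose_def Fk_cmult FU_D(3,5)[OF V] FU_D(5)[OF U])
  show "ip (compose Fk U V f) (compose Fk U V g) = ip f g" if "f \<in> Fk" "g \<in> Fk" for f g
    using that by (simp add: compose_def FU_D(3,6)[OF V] FU_D(6)[OF U])
qed (simp add: compose_extensional)

lemma FU_id: "(\<lambda>f\<in>Fk. f) \<in> FU"
proof (rule FU_I)
  show "bij_betw (\<lambda>f\<in>Fk. f) Fk Fk" by (subst bij_betw_restrict_eq) (simp add: bij_betw_def)
qed (auto simp: Fk_add Fk_cmult)

lemma FU_inverse: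
  assumes U: "U \<in> FU"
  defines "V \<equiv> restrict (inv_into Fk U) Fk"
  shows "V \<in> FU" "\<And>f. f \<in> Fk \<Longrightarrow> V f \<in> Fk" "\<And>f. f \<in> Fk \<Longrightarrow> U (V f) = f" "\<And>f. f \<in> Fk \<Longrightarrow> V (U f) = f"
proof -
  have b: "bij_betw U Fk Fk" by (rule FU_D(2)[OF U])
  show V: "V f \<in> Fk" if "f \<in> Fk" for f using that b by (auto simp: V_def bij_betw_def inv_into_into)
  show UV: "U (V f) = f" if "f \<in> Fk" for f
    using that b f_inv_into_f[of f U Fk] by (simp add: V_def bij_betw_def)
  show VU: "V (U f) = f" if "f \<in> Fk" for f using that b FU_D(3)[OF U that] by (auto simp: V_def bij_betw_def)
  show "V \<in> FU"
  proof (rule FU_I)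
    show "bij_betw V Fk Fk"
      unfolding V_def using bij_betw_inv_into[OF b] by simp
    show "V (\<lambda>z. f z + g z) = (\<lambda>z. V f z + V g z)" if "f \<in> Fk" "g \<in> Fk" for f g
    proof -
      have "U (\<lambda>z. V f z + V g z) = (\<lambda>z. f z + g z)" using that by (simp add: FU_D(4)[OF U] V UV)
      thus ?thesis using VU[OF Fk_add[OF V V], OF that] by simp
    qed
    show "V (\<lambda>z. c * f z) = (\<lambda>z. c * V f z)" if "f \<in> Fk" for c f
    proof -
      have "U (\<lambda>z. c * V f z) = (\<lambda>z. c * f z)" using that by (simp add: FU_D(5)[OF U] V UV)
      thus ?thesis using VU[OF Fk_cmult[OF V], OF that, of c] by simp
    qed
    show "ip (V f) (V g) = ip f g" if "f \<in> Fk" "g \<in> Fk" for f g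
      using FU_D(6)[OF U V V, OF that] that by (simp add: UV)
  qed (simp add: V_def)
qed

text \<open>The intertwining relation without an inverse operator; in this form it passes to
  products and inverses by substitution.\<close>

lemma Mpc_carrier_iff:
  "(U, g) \<in> carrier (Mpc h \<Omega> j) \<longleftrightarrow> U \<in> FU \<and> g \<in> Sp \<Omega> \<and>
     (\<forall>v t. \<forall>f\<in>Fk. U (heisenberg_op h \<Omega> j v t f) = heisenberg_op h \<Omega> j (g v) t (U f))"
  (is "?L \<longleftrightarrow> ?R")
proof -
  have "(\<forall>v t. \<forall>f\<in>Fk. heisenberg_op h \<Omega> j (g v) t f = U (heisenberg_op h \<Omega> j v t (inv_into Fk U f))) \<longleftrightarrow>
     (\<forall>v t. \<forall>f\<in>Fk. U (heisenberg_op h \<Omega> j v t f) = heisenberg_op h \<Omega> j (g v) t (U f))" if U: "U \<in> FU"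
  proof -
    have b: "inj_on U Fk" "U ` Fk = Fk" using FU_D(2)[OF U] by (auto simp: bij_betw_def)
    show ?thesis (is "?l \<longleftrightarrow> ?r")
    proof
      assume ?l
      show ?r
      proof (intro allI ballI)
        fix v t f assume f: "f \<in> Fk"
        hence "U f \<in> Fk" by (rule FU_D(3)[OF U])
        hence "heisenberg_op h \<Omega> j (g v) t (U f) = U (heisenberg_op h \<Omega> j v t (inv_into Fk U (U f)))" using \<open>?l\<close> by blast
        thus "U (heisenberg_op h \<Omega> j v t f) = heisenberg_op h \<Omega> j (g v) t (U f)" using f b by simp
      qed
    next
      assume ?r
      show ?l
      proof (intro allI ballI)
        fix v t f assume f: "f \<in> Fk"
        hence "f \<in> U ` Fk" using b by simp
        hence k: "inv_into Fk U f \<in> Fk" "U (inv_into Fk U f) = f" by (rule inv_into_into, rule f_inv_into_f)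
        show "heisenberg_op h \<Omega> j (g v) t f = U (heisenberg_op h \<Omega> j v t (inv_into Fk U f))"
          using \<open>?r\<close> k by simp
      qed
    qed
  qed
  thus ?thesis by (auto simp: Mpc_def)
qed

lemma compose_apply: "f \<in> Fk \<Longrightarrow> compose Fk U V f = U (V f)" by (simp add: compose_def)

lemma Mpc_mult: "(U, g) \<otimes>\<^bsub>Mpc h \<Omega> j\<^esub> (V, k) = (compose Fk U V, g \<circ> k)" by (simp add: Mpc_def)

lemma Mpc_one: "\<one>\<^bsub>Mpc h \<Omega> j\<^esub> = (\<lambda>f\<in>Fk. f, id)" by (simp add: Mpc_def)

lemma group_Mpc: "group (Mpc h \<Omega> j)" (is "group ?G")
proof (rule groupI)
  fix x y assume "x \<in> carrier ?G" "y \<in> carrier ?G"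
  then obtain U g V k where xy: "x = (U, g)" "y = (V, k)" and x: "(U, g) \<in> carrier ?G" and y: "(V, k) \<in> carrier ?G"
    by (cases x; cases y) auto
  show "x \<otimes>\<^bsub>?G\<^esub> y \<in> carrier ?G"
    using x y unfolding xy Mpc_mult Mpc_carrier_iff
    by (auto simp: FU_compose Sp_comp compose_apply heis_Fk FU_D(3))
next
  show "\<one>\<^bsub>?G\<^esub> \<in> carrier ?G"
    unfolding Mpc_one Mpc_carrier_iff by (simp add: FU_id Sp_id heis_Fk)
next
  fix x y z assume "x \<in> carrier ?G" "y \<in> carrier ?G" "z \<in> carrier ?G"
  then obtain U g V k W l where xyz: "x = (U, g)" "y = (V, k)" "z = (W, l)" and z: "(W, l) \<in> carrier ?G"
    by (cases x; cases y; cases z) auto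
  have "W f \<in> Fk" if "f \<in> Fk" for f using z that FU_D(3) by (simp add: Mpc_carrier_iff)
  hence "compose Fk (compose Fk U V) W = compose Fk U (compose Fk V W)"
    by (auto simp: compose_def fun_eq_iff)
  thus "x \<otimes>\<^bsub>?G\<^esub> y \<otimes>\<^bsub>?G\<^esub> z = x \<otimes>\<^bsub>?G\<^esub> (y \<otimes>\<^bsub>?G\<^esub> z)" by (simp add: xyz Mpc_mult comp_assoc)
next
  fix x assume "x \<in> carrier ?G"
  then obtain U g where x: "x = (U, g)" "U \<in> FU" "g \<in> Sp \<Omega>" 
    and e: "\<And>v t f. f \<in> Fk \<Longrightarrow> U (heisenberg_op h \<Omega> j v t f) = heisenberg_op h \<Omega> j (g v) t (U f)"
    by (cases x) (auto simp: Mpc_carrier_iff)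
  \<comment> \<open>Equality also concerns arguments outside the Fock space; extensionality of U
    settles it.\<close>
  have "compose Fk (\<lambda>f\<in>Fk. f) U = U"
    by (rule extensionalityI[where A = Fk]) (auto simp: compose_def FU_D[OF x(2)])
  thus "\<one>\<^bsub>?G\<^esub> \<otimes>\<^bsub>?G\<^esub> x = x" by (simp add: Mpc_one x(1) Mpc_mult)
  let ?V = "restrict (inv_into Fk U) Fk"
  note V = FU_inverse[OF x(2)]
  have "?V (heisenberg_op h \<Omega> j v t f) = heisenberg_op h \<Omega> j (iv g v) t (?V f)" if f: "f \<in> Fk" for v t f
  proof -
    have "U (heisenberg_op h \<Omega> j (iv g v) t (?V f)) = heisenberg_op h \<Omega> j v t f"
      using e[OF V(2)[OF f], of "iv g v" t] V(3)[OF f] by (simp only: SpD(5)[OF x(3)])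
    thus ?thesis using V(4)[OF heis_Fk[OF V(2)[OF f]]] by metis
  qed
  hence "(?V, iv g) \<in> carrier ?G" by (simp only: Mpc_carrier_iff V(1) Sp_inv[OF x(3)]) blast
  moreover have "compose Fk ?V U = (\<lambda>f\<in>Fk. f)"
    unfolding compose_def by (rule restrict_ext) (rule V(4))
  moreover have "iv g \<circ> g = id" using SpD(4)[OF x(3)] by (simp add: fun_eq_iff)
  ultimately show "\<exists>y\<in>carrier ?G. y \<otimes>\<^bsub>?G\<^esub> x = \<one>\<^bsub>?G\<^esub>"
    by (intro bexI[of _ "(?V, iv g)"]) (simp_all only: Mpc_mult Mpc_one x(1))
qed

text \<open>Both sides are unitary, so comparing them on coherent states is enough; there the
  composition rule for kernels applies.\<close>

lemma UO_compose:
  assumes n1: "normalised g1 c1" and n2: "normalised g2 c2" and n: "normalised (g1 \<circ> g2) c" and c: "c = c1 * c2 * Jint g1 g2"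
  shows "compose Fk (UO g1 c1) (UO g2 c2) = UO (g1 \<circ> g2) c"
proof (rule FU_unique[OF FU_compose[OF UO_FU[OF n1] UO_FU[OF n2]] UO_FU[OF n]])
  fix v
  note g1 = normalised_Sp[OF n1] note g2 = normalised_Sp[OF n2]
  have "compose Fk (UO g1 c1) (UO g2 c2) (ev v) = Uop g1 c1 (Kr g2 c2 v)"
    by (simp add: compose_def coherent_Fk UO_def Uop_coherent[OF g2] Kr_Fk[OF g2])
  also have "\<dots> = Kr (g1 \<circ> g2) c v"
    by (rule ext, subst Kr_scale) (simp only: Uop_def ip_Kr_Kr[OF g1 g2] c complex_cnj_cnj mult_ac)
  also have "\<dots> = UO (g1 \<circ> g2) c (ev v)"
    by (simp only: UO_def restrict_apply' coherent_Fk Uop_coherent[OF normalised_Sp[OF n]] if_True restrict_def)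
  finally show "compose Fk (UO g1 c1) (UO g2 c2) (ev v) = UO (g1 \<circ> g2) c (ev v)" .
qed


subsection \<open>Determinants of complex-linear maps\<close>

definition jlin :: "'v set \<Rightarrow> ('v \<Rightarrow> 'v) \<Rightarrow> bool" where
  "jlin X A \<longleftrightarrow> linear A \<and> (\<forall>v. A (j v) = j (A v)) \<and> A ` X \<subseteq> X"

lemma jlin_sc: "jlin X A \<Longrightarrow> A (sc c v) = sc c (A v)"
  by (simp add: jlin_def jscale_def linear_add linear_scale)

lemma jlin_sum: "jlin X A \<Longrightarrow> A (\<Sum>i\<in>I. f i) = (\<Sum>i\<in>I. A (f i))"
  by (simp add: jlin_def linear_sum)

definition jsub :: "'v set \<Rightarrow> bool" where
  "jsub X \<longleftrightarrow> subspace X \<and> (\<forall>w\<in>X. j w \<in> X)"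

lemma jsub_orthonormal_basis: "jsub X \<Longrightarrow> \<exists>bs. orthonormal_basis X bs"
  unfolding jsub_def by (intro orthonormal_basis_exists) auto

text \<open>The basis chosen inside \<open>Det_on\<close>. It need not be orthonormal, so adjoints
  require a change of basis.\<close>

definition jbasis :: "'v set \<Rightarrow> 'v list" where "jbasis X = (SOME bs. is_jbasis j X bs)"

lemma jbasis: assumes "jsub X" shows "is_jbasis j X (jbasis X)"
proof -
  obtain bs where "orthonormal_basis X bs" using jsub_orthonormal_basis[OF assms] by blast
  hence "is_jbasis j X bs" using assms by (intro orthonormal_basis_is_jbasis) (auto simp: jsub_def)
  thus ?thesis unfolding jbasis_def by (rule someI)
qed

definition coord :: "'v set \<Rightarrow> nat \<Rightarrow> 'v \<Rightarrow> complex" where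
  "coord X r v = Modules.module.representation sc (set (jbasis X)) v (jbasis X ! r)"

lemma Det_on_eq: "Det_on j X A = Determinant.det (Matrix.mat (length (jbasis X)) (length (jbasis X)) (\<lambda>(r, c). coord X r (A (jbasis X ! c))))"
  by (simp add: Det_on_def Let_def jbasis_def coord_def)

lemma coord_props:
  assumes X: "jsub X"
  shows "\<And>v. v \<in> X \<Longrightarrow> (\<Sum>r<length (jbasis X). sc (coord X r v) (jbasis X ! r)) = v"
    and "\<And>r f a n. (\<And>i. i < n \<Longrightarrow> f i \<in> X) \<Longrightarrow> coord X r (\<Sum>i<n. sc (a i) (f i)) = (\<Sum>i<n. a i * coord X r (f i))"
    and "\<And>r c. r < length (jbasis X) \<Longrightarrow> c < length (jbasis X) \<Longrightarrow> coord X r (jbasis X ! c) = (if r = c then 1 else 0)"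
    and "\<And>c. c < length (jbasis X) \<Longrightarrow> jbasis X ! c \<in> X"
proof -
  interpret J: vector_space sc by (rule J_vs)
  have b: "distinct (jbasis X)" "J.independent (set (jbasis X))" "J.span (set (jbasis X)) = X"
    using jbasis[OF X] by (auto simp: is_jbasis_def)
  show "(\<Sum>r<length (jbasis X). sc (coord X r v) (jbasis X ! r)) = v" if "v \<in> X" for v
    using J.sum_representation_eq[OF b(2), of v "set (jbasis X)"] that b(3)
    by (simp add: coord_def sum_nth_distinct[OF b(1)])
  show "jbasis X ! c \<in> X" if "c < length (jbasis X)" for c
    using J.span_base[of "jbasis X ! c" "set (jbasis X)"] that b(3) by simp
  have scX: "sc c x \<in> X" if "x \<in> X" for c x
    using J.span_scale[of x "set (jbasis X)" c] that b(3) by simp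
  show "coord X r (\<Sum>i<n. sc (a i) (f i)) = (\<Sum>i<n. a i * coord X r (f i))" if "\<And>i. i < n \<Longrightarrow> f i \<in> X" for r f a n
    using that scX b(3) J.representation_sum[OF b(2), of "{..<n}" "\<lambda>i. sc (a i) (f i)"] J.representation_scale[OF b(2)]
    by (simp add: coord_def)
  show "coord X r (jbasis X ! c) = (if r = c then 1 else 0)" if "r < length (jbasis X)" "c < length (jbasis X)" for r c
    using that J.representation_basis[OF b(2), of "jbasis X ! c"] nth_eq_iff_index_eq[OF b(1)] by (auto simp: coord_def)
qed

lemma Det_on_cong:
  assumes "jsub X" "\<And>v. v \<in> X \<Longrightarrow> A v = B v" shows "Det_on j X A = Det_on j X B"
proof -
  have "Matrix.mat (length (jbasis X)) (length (jbasis X)) (\<lambda>(r, c). coord X r (A (jbasis X ! c))) =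
    Matrix.mat (length (jbasis X)) (length (jbasis X)) (\<lambda>(r, c). coord X r (B (jbasis X ! c)))"
    by (rule eq_matI) (auto simp: assms(2) coord_props(4)[OF assms(1)])
  thus ?thesis by (simp add: Det_on_eq)
qed

text \<open>P and Q are the two base change matrices, with P Q = 1; the matrix in the chosen basis
  is P N Q, and both bases have the length of the complex dimension.\<close>

lemma Det_on_orthonormal_basis:
  assumes X: "jsub X" and A: "jlin X A" and bs: "orthonormal_basis X bs"
  shows "Det_on j X A = Determinant.det (Matrix.mat (length bs) (length bs) (\<lambda>(r, c). H (A (bs ! c)) (bs ! r)))"
proof -
  define m where "m = length (jbasis X)"
  define s where "s = jbasis X"
  have o: "orthonormal X bs" using bs by (simp add: orthonormal_basis_def)
  have bX: "bs ! k \<in> X" if "k < length bs" for k using o nth_mem[OF that] unfolding orthonormal_def by blast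
  have AX: "A v \<in> X" if "v \<in> X" for v using A that by (auto simp: jlin_def)
  note coord = coord_props[OF X, folded m_def s_def]
  have len: "length bs = m"
  proof -
    interpret J: vector_space sc by (rule J_vs)
    have "is_jbasis j X bs" using bs X by (intro orthonormal_basis_is_jbasis) (auto simp: jsub_def)
    hence "J.dim X = card (set bs)" "J.dim X = card (set s)"
      using jbasis[OF X] J.dim_span_eq_card_independent[of "set bs"] J.dim_span_eq_card_independent[of "set s"]
      by (auto simp: is_jbasis_def s_def)
    thus ?thesis using orthonormal_distinct[OF o] jbasis[OF X] by (simp add: distinct_card is_jbasis_def s_def m_def)
  qed
  define P where "P = Matrix.mat m m (\<lambda>(r, l). coord X r (bs ! l))"
  define Q where "Q = Matrix.mat m m (\<lambda>(k, c). H (s ! c) (bs ! k))"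
  define N where "N = Matrix.mat m m (\<lambda>(r, c). H (A (bs ! c)) (bs ! r))"
  have car: "P \<in> carrier_mat m m" "Q \<in> carrier_mat m m" "N \<in> carrier_mat m m" by (auto simp: P_def Q_def N_def)
  have ex: "v = (\<Sum>k<m. sc (H v (bs ! k)) (bs ! k))" if "v \<in> X" for v
    using orthonormal_basis_expand[OF bs that] len by simp
  have PQ: "P * Q = 1\<^sub>m m"
  proof (rule eq_matI)
    fix r c assume "r < dim_row (1\<^sub>m m :: complex mat)" "c < dim_col (1\<^sub>m m :: complex mat)"
    hence rc: "r < m" "c < m" by auto
    have "(P * Q) $$ (r, c) = (\<Sum>l<m. H (s ! c) (bs ! l) * coord X r (bs ! l))"
      using rc by (simp add: P_def Q_def scalar_prod_def atLeast0LessThan mult.commute)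
    also have "\<dots> = coord X r (\<Sum>l<m. sc (H (s ! c) (bs ! l)) (bs ! l))"
      by (rule coord(2)[symmetric]) (use bX len in auto)
    also have "\<dots> = coord X r (s ! c)" using ex[OF coord(4)[OF rc(2)]] by simp
    finally show "(P * Q) $$ (r, c) = 1\<^sub>m m $$ (r, c)" using rc coord(3) by simp
  qed (auto simp: P_def Q_def)
  have "Matrix.mat m m (\<lambda>(r, c). coord X r (A (s ! c))) = P * N * Q"
  proof (rule eq_matI)
    fix r c assume "r < dim_row (P * N * Q)" "c < dim_col (P * N * Q)"
    hence rc: "r < m" "c < m" by (auto simp: P_def Q_def)
    have "A (s ! c) = A (\<Sum>k<m. sc (H (s ! c) (bs ! k)) (bs ! k))" using ex[OF coord(4)[OF rc(2)]] by simp
    also have "\<dots> = (\<Sum>k<m. sc (H (s ! c) (bs ! k)) (A (bs ! k)))" by (simp add: jlin_sum[OF A] jlin_sc[OF A])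
    finally have "coord X r (A (s ! c)) = (\<Sum>k<m. H (s ! c) (bs ! k) * coord X r (A (bs ! k)))"
      using coord(2)[of m "\<lambda>k. A (bs ! k)" r "\<lambda>k. H (s ! c) (bs ! k)"] bX AX len by simp
    also have "\<dots> = (\<Sum>k<m. (\<Sum>l<m. coord X r (bs ! l) * H (A (bs ! k)) (bs ! l)) * H (s ! c) (bs ! k))"
    proof (rule sum.cong[OF refl])
      fix k assume "k \<in> {..<m}"
      hence "A (bs ! k) \<in> X" using bX AX len by simp
      hence "coord X r (A (bs ! k)) = coord X r (\<Sum>l<m. sc (H (A (bs ! k)) (bs ! l)) (bs ! l))" using ex by simp
      also have "\<dots> = (\<Sum>l<m. H (A (bs ! k)) (bs ! l) * coord X r (bs ! l))"
        by (rule coord(2)) (use bX len in auto)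
      finally show "H (s ! c) (bs ! k) * coord X r (A (bs ! k)) = (\<Sum>l<m. coord X r (bs ! l) * H (A (bs ! k)) (bs ! l)) * H (s ! c) (bs ! k)"
        by (simp add: mult.commute)
    qed
    also have "\<dots> = (P * N * Q) $$ (r, c)"
      using rc by (simp add: P_def Q_def N_def scalar_prod_def atLeast0LessThan)
    finally show "Matrix.mat m m (\<lambda>(r, c). coord X r (A (s ! c))) $$ (r, c) = (P * N * Q) $$ (r, c)" using rc by simp
  qed (auto simp: P_def Q_def)
  hence "Det_on j X A = Determinant.det (P * N * Q)" by (simp add: Det_on_eq m_def s_def)
  also have "\<dots> = Determinant.det P * Determinant.det N * Determinant.det Q"
    using det_mult[OF mult_carrier_mat[OF car(1,3)] car(2)] det_mult[OF car(1,3)] by simp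
  also have "\<dots> = Determinant.det (P * Q) * Determinant.det N"
    using det_mult[OF car(1,2)] by (simp add: mult_ac)
  finally show ?thesis by (simp add: PQ N_def len)
qed

lemma Det_on_comp:
  assumes X: "jsub X" and A: "jlin X A" and B: "jlin X B"
  shows "Det_on j X (\<lambda>v. A (B v)) = Det_on j X A * Det_on j X B"
proof -
  define m where "m = length (jbasis X)"
  define s where "s = jbasis X"
  note coord = coord_props[OF X, folded m_def s_def]
  have AX: "A v \<in> X" if "v \<in> X" for v using A that by (auto simp: jlin_def)
  have BX: "B v \<in> X" if "v \<in> X" for v using B that by (auto simp: jlin_def)
  let ?A = "Matrix.mat m m (\<lambda>(r, c). coord X r (A (s ! c)))"
  let ?B = "Matrix.mat m m (\<lambda>(r, c). coord X r (B (s ! c)))"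
  have "Matrix.mat m m (\<lambda>(r, c). coord X r (A (B (s ! c)))) = ?A * ?B"
  proof (rule eq_matI)
    fix r c assume "r < dim_row (?A * ?B)" "c < dim_col (?A * ?B)"
    hence rc: "r < m" "c < m" by auto
    have "A (B (s ! c)) = A (\<Sum>k<m. sc (coord X k (B (s ! c))) (s ! k))" using coord(1)[OF BX[OF coord(4)[OF rc(2)]]] by simp
    also have "\<dots> = (\<Sum>k<m. sc (coord X k (B (s ! c))) (A (s ! k)))" by (simp add: jlin_sum[OF A] jlin_sc[OF A])
    finally have "coord X r (A (B (s ! c))) = (\<Sum>k<m. coord X k (B (s ! c)) * coord X r (A (s ! k)))"
      using coord(2)[of m "\<lambda>k. A (s ! k)" r "\<lambda>k. coord X k (B (s ! c))"] AX coord(4) by simp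
    also have "\<dots> = (?A * ?B) $$ (r, c)"
      using rc by (simp add: scalar_prod_def atLeast0LessThan mult.commute)
    finally show "Matrix.mat m m (\<lambda>(r, c). coord X r (A (B (s ! c)))) $$ (r, c) = (?A * ?B) $$ (r, c)" using rc by simp
  qed auto
  thus ?thesis by (simp add: Det_on_eq m_def s_def det_mult[of _ "length (jbasis X)"])
qed

lemma Det_on_id: assumes X: "jsub X" shows "Det_on j X (\<lambda>v. v) = 1"
proof -
  have "Matrix.mat (length (jbasis X)) (length (jbasis X)) (\<lambda>(r, c). coord X r (jbasis X ! c)) = 1\<^sub>m (length (jbasis X))"
    by (rule eq_matI) (auto simp: coord_props(3)[OF X])
  thus ?thesis by (simp add: Det_on_eq)
qed

lemma det_cnj: "Determinant.det (Matrix.mat m m (\<lambda>(r, c). cnj (f r c))) = cnj (Determinant.det (Matrix.mat m m (\<lambda>(r, c). f r c)))"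
proof -
  interpret cnj: comm_ring_hom cnj by standard auto
  have "Matrix.mat m m (\<lambda>(r, c). cnj (f r c)) = map_mat cnj (Matrix.mat m m (\<lambda>(r, c). f r c))" by (rule eq_matI) auto
  thus ?thesis by simp
qed

text \<open>In an orthonormal basis the adjoint has the conjugate transpose as its matrix.\<close>

lemma Det_on_adjoint:
  assumes X: "jsub X" and A: "jlin X A" and B: "jlin X B" and adj: "\<And>v w. H (A v) w = H v (B w)"
  shows "Det_on j X B = cnj (Det_on j X A)"
proof -
  obtain bs where bs: "orthonormal_basis X bs" using jsub_orthonormal_basis[OF X] by blast
  let ?m = "length bs"
  let ?N = "\<lambda>A. Matrix.mat ?m ?m (\<lambda>(r, c). H (A (bs ! c)) (bs ! r))"
  have "H (B (bs ! c)) (bs ! r) = cnj (H (A (bs ! r)) (bs ! c))" for r c by (simp add: H_cnj adj)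
  hence "?N B = Matrix.mat ?m ?m (\<lambda>(r, c). cnj (H (A (bs ! r)) (bs ! c)))" by simp
  hence "Determinant.det (?N B) = cnj (Determinant.det (Matrix.mat ?m ?m (\<lambda>(r, c). H (A (bs ! r)) (bs ! c))))"
    by (simp only: det_cnj)
  also have "Matrix.mat ?m ?m (\<lambda>(r, c). H (A (bs ! r)) (bs ! c)) = transpose_mat (?N A)" by (rule eq_matI) auto
  also have "Determinant.det \<dots> = Determinant.det (?N A)" by (rule det_transpose) auto
  finally show ?thesis by (simp add: Det_on_orthonormal_basis[OF X A bs] Det_on_orthonormal_basis[OF X B bs])
qed

end

lemma sum_lessThan_add: "(\<Sum>k<p + q. f k) = (\<Sum>k<p. f k) + (\<Sum>k<q. f (p + k))"
  for p q :: nat and f :: "nat \<Rightarrow> 'a::comm_monoid_add"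
  by (induction q) (simp_all add: add.assoc)

text \<open>A unipotent lower block triangular factor clears the lower left block. It will reduce a
  determinant on all of V to one on V_- alone.\<close>

lemma det_block_one:
  fixes B Cm :: "'a::idom mat"
  assumes B: "B \<in> carrier_mat p q" and Cm: "Cm \<in> carrier_mat q p"
  shows "Determinant.det (four_block_mat (1\<^sub>m p) B Cm (1\<^sub>m q)) = Determinant.det (1\<^sub>m q - Cm * B)"
proof -
  let ?P = "four_block_mat (1\<^sub>m p) B Cm (1\<^sub>m q)"
  let ?U = "four_block_mat (1\<^sub>m p) (0\<^sub>m p q) (- Cm) (1\<^sub>m q)"
  have CB: "Cm * B \<in> carrier_mat q q" using mult_carrier_mat[OF Cm B] .
  have "?U * ?P = four_block_mat (1\<^sub>m p * 1\<^sub>m p + 0\<^sub>m p q * Cm) (1\<^sub>m p * B + 0\<^sub>m p q * 1\<^sub>m q)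
     (- Cm * 1\<^sub>m p + 1\<^sub>m q * Cm) (- Cm * B + 1\<^sub>m q * 1\<^sub>m q)"
    by (rule mult_four_block_mat) (use B Cm in auto)
  also have "1\<^sub>m p * 1\<^sub>m p + 0\<^sub>m p q * Cm = 1\<^sub>m p" using Cm by simp
  also have "1\<^sub>m p * B + 0\<^sub>m p q * 1\<^sub>m q = B" using B by simp
  also have "- Cm * 1\<^sub>m p + 1\<^sub>m q * Cm = 0\<^sub>m q p" using Cm by (simp add: uminus_l_inv_mat)
  also have "- Cm * B + 1\<^sub>m q * 1\<^sub>m q = 1\<^sub>m q - Cm * B"
    using B Cm CB by (intro eq_matI) auto
  finally have UP: "?U * ?P = four_block_mat (1\<^sub>m p) B (0\<^sub>m q p) (1\<^sub>m q - Cm * B)" .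
  have cU: "?U \<in> carrier_mat (p + q) (p + q)" "?P \<in> carrier_mat (p + q) (p + q)"
    by (rule four_block_carrier_mat; use B Cm in auto)+
  have CB': "1\<^sub>m q - Cm * B \<in> carrier_mat q q" by (rule minus_carrier_mat[OF CB])
  have d1: "Determinant.det (?U * ?P) = Determinant.det ?U * Determinant.det ?P" by (rule det_mult[OF cU])
  have d2: "Determinant.det (four_block_mat (1\<^sub>m p) B (0\<^sub>m q p) (1\<^sub>m q - Cm * B)) =
      Determinant.det (1\<^sub>m p :: 'a mat) * Determinant.det (1\<^sub>m q - Cm * B)"
    by (rule det_four_block_mat_lower_left_zero[OF one_carrier_mat B refl CB'])
  have d3: "Determinant.det ?U = Determinant.det (1\<^sub>m p :: 'a mat) * Determinant.det (1\<^sub>m q :: 'a mat)"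
    by (rule det_four_block_mat_upper_right_zero[OF one_carrier_mat refl _ one_carrier_mat]) (use Cm in auto)
  show ?thesis using d1 unfolding UP d2 d3 det_one by (simp only: mult_1_left)
qed

section \<open>The splitting of V into V_+ and V_-, and Gaussian integrals adapted to it\<close>

locale fock_space_pm = fock_space h \<Omega> j for h \<Omega> and j :: "'v::real_normed_vector \<Rightarrow> 'v" +
  fixes jt :: "'v \<Rightarrow> 'v"
  assumes jt: "compatible_cs \<Omega> jt" and j_jt_comp: "j \<circ> jt = jt \<circ> j"
begin

abbreviation "Vm \<equiv> V_minus jt j"

definition Vp :: "'v set" where "Vp = {v. jt v = j v}"

lemma linear_jt: "linear jt" and jt_jt [simp]: "jt (jt v) = - v" and \<Omega>_jt [simp]: "\<Omega> (jt v) (jt w) = \<Omega> v w"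
  using jt by (auto simp: compatible_cs_def Sp_def)

lemmas jt_simps [simp] = linear_add[OF linear_jt] linear_diff[OF linear_jt] linear_neg[OF linear_jt]
  linear_scale[OF linear_jt] linear_0[OF linear_jt]

lemma jt_j: "jt (j v) = j (jt v)"
  using fun_cong[OF j_jt_comp, of v] by simp

lemma jsub_Vm: "jsub Vm" and jsub_Vp: "jsub Vp"
  unfolding jsub_def subspace_def V_minus_def Vp_def by (auto simp: jt_j)

lemma VmD: "v \<in> Vm \<Longrightarrow> jt v = - j v" and VpD: "v \<in> Vp \<Longrightarrow> jt v = j v"
  by (auto simp: V_minus_def Vp_def)

text \<open>The map \<open>jt\<close> preserves \<Omega> but acts on the two spaces as j and as -j,
  so \<Omega>(x, y) is its own negative.\<close>

lemma H_Vp_Vm: assumes x: "x \<in> Vp" and y: "y \<in> Vm" shows "H x y = 0" "H y x = 0"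
proof -
  have 0: "\<Omega> x y = 0" if y: "y \<in> Vm" for y
  proof -
    have "\<Omega> x y = \<Omega> (jt x) (jt y)" by simp
    also have "\<dots> = - \<Omega> x y" unfolding VpD[OF x] VmD[OF y] by (simp add: \<Omega>_simps)
    finally show ?thesis by simp
  qed
  have "j y \<in> Vm" using y jsub_Vm by (auto simp: jsub_def)
  thus "H x y = 0" using 0 y by (simp add: herm_def)
  thus "H y x = 0" by (metis H_cnj complex_cnj_zero)
qed

definition bp :: "'v list" where "bp = (SOME bs. orthonormal_basis Vp bs)"
definition bm :: "'v list" where "bm = (SOME bs. orthonormal_basis Vm bs)"

lemma orthonormal_basis_bp: "orthonormal_basis Vp bp" and orthonormal_basis_bm: "orthonormal_basis Vm bm"
  unfolding bp_def bm_def by (rule someI_ex[OF jsub_orthonormal_basis[OF jsub_Vp]], rule someI_ex[OF jsub_orthonormal_basis[OF jsub_Vm]])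

definition bpm :: "'v list" where "bpm = bp @ bm"

abbreviation "np \<equiv> length bp"
abbreviation "nmi \<equiv> length bm"

lemma bpm_nth: "i < np \<Longrightarrow> bpm ! i = bp ! i" "bpm ! (np + i) = bm ! i"
  by (simp_all add: bpm_def nth_append)

lemma bp_Vp: "i < np \<Longrightarrow> bp ! i \<in> Vp" and bm_Vm: "i < nmi \<Longrightarrow> bm ! i \<in> Vm"
  using orthonormal_basis_bp orthonormal_basis_bm nth_mem unfolding orthonormal_basis_def orthonormal_def by blast+

lemma length_bpm: "length bpm = np + nmi" by (simp add: bpm_def)

lemma sum_bpm: "(\<Sum>k<np + nmi. f k) = (\<Sum>k<np. f k) + (\<Sum>k<nmi. f (np + k))"
  by (rule sum_lessThan_add)

lemma orthonormal_basis_bpm: "orthonormal_basis UNIV bpm"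
  unfolding orthonormal_basis_def
proof
  have op: "orthonormal Vp bp" and om: "orthonormal Vm bm" using orthonormal_basis_bp orthonormal_basis_bm by (auto simp: orthonormal_basis_def)
  show "orthonormal UNIV bpm" unfolding orthonormal_def
  proof (intro conjI allI impI)
    fix k l assume kl: "k < length bpm" "l < length bpm"
    consider "k < np" "l < np" | "k < np" "\<not> l < np" | "\<not> k < np" "l < np" | "\<not> k < np" "\<not> l < np" by blast
    thus "H (bpm ! k) (bpm ! l) = (if k = l then 1 else 0)"
    proof cases
      case 1 thus ?thesis using orthonormal_nth[OF op] by (simp add: bpm_nth)
    next
      case 2
      hence "bpm ! k \<in> Vp" "bpm ! l \<in> Vm" using kl bp_Vp bm_Vm by (auto simp: bpm_def nth_append)
      thus ?thesis using 2 H_Vp_Vm(1) by auto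
    next
      case 3
      hence "bpm ! k \<in> Vm" "bpm ! l \<in> Vp" using kl bp_Vp bm_Vm by (auto simp: bpm_def nth_append)
      thus ?thesis using 3 H_Vp_Vm(2) by auto
    next
      case 4
      have "H (bm ! (k - np)) (bm ! (l - np)) = (if k - np = l - np then 1 else 0)"
        by (rule orthonormal_nth[OF om]) (use 4 kl in \<open>auto simp: bpm_def\<close>)
      thus ?thesis using 4 by (auto simp: bpm_def nth_append)
    qed
  qed auto
  show "\<forall>w\<in>UNIV. w = (\<Sum>k<length bpm. sc (H w (bpm ! k)) (bpm ! k))"
  proof
    fix w
    \<comment> \<open>The product j jt is an involution since the two commute; it is -1 on V_+ and 1
      on V_-, so x and y are the two projections of w.\<close>
    define x where "x = (1/2) *\<^sub>R (w - j (jt w))"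
    define y where "y = (1/2) *\<^sub>R (w + j (jt w))"
    have w: "w = x + y" by (simp add: x_def y_def scaleR_add_right[symmetric] scaleR_2[symmetric])
    have x: "x \<in> Vp" and y: "y \<in> Vm" by (auto simp: x_def y_def Vp_def V_minus_def jt_j algebra_simps)
    have "(\<Sum>k<length bpm. sc (H w (bpm ! k)) (bpm ! k)) =
       (\<Sum>k<np. sc (H w (bp ! k)) (bp ! k)) + (\<Sum>k<nmi. sc (H w (bm ! k)) (bm ! k))"
      by (simp add: length_bpm sum_bpm bpm_nth)
    also have "\<dots> = (\<Sum>k<np. sc (H x (bp ! k)) (bp ! k)) + (\<Sum>k<nmi. sc (H y (bm ! k)) (bm ! k))"
      using H_Vp_Vm(1)[OF x bm_Vm] H_Vp_Vm(2)[OF bp_Vp y] by (simp add: w H_simps)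
    also have "\<dots> = w" using orthonormal_basis_expand[OF orthonormal_basis_bp x] orthonormal_basis_expand[OF orthonormal_basis_bm y] w by simp
    finally show "w = (\<Sum>k<length bpm. sc (H w (bpm ! k)) (bpm ! k))" by simp
  qed
qed

text \<open>
  Coordinates that are conjugated on \<open>V\<^sub>+\<close>: in them, the bilinear Gaussian exponents coming from
  maps that interchange \<open>V\<^sub>+\<close> and \<open>V\<^sub>-\<close> become sesquilinear.
\<close>

definition conj_cmb :: "(nat \<Rightarrow> complex) \<Rightarrow> 'v" where
  "conj_cmb x = cmb bpm (\<lambda>i. if i < np then cnj (x i) else x i)"

lemma param_conj_cmb: "param (np + nmi) conj_cmb"
  unfolding param_def
proof (intro conjI allI impI)
  have p: "param (np + nmi) (cmb bpm)" using param_cmb[OF orthonormal_basis_bpm] by (simp add: length_bpm)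
  show "continuous_on UNIV conj_cmb" unfolding conj_cmb_def cmb_def
  proof (intro continuous_on_sum continuous_sc)
    fix k show "continuous_on UNIV (\<lambda>x. if k < np then cnj (x k) else x k)"
      by (cases "k < np") (auto intro!: continuous_intros continuous_on_product_coordinates)
  qed
  show "conj_cmb (\<lambda>i. x i + y i) = conj_cmb x + conj_cmb y" for x y
  proof -
    have "(\<lambda>i. if i < np then cnj (x i + y i) else x i + y i) =
      (\<lambda>i. (if i < np then cnj (x i) else x i) + (if i < np then cnj (y i) else y i))" by auto
    thus ?thesis using p by (simp add: conj_cmb_def param_def)
  qed
  show "conj_cmb x = conj_cmb y" if "\<forall>i<np + nmi. x i = y i" for x y
    unfolding conj_cmb_def by (rule param_cong[OF p]) (use that in auto)
  show "surj conj_cmb"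
  proof (rule surjI)
    fix v
    have "(\<lambda>i. if i < np then cnj (if i < np then cnj (crd bpm v i) else crd bpm v i)
        else (if i < np then cnj (crd bpm v i) else crd bpm v i)) = crd bpm v" by auto
    thus "conj_cmb (\<lambda>i. if i < np then cnj (crd bpm v i) else crd bpm v i) = v"
      by (simp only: conj_cmb_def cmb_crd[OF orthonormal_basis_bpm])
  qed
  show "nm (conj_cmb x) = (\<Sum>i<np + nmi. (cmod (x i))\<^sup>2)" for x
  proof -
    have "nm (conj_cmb x) = (\<Sum>i<np + nmi. (cmod (if i < np then cnj (x i) else x i))\<^sup>2)"
      using p by (simp add: conj_cmb_def param_def)
    also have "\<dots> = (\<Sum>i<np + nmi. (cmod (x i))\<^sup>2)" by (rule sum.cong) auto
    finally show ?thesis .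
  qed
qed

text \<open>The properties of Z_g for pseudo-unitary g that the Gaussian integral depends
  on.\<close>

definition swaps_pm :: "('v \<Rightarrow> 'v) \<Rightarrow> bool" where
  "swaps_pm A \<longleftrightarrow> linear A \<and> (\<forall>v. A (j v) = - j (A v)) \<and> A ` Vp \<subseteq> Vm \<and> A ` Vm \<subseteq> Vp \<and>
     (\<forall>v w. H (A v) w = H (A w) v)"

lemma swaps_pm_sc: "swaps_pm A \<Longrightarrow> A (sc c v) = sc (cnj c) (A v)"
  by (simp add: swaps_pm_def jscale_def linear_add linear_scale)

lemma swaps_pm_H: "swaps_pm A \<Longrightarrow> H v (A w) = H w (A v)"
  unfolding swaps_pm_def by (metis H_cnj)

lemma swaps_pm_swaps_pm_Vm: "swaps_pm A \<Longrightarrow> swaps_pm B \<Longrightarrow> v \<in> Vm \<Longrightarrow> B (A v) \<in> Vm"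
  unfolding swaps_pm_def by blast

lemma jlin_comp: "jlin X A \<Longrightarrow> jlin X B \<Longrightarrow> jlin X (\<lambda>v. A (B v))"
  using linear_compose[of B A] unfolding jlin_def comp_def by (simp add: image_subset_iff)

lemma jlin_diff_swaps_pm: assumes A: "swaps_pm A" and B: "swaps_pm B" shows "jlin Vm (\<lambda>v. v - B (A v))"
  unfolding jlin_def
proof (intro conjI allI subsetI)
  have lA: "linear A" "A (j v) = - j (A v)" and lB: "linear B" "B (j v) = - j (B v)" for v
    using A B by (auto simp: swaps_pm_def)
  have "linear (\<lambda>v. B (A v))" using linear_compose[OF lA(1) lB(1)] by (simp add: comp_def)
  thus "linear (\<lambda>v. v - B (A v))" by (intro linear_compose_sub linear_ident)
  show "j v - B (A (j v)) = j (v - B (A v))" for v by (simp add: lA(2) lB(2) linear_neg[OF lB(1)])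
  fix w assume "w \<in> (\<lambda>v. v - B (A v)) ` Vm"
  then obtain v where v: "v \<in> Vm" "w = v - B (A v)" by blast
  have "subspace Vm" using jsub_Vm by (simp add: jsub_def)
  thus "w \<in> Vm" unfolding v(2) by (rule subspace_diff[OF _ v(1) swaps_pm_swaps_pm_Vm[OF A B v(1)]])
qed

text \<open>By orthogonality only the two cross terms survive, and symmetry makes them equal. They
  are bilinear in the coordinates on V_+ and V_-; conjugating those on V_+ gives a sesquilinear
  expression.\<close>

lemma swaps_pm_quadratic:
  assumes A: "swaps_pm A"
  shows "H (conj_cmb x) (A (conj_cmb x)) = 2 * (\<Sum>i<np. \<Sum>l<nmi. cnj (x i) * H (bp ! i) (A (bm ! l)) * x (np + l))"
proof -
  define u where "u = (\<Sum>i<np. sc (cnj (x i)) (bp ! i))"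
  define v where "v = (\<Sum>l<nmi. sc (x (np + l)) (bm ! l))"
  have L: "conj_cmb x = u + v" by (simp add: conj_cmb_def cmb_def length_bpm sum_bpm bpm_nth u_def v_def)
  have sV: "sc c w \<in> X" if "jsub X" "w \<in> X" for c w X
    using that unfolding jscale_def jsub_def by (auto intro!: subspace_add subspace_scale)
  have u: "u \<in> Vp" unfolding u_def using jsub_Vp by (intro subspace_sum sV bp_Vp) (auto simp: jsub_def)
  have v: "v \<in> Vm" unfolding v_def using jsub_Vm by (intro subspace_sum sV bm_Vm) (auto simp: jsub_def)
  have l: "linear A" and Au: "A u \<in> Vm" and Av: "A v \<in> Vp" using A u v by (auto simp: swaps_pm_def)
  have "H (conj_cmb x) (A (conj_cmb x)) = H u (A v) + H v (A u)"
    by (simp add: L linear_add[OF l] H_simps H_Vp_Vm(1)[OF u Au] H_Vp_Vm(2)[OF Av v])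
  also have "\<dots> = 2 * H u (A v)" using swaps_pm_H[OF A, of v u] by simp
  also have "H u (A v) = (\<Sum>i<np. \<Sum>l<nmi. cnj (x i) * H (bp ! i) (A (bm ! l)) * x (np + l))"
    unfolding u_def v_def
    by (simp add: linear_sum[OF l] swaps_pm_sc[OF A] H_sum_left H_sum_right H_sc_left H_sc_right sum_distrib_left mult_ac)
       (rule sum.swap)
  finally show ?thesis .
qed

text \<open>A block matrix with identity diagonal blocks: A fills the block from V_- to V_+, and B,
  which enters the integral conjugated, fills the opposite one.\<close>

definition block_form :: "('v \<Rightarrow> 'v) \<Rightarrow> ('v \<Rightarrow> 'v) \<Rightarrow> nat \<Rightarrow> nat \<Rightarrow> complex" where
  "block_form A B i l = (if i = l then 1 else 0) + (if i < np \<and> np \<le> l then H (bpm ! i) (A (bpm ! l)) else 0)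
     + (if np \<le> i \<and> l < np then H (B (bpm ! i)) (bpm ! l) else 0)"

lemma block_form_form:
  assumes A: "swaps_pm A" and B: "swaps_pm B"
  shows "(\<Sum>i<np + nmi. \<Sum>l<np + nmi. cnj (x i) * (of_real kap * block_form A B i l) * x l) =
    of_real (kap * nm (conj_cmb x)) + of_real (kap / 2) * (H (conj_cmb x) (A (conj_cmb x)) + cnj (H (conj_cmb x) (B (conj_cmb x))))"
proof -
  let ?SA = "\<Sum>i<np. \<Sum>l<nmi. cnj (x i) * H (bp ! i) (A (bm ! l)) * x (np + l)"
  let ?SB = "\<Sum>i<np. \<Sum>l<nmi. cnj (x i) * H (bp ! i) (B (bm ! l)) * x (np + l)"
  have D: "(\<Sum>i<np + nmi. \<Sum>l<np + nmi. cnj (x i) * (if i = l then 1 else 0) * x l) = of_real (nm (conj_cmb x))"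
  proof -
    have "(\<Sum>i<np + nmi. \<Sum>l<np + nmi. cnj (x i) * (if i = l then 1 else 0) * x l) =
       (\<Sum>i<np + nmi. \<Sum>l<np + nmi. if i = l then cnj (x i) * x l else 0)"
      by (intro sum.cong) auto
    also have "\<dots> = (\<Sum>i<np + nmi. cnj (x i) * x i)" by (intro sum.cong) auto
    also have "\<dots> = of_real (\<Sum>i<np + nmi. (cmod (x i))\<^sup>2)"
      unfolding of_real_sum complex_norm_square by (simp add: mult.commute)
    finally show ?thesis using param_conj_cmb by (simp add: param_def)
  qed
  have SA: "(\<Sum>i<np + nmi. \<Sum>l<np + nmi. cnj (x i) * (if i < np \<and> np \<le> l then H (bpm ! i) (A (bpm ! l)) else 0) * x l) = ?SA"
    unfolding sum_bpm by (simp add: bpm_nth)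
  have SB: "(\<Sum>i<np + nmi. \<Sum>l<np + nmi. cnj (x i) * (if np \<le> i \<and> l < np then H (B (bpm ! i)) (bpm ! l) else 0) * x l) = cnj ?SB"
  proof -
    have "(\<Sum>i<np + nmi. \<Sum>l<np + nmi. cnj (x i) * (if np \<le> i \<and> l < np then H (B (bpm ! i)) (bpm ! l) else 0) * x l) =
      (\<Sum>i<nmi. \<Sum>l<np. cnj (x (np + i)) * H (B (bm ! i)) (bp ! l) * x l)"
      unfolding sum_bpm by (simp add: bpm_nth)
    also have "\<dots> = (\<Sum>l<np. \<Sum>i<nmi. cnj (x (np + i)) * H (B (bm ! i)) (bp ! l) * x l)" by (rule sum.swap)
    also have "\<dots> = cnj ?SB" by (simp add: H_cnj mult_ac)
    finally show ?thesis .
  qed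
  have "(\<Sum>i<np + nmi. \<Sum>l<np + nmi. cnj (x i) * (of_real kap * block_form A B i l) * x l) =
    of_real kap * ((\<Sum>i<np + nmi. \<Sum>l<np + nmi. cnj (x i) * (if i = l then 1 else 0) * x l) +
      (\<Sum>i<np + nmi. \<Sum>l<np + nmi. cnj (x i) * (if i < np \<and> np \<le> l then H (bpm ! i) (A (bpm ! l)) else 0) * x l) +
      (\<Sum>i<np + nmi. \<Sum>l<np + nmi. cnj (x i) * (if np \<le> i \<and> l < np then H (B (bpm ! i)) (bpm ! l) else 0) * x l))"
    unfolding block_form_def sum_distrib_left sum.distrib[symmetric] by (intro sum.cong) (auto simp: algebra_simps)
  also have "\<dots> = of_real kap * (of_real (nm (conj_cmb x)) + ?SA + cnj ?SB)" by (simp only: D SA SB)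
  also have "\<dots> = of_real (kap * nm (conj_cmb x)) + of_real (kap / 2) * (2 * ?SA + cnj (2 * ?SB))"
    by (simp add: field_simps)
  finally show ?thesis by (simp only: swaps_pm_quadratic[OF A] swaps_pm_quadratic[OF B])
qed

text \<open>Block elimination leaves 1 - b a, with a and b the blocks of A and B. Expanding the
  image under A in the basis of V_+ and using the symmetry of B identifies b a with the matrix of B
  A on V_-.\<close>

lemma det_block_form:
  assumes A: "swaps_pm A" and B: "swaps_pm B"
  shows "Determinant.det (Matrix.mat (np + nmi) (np + nmi) (\<lambda>(i, l). block_form A B i l)) = Det_on j Vm (\<lambda>v. v - B (A v))"
proof -
  let ?a = "Matrix.mat np nmi (\<lambda>(i, l). H (bp ! i) (A (bm ! l)))"
  let ?b = "Matrix.mat nmi np (\<lambda>(i, l). H (B (bm ! i)) (bp ! l))"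
  have "Matrix.mat (np + nmi) (np + nmi) (\<lambda>(i, l). block_form A B i l) = four_block_mat (1\<^sub>m np) ?a ?b (1\<^sub>m nmi)"
  proof (rule eq_matI)
    fix i l assume "i < dim_row (four_block_mat (1\<^sub>m np) ?a ?b (1\<^sub>m nmi))" "l < dim_col (four_block_mat (1\<^sub>m np) ?a ?b (1\<^sub>m nmi))"
    hence "i < np + nmi" "l < np + nmi" by auto
    thus "Matrix.mat (np + nmi) (np + nmi) (\<lambda>(i, l). block_form A B i l) $$ (i, l) = four_block_mat (1\<^sub>m np) ?a ?b (1\<^sub>m nmi) $$ (i, l)"
      by (auto simp: block_form_def bpm_def nth_append)
  qed auto
  hence "Determinant.det (Matrix.mat (np + nmi) (np + nmi) (\<lambda>(i, l). block_form A B i l)) = Determinant.det (1\<^sub>m nmi - ?b * ?a)"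
    by (simp only:) (rule det_block_one, auto)
  also have "1\<^sub>m nmi - ?b * ?a = Matrix.mat nmi nmi (\<lambda>(r, c). H (bm ! c - B (A (bm ! c))) (bm ! r))"
  proof (rule eq_matI)
    fix r c assume "r < dim_row (Matrix.mat nmi nmi (\<lambda>(r, c). H (bm ! c - B (A (bm ! c))) (bm ! r)))"
      "c < dim_col (Matrix.mat nmi nmi (\<lambda>(r, c). H (bm ! c - B (A (bm ! c))) (bm ! r)))"
    hence rc: "r < nmi" "c < nmi" by auto
    have Ac: "A (bm ! c) \<in> Vp" using A bm_Vm[OF rc(2)] by (auto simp: swaps_pm_def)
    have "H (B (A (bm ! c))) (bm ! r) = H (B (bm ! r)) (A (bm ! c))" using B by (simp add: swaps_pm_def)
    also have "\<dots> = H (B (bm ! r)) (\<Sum>k<np. sc (H (A (bm ! c)) (bp ! k)) (bp ! k))"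
      by (simp only: orthonormal_basis_expand[OF orthonormal_basis_bp Ac])
    also have "\<dots> = (\<Sum>k<np. H (B (bm ! r)) (bp ! k) * H (bp ! k) (A (bm ! c)))"
      by (simp add: H_sum_right H_sc_right H_cnj mult.commute)
    finally have e: "H (B (A (bm ! c))) (bm ! r) = (\<Sum>k<np. H (B (bm ! r)) (bp ! k) * H (bp ! k) (A (bm ! c)))" .
    have "H (bm ! c) (bm ! r) = (if r = c then 1 else 0)"
      using orthonormal_nth[of Vm bm c r] orthonormal_basis_bm rc by (auto simp: orthonormal_basis_def)
    thus "(1\<^sub>m nmi - ?b * ?a) $$ (r, c) = Matrix.mat nmi nmi (\<lambda>(r, c). H (bm ! c - B (A (bm ! c))) (bm ! r)) $$ (r, c)"
      using rc by (simp add: scalar_prod_def atLeast0LessThan H_diff_left e)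
  qed auto
  also have "Determinant.det \<dots> = Det_on j Vm (\<lambda>v. v - B (A v))"
  proof (rule Det_on_orthonormal_basis[OF jsub_Vm _ orthonormal_basis_bm, symmetric])
    show "jlin Vm (\<lambda>v. v - B (A v))" by (rule jlin_diff_swaps_pm[OF A B])
  qed
  finally show ?thesis .
qed

text \<open>In the conjugated coordinates the exponent is a sesquilinear form with matrix kap times
  \<open>block_form A B\<close>, so \<open>gauss_CPi\<close> yields a full inverse determinant; the
  powers of pi and \<open>kap\<close> cancel against the normalisation of
  \<open>gauss\<close>.\<close>

lemma gauss_swaps_pm:
  assumes A: "swaps_pm A" and B: "swaps_pm B" and r: "r1 < 1" "r2 < 1"
    and Ab: "\<And>v. cmod (H v (A v)) \<le> r1 * nm v" and Bb: "\<And>v. cmod (H v (B v)) \<le> r2 * nm v"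
  shows "(\<integral>z. exp (- of_real (kap / 2) * (H z (A z) + cnj (H z (B z)))) \<partial>gauss) = 1 / Det_on j Vm (\<lambda>v. v - B (A v))"
proof -
  let ?n = "np + nmi"
  let ?Q = "\<lambda>x. \<Sum>i<?n. \<Sum>l<?n. cnj (x i) * (of_real kap * block_form A B i l) * x l"
  have lA: "linear A" and lB: "linear B" using A B by (auto simp: swaps_pm_def)
  have m: "(\<lambda>z. exp (- of_real (kap / 2) * (H z (A z) + cnj (H z (B z))))) \<in> borel_measurable borel"
    by (intro borel_measurable_continuous_onI continuous_intros continuous_on_linear[OF lA] continuous_on_linear[OF lB])
  \<comment> \<open>What remains of the Gaussian decay \<open>kap\<close> after subtracting the
    bounds kap/2 r1 and kap/2 r2 on the two quadratic terms.\<close>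
  define e where "e = kap / 2 * (2 - r1 - r2)"
  have e: "e > 0" using kap_pos r by (simp add: e_def)
  have coord: "Re (?Q x) \<ge> e * (\<Sum>i<?n. (cmod (x i))\<^sup>2)" for x
  proof -
    have n: "nm (conj_cmb x) = (\<Sum>i<?n. (cmod (x i))\<^sup>2)" using param_conj_cmb by (simp add: param_def)
    have "- Re (H (conj_cmb x) (A (conj_cmb x))) \<le> r1 * nm (conj_cmb x)" "- Re (H (conj_cmb x) (B (conj_cmb x))) \<le> r2 * nm (conj_cmb x)"
      using Ab[of "conj_cmb x"] Bb[of "conj_cmb x"] abs_Re_le_cmod[of "H (conj_cmb x) (A (conj_cmb x))"] abs_Re_le_cmod[of "H (conj_cmb x) (B (conj_cmb x))"] by linarith+
    hence "kap / 2 * (- Re (H (conj_cmb x) (A (conj_cmb x))) + - Re (H (conj_cmb x) (B (conj_cmb x)))) \<le> kap / 2 * (r1 * nm (conj_cmb x) + r2 * nm (conj_cmb x))"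
      using kap_pos by (intro mult_left_mono add_mono) auto
    moreover have "kap / 2 * (- Re (H (conj_cmb x) (A (conj_cmb x))) + - Re (H (conj_cmb x) (B (conj_cmb x)))) =
       - (kap / 2 * Re (H (conj_cmb x) (A (conj_cmb x))) + kap / 2 * Re (H (conj_cmb x) (B (conj_cmb x))))" by (simp add: algebra_simps)
    moreover have "e * nm (conj_cmb x) = kap * nm (conj_cmb x) - kap / 2 * (r1 * nm (conj_cmb x) + r2 * nm (conj_cmb x))"
      by (simp add: e_def field_simps)
    moreover have "Re (?Q x) = kap * nm (conj_cmb x) + (kap / 2 * Re (H (conj_cmb x) (A (conj_cmb x))) + kap / 2 * Re (H (conj_cmb x) (B (conj_cmb x))))"
      unfolding block_form_form[OF A B] by (simp add: algebra_simps)
    ultimately show ?thesis unfolding n[symmetric] by linarith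
  qed
  note G = gauss_CPi[of e ?n "\<lambda>i l. of_real kap * block_form A B i l", OF e coord]
  have "exp (- kap * (\<Sum>i<?n. (cmod (x i))\<^sup>2)) *\<^sub>R exp (- of_real (kap / 2) * (H (conj_cmb x) (A (conj_cmb x)) + cnj (H (conj_cmb x) (B (conj_cmb x))))) = exp (- ?Q x)" for x
  proof -
    have n: "(\<Sum>i<?n. (cmod (x i))\<^sup>2) = nm (conj_cmb x)" using param_conj_cmb by (simp add: param_def)
    show ?thesis unfolding block_form_form[OF A B] n scaleR_conv_of_real exp_of_real[symmetric] mult_exp_exp
      by (rule arg_cong[where f = exp]) (simp add: algebra_simps)
  qed
  hence "(\<integral>z. exp (- of_real (kap / 2) * (H z (A z) + cnj (H z (B z)))) \<partial>gauss) = (\<integral>x. exp (- ?Q x) \<partial>CPi ?n) / of_real ((pi / kap) ^ ?n)"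
    by (simp only: gauss_integral_param[OF param_conj_cmb m])
  also have "(\<integral>x. exp (- ?Q x) \<partial>CPi ?n) = pi ^ ?n / Determinant.det (Matrix.mat ?n ?n (\<lambda>(i, l). of_real kap * block_form A B i l))"
    using G by (rule conjunct2)
  also have "Matrix.mat ?n ?n (\<lambda>(i, l). of_real kap * block_form A B i l) = of_real kap \<cdot>\<^sub>m Matrix.mat ?n ?n (\<lambda>(i, l). block_form A B i l)"
    by (rule eq_matI) auto
  also have "Determinant.det \<dots> = of_real kap ^ ?n * Det_on j Vm (\<lambda>v. v - B (A v))"
    by (simp only: det_smult det_block_form[OF A B] dim_col_mat)
  also have "pi ^ ?n / (of_real kap ^ ?n * Det_on j Vm (\<lambda>v. v - B (A v))) / of_real ((pi / kap) ^ ?n) = 1 / Det_on j Vm (\<lambda>v. v - B (A v))"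
    using kap_pos by (simp add: power_divide)
  finally show ?thesis .
qed

subsection \<open>The pseudo-unitary group\<close>

definition PU :: "('v \<Rightarrow> 'v) set" where "PU = {g \<in> Sp \<Omega>. g \<circ> jt = jt \<circ> g}"

lemma PU_Sp: "g \<in> PU \<Longrightarrow> g \<in> Sp \<Omega>" by (simp add: PU_def)

lemma PU_jt: "g \<in> PU \<Longrightarrow> g (jt v) = jt (g v)"
  unfolding PU_def by (auto dest: fun_cong[of _ _ v])

lemma PU_comp: "g1 \<in> PU \<Longrightarrow> g2 \<in> PU \<Longrightarrow> g1 \<circ> g2 \<in> PU"
  by (auto simp: PU_def Sp_comp fun_eq_iff)

lemma PU_id: "id \<in> PU" by (simp add: PU_def Sp_id)

lemma PU_iv: assumes g: "g \<in> PU" shows "iv g \<in> PU"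
proof -
  note gS = PU_Sp[OF g]
  have "iv g (jt v) = jt (iv g v)" for v
  proof -
    have "jt v = g (jt (iv g v))" by (simp only: PU_jt[OF g] SpD(5)[OF gS])
    thus ?thesis using SpD(4)[OF gS] by metis
  qed
  thus ?thesis by (auto simp: PU_def Sp_inv[OF gS])
qed

lemma C_PU_jt: "g \<in> PU \<Longrightarrow> C g (jt v) = jt (C g v)"
  by (simp add: C_part_def PU_jt jt_j[symmetric])

lemma A_PU_jt: "g \<in> PU \<Longrightarrow> A_part g (jt v) = jt (A_part g v)"
  by (simp add: A_part_def PU_jt jt_j[symmetric])

lemma Ci_PU_jt: assumes g: "g \<in> PU" shows "Ci g (jt v) = jt (Ci g v)"
  using Ci_C[OF PU_Sp[OF g], of "jt (Ci g v)"] by (simp add: C_PU_jt[OF g] C_Ci[OF PU_Sp[OF g]])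

lemma Z_PU_jt: "g \<in> PU \<Longrightarrow> Z g (jt v) = jt (Z g v)"
  by (simp add: Z_eq A_PU_jt Ci_PU_jt)

lemma C_Vm: assumes g: "g \<in> PU" and v: "v \<in> Vm" shows "C g v \<in> Vm"
proof -
  have l: "linear (C g)" by (rule C_linear[OF SpD(1)[OF PU_Sp[OF g]]])
  have "jt (C g v) = C g (- j v)" by (simp add: C_PU_jt[OF g, symmetric] VmD[OF v])
  thus ?thesis by (simp add: V_minus_def linear_neg[OF l] C_j[OF SpD(1)[OF PU_Sp[OF g]]])
qed

text \<open>Z_g commutes with \<open>jt\<close> but anticommutes with j, so it exchanges the space
  where they agree with the space where they are opposite.\<close>

lemma swaps_pm_Z: assumes g: "g \<in> PU" shows "swaps_pm (Z g)"
proof -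
  note gS = PU_Sp[OF g]
  have "Z g v \<in> Vm" if "v \<in> Vp" for v
  proof -
    have "jt (Z g v) = Z g (j v)" by (simp add: Z_PU_jt[OF g, symmetric] VpD[OF that])
    thus ?thesis by (simp add: V_minus_def Z_j[OF gS])
  qed
  moreover have "Z g v \<in> Vp" if "v \<in> Vm" for v
  proof -
    have "jt (Z g v) = Z g (- j v)" by (simp add: Z_PU_jt[OF g, symmetric] VmD[OF that])
    thus ?thesis by (simp add: Vp_def linear_neg[OF Z_linear[OF gS]] Z_j[OF gS])
  qed
  ultimately show ?thesis using Z_linear[OF gS] Z_j[OF gS] H_Z[OF gS] by (auto simp: swaps_pm_def)
qed

lemma jlin_C: "g \<in> PU \<Longrightarrow> jlin Vm (C g)"
  using C_Vm by (auto simp: jlin_def C_linear C_j SpD(1)[OF PU_Sp])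

abbreviation "DC g \<equiv> Det_on j Vm (C g)"

text \<open>With zero parameters the two kernels reduce to exponentials of their Z-terms, the second
  one conjugated, which is the integrand of \<open>gauss_swaps_pm\<close>.\<close>

lemma Jint_Det:
  assumes g1: "g1 \<in> PU" and g2: "g2 \<in> PU"
  shows "Jint g1 g2 = 1 / Det_on j Vm (\<lambda>v. v - Z g1 (Z (iv g2) v))"
proof -
  note s1 = PU_Sp[OF g1] note s2 = PU_Sp[OF PU_iv[OF g2]]
  obtain r1 where r1: "r1 < 1" "\<And>v. cmod (H v (Z (iv g2) v)) \<le> r1 * nm v" using Z_contraction[OF s2] by blast
  obtain r2 where r2: "r2 < 1" "\<And>v. cmod (H v (Z g1 v)) \<le> r2 * nm v" using Z_contraction[OF s1] by blast
  have e: "Kr g2 1 0 z * cnj (Kr (iv g1) 1 0 z) = exp (- of_real (kap / 2) * (H z (Z (iv g2) z) + cnj (H z (Z g1 z))))" for z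
  proof -
    have "cnj (exp (- of_real (kap / 2) * H z (Z (iv (iv g1)) z))) = exp (- of_real (kap / 2) * cnj (H z (Z g1 z)))"
      by (simp add: exp_cnj SpD(6)[OF s1])
    thus ?thesis unfolding Kr_0[OF PU_Sp[OF g2]] Kr_0[OF Sp_inv[OF s1]]
      by (simp only: mult_exp_exp distrib_left)
  qed
  show ?thesis unfolding Jint_def ip_def e
    by (rule gauss_swaps_pm[OF swaps_pm_Z[OF PU_iv[OF g2]] swaps_pm_Z[OF g1] r1(1) r2(1) r1(2) r2(2)])
qed

lemma DC_comp:
  assumes g1: "g1 \<in> PU" and g2: "g2 \<in> PU"
  shows "DC (g1 \<circ> g2) = DC g1 * Det_on j Vm (\<lambda>v. v - Z g1 (Z (iv g2) v)) * DC g2"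
proof -
  note s1 = PU_Sp[OF g1] note s2 = PU_Sp[OF g2]
  let ?N = "\<lambda>v. v - Z g1 (Z (iv g2) v)"
  have A: "swaps_pm (Z (iv g2))" and B: "swaps_pm (Z g1)" using swaps_pm_Z PU_iv g1 g2 by auto
  have N: "jlin Vm ?N"
by (rule jlin_diff_swaps_pm[OF A B])
  have NC: "jlin Vm (\<lambda>v. ?N (C g2 v))" by (rule jlin_comp[OF N jlin_C[OF g2]])
  have "DC (g1 \<circ> g2) = Det_on j Vm (\<lambda>v. C g1 (?N (C g2 v)))"
    by (rule Det_on_cong[OF jsub_Vm]) (rule C_comp[OF s1 s2])
  also have "\<dots> = DC g1 * Det_on j Vm (\<lambda>v. ?N (C g2 v))" by (rule Det_on_comp[OF jsub_Vm jlin_C[OF g1] NC])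
  also have "Det_on j Vm (\<lambda>v. ?N (C g2 v)) = Det_on j Vm ?N * DC g2" by (rule Det_on_comp[OF jsub_Vm N jlin_C[OF g2]])
  finally show ?thesis by (simp only: mult.assoc)
qed

lemma DC_id: "DC id = 1"
proof -
  have "C id v = v" for v by (simp add: C_part_def flip: scaleR_2)
  hence "DC id = Det_on j Vm (\<lambda>v. v)" by (intro Det_on_cong jsub_Vm) simp
  thus ?thesis by (simp add: Det_on_id jsub_Vm)
qed

lemma DC_iv: "g \<in> PU \<Longrightarrow> DC (iv g) = cnj (DC g)"
  by (rule Det_on_adjoint[OF jsub_Vm jlin_C jlin_C[OF PU_iv]]) (auto intro: H_C PU_Sp)

abbreviation "lam g \<equiv> F_lambda jt j g"

lemma lam_DC: "lam g = inverse (DC g)"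
proof -
  have "Det_on j Vm (C_minus jt j g) = DC g" by (rule Det_on_cong[OF jsub_Vm]) (simp add: C_minus_def)
  thus ?thesis by (simp add: F_lambda_def)
qed

text \<open>The total \<open>inverse\<close> lets this hold before the determinants are known to be
  nonzero; that they are follows from the case of a map and its inverse.\<close>

lemma lam_comp: assumes "g1 \<in> PU" "g2 \<in> PU" shows "lam (g1 \<circ> g2) = lam g1 * lam g2 * Jint g1 g2"
  by (simp add: lam_DC DC_comp[OF assms] Jint_Det[OF assms] divide_inverse mult_ac)

lemma lam_iv: "g \<in> PU \<Longrightarrow> lam (iv g) = cnj (lam g)"
  by (simp add: lam_DC DC_iv)

text \<open>Multiplicativity up to J, applied to g^-1 g = 1 and g g^-1 = 1, together with the fact
  that inverting g conjugates \<open>lam\<close>.\<close>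

lemma normalised_lam: assumes g: "g \<in> PU" shows "normalised g (lam g)"
proof -
  have "iv g \<circ> g = id" "g \<circ> iv g = id" using SpD(4,5)[OF PU_Sp[OF g]] by (auto simp: fun_eq_iff)
  hence "lam (iv g) * lam g * Jint (iv g) g = 1" "lam g * lam (iv g) * Jint g (iv g) = 1"
    using lam_comp[OF PU_iv[OF g] g] lam_comp[OF g PU_iv[OF g]] by (simp_all add: lam_DC DC_id)
  thus ?thesis by (simp add: normalised_def PU_Sp[OF g] lam_iv[OF g] mult_ac)
qed

lemma F_map_UO: "g \<in> PU \<Longrightarrow> F_map h \<Omega> jt j g = (UO g (lam g), g)"
  by (simp add: F_map_def U_op_UO[OF normalised_lam])

lemma group_PU: "group (pseudo_unitary_group \<Omega> jt)"
proof (rule groupI)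
  fix g assume "g \<in> carrier (pseudo_unitary_group \<Omega> jt)"
  hence g: "g \<in> PU" by (simp add: pseudo_unitary_group_def PU_def)
  have "iv g \<circ> g = id" using SpD(4)[OF PU_Sp[OF g]] by (auto simp: fun_eq_iff)
  thus "\<exists>k\<in>carrier (pseudo_unitary_group \<Omega> jt). k \<otimes>\<^bsub>pseudo_unitary_group \<Omega> jt\<^esub> g = \<one>\<^bsub>pseudo_unitary_group \<Omega> jt\<^esub>"
    using PU_iv[OF g] by (intro bexI[of _ "iv g"]) (auto simp: pseudo_unitary_group_def PU_def)
qed (use PU_comp PU_id in \<open>auto simp: pseudo_unitary_group_def PU_def comp_assoc\<close>)

lemma F_map_hom: "F_map h \<Omega> jt j \<in> hom (pseudo_unitary_group \<Omega> jt) (Mpc h \<Omega> j)"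
proof (rule homI)
  fix g assume "g \<in> carrier (pseudo_unitary_group \<Omega> jt)"
  hence g: "g \<in> PU" by (simp add: pseudo_unitary_group_def PU_def)
  show "F_map h \<Omega> jt j g \<in> carrier (Mpc h \<Omega> j)" unfolding F_map_UO[OF g] by (rule UO_Mpc[OF normalised_lam[OF g]])
next
  fix g k assume "g \<in> carrier (pseudo_unitary_group \<Omega> jt)" "k \<in> carrier (pseudo_unitary_group \<Omega> jt)"
  hence g: "g \<in> PU" and k: "k \<in> PU" by (auto simp: pseudo_unitary_group_def PU_def)
  have "F_map h \<Omega> jt j (g \<circ> k) = F_map h \<Omega> jt j g \<otimes>\<^bsub>Mpc h \<Omega> j\<^esub> F_map h \<Omega> jt j k"
    unfolding F_map_UO[OF g] F_map_UO[OF k] F_map_UO[OF PU_comp[OF g k]] Mpc_mult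
    by (simp only: UO_compose[OF normalised_lam[OF g] normalised_lam[OF k] normalised_lam[OF PU_comp[OF g k]] lam_comp[OF g k]])
  thus "F_map h \<Omega> jt j (g \<otimes>\<^bsub>pseudo_unitary_group \<Omega> jt\<^esub> k) = F_map h \<Omega> jt j g \<otimes>\<^bsub>Mpc h \<Omega> j\<^esub> F_map h \<Omega> jt j k"
    by (simp add: pseudo_unitary_group_def)
qed

end

theorem proposition2p18:
  fixes h :: real
    and \<Omega> :: "'v::real_normed_vector \<Rightarrow> 'v \<Rightarrow> real"
    and jt j :: "'v \<Rightarrow> 'v"
  assumes "h > 0"
    and "symplectic_form \<Omega>"
    and "compatible_cs \<Omega> jt"
    and "j \<in> j_plus \<Omega>"
    and "j \<circ> jt = jt \<circ> j"
  shows "group_hom (pseudo_unitary_group \<Omega> jt) (Mpc h \<Omega> j) (F_map h \<Omega> jt j)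
    \<and> inj_on (F_map h \<Omega> jt j) (carrier (pseudo_unitary_group \<Omega> jt))
    \<and> (\<forall>g \<in> carrier (pseudo_unitary_group \<Omega> jt).
         C_part j g ` V_minus jt j \<subseteq> V_minus jt j
         \<and> Mpc_sigma (F_map h \<Omega> jt j g) = g
         \<and> has_parameters h \<Omega> j (fst (F_map h \<Omega> jt j g)) g (F_lambda jt j g))"
proof -
  interpret fock_space_pm h \<Omega> j jt by standard fact+
  have "group_hom (pseudo_unitary_group \<Omega> jt) (Mpc h \<Omega> j) (F_map h \<Omega> jt j)"
    by (intro group_hom.intro group_hom_axioms.intro group_PU group_Mpc F_map_hom)
  moreover have "inj_on (F_map h \<Omega> jt j) (carrier (pseudo_unitary_group \<Omega> jt))"
    by (rule inj_onI) (simp add: F_map_def)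
  moreover have "C_part j g ` V_minus jt j \<subseteq> V_minus jt j \<and> Mpc_sigma (F_map h \<Omega> jt j g) = g
     \<and> has_parameters h \<Omega> j (fst (F_map h \<Omega> jt j g)) g (F_lambda jt j g)"
    if "g \<in> carrier (pseudo_unitary_group \<Omega> jt)" for g
  proof -
    have g: "g \<in> PU" using that by (simp add: pseudo_unitary_group_def PU_def)
    show ?thesis using C_Vm[OF g] UO_parameters[OF normalised_lam[OF g]] by (auto simp: F_map_UO[OF g] Mpc_sigma_def)
  qed
  ultimately show ?thesis by blast
qed

end
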